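(* Let $G$ be a real semisimple Lie group with Cartan decomposition $\mathfrak g=\mathfrak k\oplus\mathfrak p$, $G\cong K\times\mathfrak p$, let $\mathfrak a\subset\mathfrak p$ be maximal abelian, $w_0\in\mathfrak a$, and let $\mathbb I$ be an inertia tensor on $\mathfrak k$. Let $\Omega^K$ and $X_{\mathrm{nh}}$ be the canonical symplectic form and the compressed non-holonomic vector field on $TK=K\times\mathfrak k$, and let $\mu_0:K\to\mathrm{End}(\mathfrak k)$ be the metric tensor, all as defined in the context. Let $d=\dim K$ and $$f:=(\det\mu_0)^{-1/2}:K\to\mathbb R_{>0}$$ (regarded as a function on $TK$ by pull-back). Then $$L_{X_{\mathrm{nh}}}\big(f\,(\Omega^K)^d\big)=0.$$
   Context: Let $\theta$ be the Cartan involution of $\mathfrak g$, $B$ the Killing form, $\langle\cdot,\cdot\rangle=-B(\cdot,\theta\,\cdot)$ the associated positive definite inner product. It is $\mathrm{Ad}(K)$-invariant. Let $H=Z_K(w_0)=\{h\in K:\mathrm{Ad}(h)w_0=w_0\}$ with Lie algebra $\mathfrak h$, $\mathfrak h^\perp$ its orthogonal complement in $\mathfrak k$, and $V=\mathrm{ad}(w_0)(\mathfrak h^\perp)\subset\mathfrak p$. The inertia tensor $\mathbb I$ is a symmetric positive definite endomorphism of $(\mathfrak k,\langle\cdot,\cdot\rangle)$. Trivialize $TK=K\times\mathfrak k$ by left multiplication, $u=s^{-1}s'$, and let $\tau:TK\to K$ be the projection. Define the $V$-valued one-form $\mathcal A$ on $K$ by $\mathcal A_s(u)=-[\mathrm{Ad}(s)u,w_0]\in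 V$. (The underlying non-holonomic system has configuration space $Q=K\times V$, Lagrangian $L=\tfrac12\langle\mathbb I u,u\rangle+\tfrac12\langle x',x'\rangle$ and constraint distribution $\mathcal D=\{(s,u,x,-\mathcal A_s(u))\}\subset TK\times TV$; factoring out $V$, i.e. compression, gives the following almost Hamiltonian system on $TK$.) Metric tensor: $\mu_0(s)=\mathbb I+\mathcal A_s^*\mathcal A_s:\mathfrak k\to\mathfrak k$, i.e. $\mu_0(s)=\mathbb I+\mathrm{Ad}(s^{-1})\circ\mathrm{ad}(w_0)^2|_{\mathfrak k}\circ\mathrm{Ad}(s)$. The metric $\langle\mu_0(s)u_1,u_2\rangle$ on $K$ is used to identify $TK=T^*K$; $\Omega^K$ is the canonical symplectic form transported to $TK$, $\Omega^K=-d\theta^K$ with $\theta^K_{(s,u)}(\xi)=\langle\mu_0(s)u,T\tau\,\xi\rangle$ (locally $\Omega^K=\sum dq^i\wedge dp_i$). Compressed Hamiltonian: $\mathcal H_c(s,u)=\tfrac12\langle\mathbb Iu,u\rangle+\tfrac12\langle\mathcal A_s(u),\mathcal A_s(u)\rangle$. Compressed almost symplectic form: $\Omega_{\mathrm{nh}}=\Omega^K+\langle\mathcal A,d\mathcal A\rangle$, where $\langle\mathcal A,d\mathcal A\rangle_{(s,u)}(\xi_1,\xi_2)=\langle\mathcal A_s(u),d\mathcal A(T\tau\,\xi_1,T\tau\,\xi_2)\rangle$ is a 2-form on $TK$. Dynamics: $X_{\mathrm{nh}}$ is the vector field on $TK$ defined by $i(X_{\mathrm{nh}})\Omega_{\mathrm{nh}}=d\mathcal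 H_c$. *)

theory Defs
  imports "HOL-Analysis.Analysis" "HOL-Algebra.Group" "HOL-Combinatorics.Permutations"
begin

section \<open>Smooth maps, manifolds and Lie groups\<close>

text \<open>\<open>C_on k S f\<close>: f is of class \<open>C\<^sup>k\<close> on the open set S of a finite-dimensional space
  (differentiable, with all directional derivatives of class \<open>C\<^sup>k\<^sup>-\<^sup>1\<close>).\<close>

primrec C_on :: "nat \<Rightarrow> 'a::real_normed_vector set \<Rightarrow> ('a \<Rightarrow> 'b::real_normed_vector) \<Rightarrow> bool" where
  "C_on 0 S f \<longleftrightarrow> continuous_on S f"
| "C_on (Suc k) S f \<longleftrightarrow>
     (\<forall>x\<in>S. f differentiable (at x)) \<and> (\<forall>v. C_on k S (\<lambda>x. frechet_derivative f (at x) v))"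

definition smooth_on :: "'a::real_normed_vector set \<Rightarrow> ('a \<Rightarrow> 'b::real_normed_vector) \<Rightarrow> bool" where
  "smooth_on S f \<longleftrightarrow> open S \<and> (\<forall>k. C_on k S f)"

type_synonym ('a, 'e) chart = "'a set \<times> ('a \<Rightarrow> 'e)"

definition chart_inv :: "('a, 'e) chart \<Rightarrow> 'e \<Rightarrow> 'a" where
  "chart_inv c = inv_into (fst c) (snd c)"

definition is_chart :: "'a topology \<Rightarrow> ('a, 'e::euclidean_space) chart \<Rightarrow> bool" where
  "is_chart X c \<longleftrightarrow> openin X (fst c) \<and> open (snd c ` fst c) \<and>
     homeomorphic_map (subtopology X (fst c)) (top_of_set (snd c ` fst c)) (snd c)"

definition smooth_manifold :: "'a topology \<Rightarrow> ('a, 'e::euclidean_space) chart set \<Rightarrow> bool" where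
  "smooth_manifold X \<A> \<longleftrightarrow>
     Hausdorff_space X \<and> second_countable X \<and>
     (\<forall>c\<in>\<A>. is_chart X c) \<and> (\<Union>c\<in>\<A>. fst c) = topspace X \<and>
     (\<forall>c\<in>\<A>. \<forall>d\<in>\<A>. smooth_on (snd c ` (fst c \<inter> fst d)) (snd d \<circ> chart_inv c))"

definition prod_atlas ::
    "('a, 'e) chart set \<Rightarrow> ('b, 'f) chart set \<Rightarrow> ('a \<times> 'b, 'e \<times> 'f) chart set" where
  "prod_atlas \<A> \<B> = {(fst c \<times> fst d, map_prod (snd c) (snd d)) | c d. c \<in> \<A> \<and> d \<in> \<B>}"

definition vector_atlas :: "('e, 'e) chart set" where
  "vector_atlas = {(UNIV, id)}"

text \<open>Smoothness of a map from an arbitrary subset S of a manifold (with atlas \<open>\<A>\<close>) to a manifold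
  (with atlas \<open>\<B>\<close>): locally f is the restriction of a smooth map defined on an open set. For S the
  whole manifold this is ordinary smoothness; for S an embedded submanifold it is smoothness with
  respect to the induced structure.\<close>

definition smooth_map_on ::
    "'a topology \<Rightarrow> ('a, 'e::euclidean_space) chart set \<Rightarrow> 'a set \<Rightarrow>
     ('b, 'f::euclidean_space) chart set \<Rightarrow> ('a \<Rightarrow> 'b) \<Rightarrow> bool" where
  "smooth_map_on X \<A> S \<B> f \<longleftrightarrow>
     (\<forall>p\<in>S. \<exists>c\<in>\<A>. \<exists>d\<in>\<B>. \<exists>W F. openin X W \<and> p \<in> W \<and> W \<subseteq> fst c \<and> F ` W \<subseteq> fst d \<and>
        (\<forall>q\<in>W \<inter> S. F q = f q) \<and> smooth_on (snd c ` W) (snd d \<circ> F \<circ> chart_inv c))"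

record ('a, 'e) lie_data = "'a monoid" +
  gtop :: "'a topology"
  gatlas :: "('a, 'e) chart set"

definition lie_group :: "('a, 'e::euclidean_space) lie_data \<Rightarrow> bool" where
  "lie_group G \<longleftrightarrow>
     group G \<and> topspace (gtop G) = carrier G \<and> smooth_manifold (gtop G) (gatlas G) \<and>
     smooth_map_on (prod_topology (gtop G) (gtop G)) (prod_atlas (gatlas G) (gatlas G))
       (carrier G \<times> carrier G) (gatlas G) (\<lambda>(x, y). x \<otimes>\<^bsub>G\<^esub> y) \<and>
     smooth_map_on (gtop G) (gatlas G) (carrier G) (gatlas G) (\<lambda>x. inv\<^bsub>G\<^esub> x)"

section \<open>The Lie algebra\<close>

text \<open>The Lie algebra \<open>\<gg> = T\<^sub>1G\<close> is the model space of the manifold: a tangent vector at 1 is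
  represented by its components in a chart around 1, fixed once and for all. The bracket is the
  derivative at 1 of the adjoint representation.\<close>

definition base_chart :: "('a, 'e) lie_data \<Rightarrow> ('a, 'e) chart" where
  "base_chart G = (SOME c. c \<in> gatlas G \<and> \<one>\<^bsub>G\<^esub> \<in> fst c)"

definition coord :: "('a, 'e) lie_data \<Rightarrow> 'a \<Rightarrow> 'e" where
  "coord G = snd (base_chart G)"

definition uncoord :: "('a, 'e) lie_data \<Rightarrow> 'e \<Rightarrow> 'a" where
  "uncoord G = chart_inv (base_chart G)"

definition Ad :: "('a, 'e::euclidean_space) lie_data \<Rightarrow> 'a \<Rightarrow> 'e \<Rightarrow> 'e" where
  "Ad G g = frechet_derivative (\<lambda>x. coord G (g \<otimes>\<^bsub>G\<^esub> uncoord G x \<otimes>\<^bsub>G\<^esub> inv\<^bsub>G\<^esub> g)) (at (coord G \<one>\<^bsub>G\<^esub>))"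

definition lie_bracket :: "('a, 'e::euclidean_space) lie_data \<Rightarrow> 'e \<Rightarrow> 'e \<Rightarrow> 'e" where
  "lie_bracket G X Y = frechet_derivative (\<lambda>x. Ad G (uncoord G x) Y) (at (coord G \<one>\<^bsub>G\<^esub>)) X"

definition one_parameter_subgroup ::
    "('a, 'e::euclidean_space) lie_data \<Rightarrow> 'e \<Rightarrow> (real \<Rightarrow> 'a) \<Rightarrow> bool" where
  "one_parameter_subgroup G X \<gamma> \<longleftrightarrow>
     smooth_map_on euclidean vector_atlas UNIV (gatlas G) \<gamma> \<and>
     (\<forall>t. \<gamma> t \<in> carrier G) \<and> (\<forall>s t. \<gamma> (s + t) = \<gamma> s \<otimes>\<^bsub>G\<^esub> \<gamma> t) \<and>
     ((\<lambda>t. coord G (\<gamma> t)) has_vector_derivative X) (at 0)"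

text \<open>\<open>exp_flow G X t\<close> is \<open>exp (tX)\<close>; in a Lie group the one-parameter subgroup with velocity X
  exists and is unique.\<close>

definition exp_flow :: "('a, 'e::euclidean_space) lie_data \<Rightarrow> 'e \<Rightarrow> real \<Rightarrow> 'a" where
  "exp_flow G X = (SOME \<gamma>. one_parameter_subgroup G X \<gamma>)"

definition lie_exp :: "('a, 'e::euclidean_space) lie_data \<Rightarrow> 'e \<Rightarrow> 'a" where
  "lie_exp G X = exp_flow G X 1"

definition lie_algebra_of :: "('a, 'e::euclidean_space) lie_data \<Rightarrow> 'a set \<Rightarrow> 'e set" where
  "lie_algebra_of G K = {X. \<exists>\<gamma>. one_parameter_subgroup G X \<gamma> \<and> range \<gamma> \<subseteq> K}"

definition lie_ideal :: "('a, 'e::euclidean_space) lie_data \<Rightarrow> 'e set \<Rightarrow> bool" where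
  "lie_ideal G J \<longleftrightarrow> subspace J \<and> (\<forall>X. \<forall>Y\<in>J. lie_bracket G X Y \<in> J)"

primrec derived_series :: "('a, 'e::euclidean_space) lie_data \<Rightarrow> 'e set \<Rightarrow> nat \<Rightarrow> 'e set" where
  "derived_series G J 0 = J"
| "derived_series G J (Suc n) =
     span {lie_bracket G X Y | X Y. X \<in> derived_series G J n \<and> Y \<in> derived_series G J n}"

definition semisimple_lie_group :: "('a, 'e::euclidean_space) lie_data \<Rightarrow> bool" where
  "semisimple_lie_group G \<longleftrightarrow> lie_group G \<and>
     (\<forall>J. lie_ideal G J \<and> (\<exists>n. derived_series G J n = {0}) \<longrightarrow> J = {0})"

definition killing_form :: "('a, real^'m) lie_data \<Rightarrow> real^'m \<Rightarrow> real^'m \<Rightarrow> real" where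
  "killing_form G X Y = trace (matrix (\<lambda>Z. lie_bracket G X (lie_bracket G Y Z)))"

section \<open>Cartan decomposition\<close>

definition theta_inner ::
    "('a, real^'m) lie_data \<Rightarrow> (real^'m \<Rightarrow> real^'m) \<Rightarrow> real^'m \<Rightarrow> real^'m \<Rightarrow> real" where
  "theta_inner G \<theta> X Y = - killing_form G X (\<theta> Y)"

definition cartan_involution ::
    "('a, real^'m) lie_data \<Rightarrow> (real^'m \<Rightarrow> real^'m) \<Rightarrow> bool" where
  "cartan_involution G \<theta> \<longleftrightarrow>
     linear \<theta> \<and> (\<forall>X. \<theta> (\<theta> X) = X) \<and>
     (\<forall>X Y. \<theta> (lie_bracket G X Y) = lie_bracket G (\<theta> X) (\<theta> Y)) \<and>
     (\<forall>X. X \<noteq> 0 \<longrightarrow> theta_inner G \<theta> X X > 0)"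

definition k_part :: "('e::real_vector \<Rightarrow> 'e) \<Rightarrow> 'e set" where
  "k_part \<theta> = {X. \<theta> X = X}"

definition p_part :: "('e::real_vector \<Rightarrow> 'e) \<Rightarrow> 'e set" where
  "p_part \<theta> = {X. \<theta> X = - X}"

text \<open>The global decomposition: K is a closed subgroup with Lie algebra \<open>\<kk>\<close>, and
  \<open>(k, X) \<mapsto> k exp X\<close> is a diffeomorphism from the submanifold \<open>K \<times> \<pp>\<close> of \<open>G \<times> \<gg>\<close> onto G.\<close>

definition cartan_decomposition ::
    "('a, real^'m) lie_data \<Rightarrow> (real^'m \<Rightarrow> real^'m) \<Rightarrow> 'a set \<Rightarrow> bool" where
  "cartan_decomposition G \<theta> K \<longleftrightarrow>
     cartan_involution G \<theta> \<and> subgroup K G \<and> closedin (gtop G) K \<and> lie_algebra_of G K = k_part \<theta> \<and>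
     (let S = K \<times> p_part \<theta>; \<Phi> = (\<lambda>(k, X). k \<otimes>\<^bsub>G\<^esub> lie_exp G X)
      in bij_betw \<Phi> S (carrier G) \<and>
         smooth_map_on (prod_topology (gtop G) euclidean) (prod_atlas (gatlas G) vector_atlas)
           S (gatlas G) \<Phi> \<and>
         smooth_map_on (gtop G) (gatlas G) (carrier G)
           (prod_atlas (gatlas G) vector_atlas) (inv_into S \<Phi>))"

definition abelian_subspace :: "('a, 'e::euclidean_space) lie_data \<Rightarrow> 'e set \<Rightarrow> bool" where
  "abelian_subspace G \<aa> \<longleftrightarrow> subspace \<aa> \<and> (\<forall>X\<in>\<aa>. \<forall>Y\<in>\<aa>. lie_bracket G X Y = 0)"

definition maximal_abelian_in ::
    "('a, 'e::euclidean_space) lie_data \<Rightarrow> 'e set \<Rightarrow> 'e set \<Rightarrow> bool" where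
  "maximal_abelian_in G \<pp> \<aa> \<longleftrightarrow> \<aa> \<subseteq> \<pp> \<and> abelian_subspace G \<aa> \<and>
     (\<forall>\<bb>. \<bb> \<subseteq> \<pp> \<and> abelian_subspace G \<bb> \<and> \<aa> \<subseteq> \<bb> \<longrightarrow> \<bb> = \<aa>)"

definition inertia_tensor ::
    "('a, real^'m) lie_data \<Rightarrow> (real^'m \<Rightarrow> real^'m) \<Rightarrow> (real^'m \<Rightarrow> real^'m) \<Rightarrow> bool" where
  "inertia_tensor G \<theta> \<I> \<longleftrightarrow>
     (\<forall>u\<in>k_part \<theta>. \<I> u \<in> k_part \<theta>) \<and>
     (\<forall>u\<in>k_part \<theta>. \<forall>v\<in>k_part \<theta>. \<I> (u + v) = \<I> u + \<I> v) \<and>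
     (\<forall>u\<in>k_part \<theta>. \<forall>r. \<I> (r *\<^sub>R u) = r *\<^sub>R \<I> u) \<and>
     (\<forall>u\<in>k_part \<theta>. \<forall>v\<in>k_part \<theta>. theta_inner G \<theta> (\<I> u) v = theta_inner G \<theta> u (\<I> v)) \<and>
     (\<forall>u\<in>k_part \<theta>. u \<noteq> 0 \<longrightarrow> theta_inner G \<theta> (\<I> u) u > 0)"

section \<open>Differential calculus on \<open>K\<close> and \<open>TK = K \<times> \<kk>\<close> in the left trivialization\<close>

text \<open>A point of TK is a pair (s, u); a tangent vector of TK at (s, u) is a pair \<open>(\<xi>, \<eta>)\<close> in
  \<open>\<kk> \<times> \<kk>\<close>, the velocity at t = 0 of the curve \<open>(s exp (t\<xi>), u + t\<eta>)\<close>. Accordingly the differential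
  of the projection TK to K is \<open>fst\<close>, a constant pair is a left invariant vector field of the
  Lie group \<open>K \<times> (\<kk>, +)\<close>, and the bracket of two such fields is \<open>([\<xi>, \<xi>'], 0)\<close>.\<close>

definition deriv_K ::
    "('a, 'e::euclidean_space) lie_data \<Rightarrow> ('a \<Rightarrow> 'v::real_normed_vector) \<Rightarrow> 'a \<Rightarrow> 'e \<Rightarrow> 'v" where
  "deriv_K G F s \<xi> = vector_derivative (\<lambda>t. F (s \<otimes>\<^bsub>G\<^esub> exp_flow G \<xi> t)) (at 0)"

definition deriv_TK ::
    "('a, 'e::euclidean_space) lie_data \<Rightarrow> ('a \<times> 'e \<Rightarrow> 'v::real_normed_vector) \<Rightarrow>
     'a \<times> 'e \<Rightarrow> 'e \<times> 'e \<Rightarrow> 'v" where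
  "deriv_TK G F q v = vector_derivative
     (\<lambda>t. F (fst q \<otimes>\<^bsub>G\<^esub> exp_flow G (fst v) t, snd q + t *\<^sub>R snd v)) (at 0)"

definition bracket_TK :: "('a, 'e::euclidean_space) lie_data \<Rightarrow> 'e \<times> 'e \<Rightarrow> 'e \<times> 'e \<Rightarrow> 'e \<times> 'e" where
  "bracket_TK G v w = (lie_bracket G (fst v) (fst w), 0)"

text \<open>Exterior derivative of a one-form,
  \<open>d\<omega>(Y, Z) = Y(\<omega>(Z)) - Z(\<omega>(Y)) - \<omega>([Y, Z])\<close>, evaluated on left invariant fields Y, Z. The
  arguments D and br are the directional derivative and the bracket of left invariant fields.\<close>

definition ext_deriv ::
    "(('q \<Rightarrow> 'v) \<Rightarrow> 'q \<Rightarrow> 'w \<Rightarrow> 'v) \<Rightarrow> ('w \<Rightarrow> 'w \<Rightarrow> 'w) \<Rightarrow> ('q \<Rightarrow> 'w \<Rightarrow> 'v::real_normed_vector) \<Rightarrow>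
     'q \<Rightarrow> 'w \<Rightarrow> 'w \<Rightarrow> 'v" where
  "ext_deriv D br \<omega> q y z =
     D (\<lambda>q. \<omega> q z) q y - D (\<lambda>q. \<omega> q y) q z - \<omega> q (br y z)"

text \<open>Bracket of arbitrary vector fields on TK, given by their components in the left invariant
  frame.\<close>

definition field_bracket ::
    "('a, 'e::euclidean_space) lie_data \<Rightarrow> ('a \<times> 'e \<Rightarrow> 'e \<times> 'e) \<Rightarrow> ('a \<times> 'e \<Rightarrow> 'e \<times> 'e) \<Rightarrow>
     'a \<times> 'e \<Rightarrow> 'e \<times> 'e" where
  "field_bracket G X Y q =
     deriv_TK G Y q (X q) - deriv_TK G X q (Y q) + bracket_TK G (X q) (Y q)"

text \<open>An n-form is evaluated on families of tangent vectors, of which only the members with index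
  below n matter. Lie derivative:
  \<open>(L\<^sub>X \<omega>)(Y\<^sub>0, \<dots>) = X(\<omega>(Y\<^sub>0, \<dots>)) - \<Sum>\<^sub>i \<omega>(Y\<^sub>0, \<dots>, [X, Y\<^sub>i], \<dots>)\<close>, evaluated on left
  invariant fields.\<close>

definition lie_derivative ::
    "('a, 'e::euclidean_space) lie_data \<Rightarrow> ('a \<times> 'e \<Rightarrow> 'e \<times> 'e) \<Rightarrow> nat \<Rightarrow>
     ('a \<times> 'e \<Rightarrow> (nat \<Rightarrow> 'e \<times> 'e) \<Rightarrow> real) \<Rightarrow> 'a \<times> 'e \<Rightarrow> (nat \<Rightarrow> 'e \<times> 'e) \<Rightarrow> real" where
  "lie_derivative G X n \<omega> q y =
     deriv_TK G (\<lambda>q. \<omega> q y) q (X q)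
     - (\<Sum>i<n. \<omega> q (y(i := field_bracket G X (\<lambda>_. y i) q)))"

definition wedge ::
    "nat \<Rightarrow> nat \<Rightarrow> ((nat \<Rightarrow> 'w) \<Rightarrow> real) \<Rightarrow> ((nat \<Rightarrow> 'w) \<Rightarrow> real) \<Rightarrow> (nat \<Rightarrow> 'w) \<Rightarrow> real" where
  "wedge m n \<alpha> \<beta> y = (\<Sum>\<pi> | \<pi> permutes {..<m + n}.
     of_int (sign \<pi>) * \<alpha> (\<lambda>i. y (\<pi> i)) * \<beta> (\<lambda>i. y (\<pi> (m + i)))) / (fact m * fact n)"

primrec wedge_power :: "('w \<Rightarrow> 'w \<Rightarrow> real) \<Rightarrow> nat \<Rightarrow> (nat \<Rightarrow> 'w) \<Rightarrow> real" where
  "wedge_power \<Omega> 0 = (\<lambda>_. 1)"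
| "wedge_power \<Omega> (Suc n) = wedge 2 (2 * n) (\<lambda>y. \<Omega> (y 0) (y 1)) (wedge_power \<Omega> n)"

text \<open>Determinant of an endomorphism T of a finite-dimensional subspace S: the Leibniz formula for
  the matrix of T in some basis of S.\<close>

definition det_on :: "'e::euclidean_space set \<Rightarrow> ('e \<Rightarrow> 'e) \<Rightarrow> real" where
  "det_on S T = (let B = (SOME B. independent B \<and> span B = S) in
     \<Sum>\<pi> | \<pi> permutes B. of_int (sign \<pi>) * (\<Prod>b\<in>B. representation B (T b) (\<pi> b)))"

section \<open>The compressed system\<close>

text \<open>The one-form is regarded as \<open>\<gg>\<close>-valued; its values lie in
  \<open>V = ad(w\<^sub>0)(\<hh>\<^sup>\<bottom>) = ad(w\<^sub>0)(\<kk>)\<close>, where \<open>\<hh>\<close> is the kernel of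
  \<open>ad(w\<^sub>0)\<close> on \<open>\<kk>\<close>, and the inner product of V is the restriction of \<open>theta_inner\<close>.\<close>

definition nh_form :: "('a, 'e::euclidean_space) lie_data \<Rightarrow> 'e \<Rightarrow> 'a \<Rightarrow> 'e \<Rightarrow> 'e" where
  "nh_form G w0 s u = - lie_bracket G (Ad G s u) w0"

definition adjoint_k ::
    "('a, real^'m) lie_data \<Rightarrow> (real^'m \<Rightarrow> real^'m) \<Rightarrow> (real^'m \<Rightarrow> real^'m) \<Rightarrow> real^'m \<Rightarrow> real^'m" where
  "adjoint_k G \<theta> T v =
     (THE z. z \<in> k_part \<theta> \<and> (\<forall>u\<in>k_part \<theta>. theta_inner G \<theta> (T u) v = theta_inner G \<theta> u z))"

definition metric_tensor ::
    "('a, real^'m) lie_data \<Rightarrow> (real^'m \<Rightarrow> real^'m) \<Rightarrow> (real^'m \<Rightarrow> real^'m) \<Rightarrow> real^'m \<Rightarrow>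
     'a \<Rightarrow> real^'m \<Rightarrow> real^'m" where
  "metric_tensor G \<theta> \<I> w0 s u = \<I> u + adjoint_k G \<theta> (nh_form G w0 s) (nh_form G w0 s u)"

definition liouville_form ::
    "('a, real^'m) lie_data \<Rightarrow> (real^'m \<Rightarrow> real^'m) \<Rightarrow> (real^'m \<Rightarrow> real^'m) \<Rightarrow> real^'m \<Rightarrow>
     'a \<times> (real^'m) \<Rightarrow> (real^'m) \<times> (real^'m) \<Rightarrow> real" where
  "liouville_form G \<theta> \<I> w0 q v =
     theta_inner G \<theta> (metric_tensor G \<theta> \<I> w0 (fst q) (snd q)) (fst v)"

definition Omega_K ::
    "('a, real^'m) lie_data \<Rightarrow> (real^'m \<Rightarrow> real^'m) \<Rightarrow> (real^'m \<Rightarrow> real^'m) \<Rightarrow> real^'m \<Rightarrow>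
     'a \<times> (real^'m) \<Rightarrow> (real^'m) \<times> (real^'m) \<Rightarrow> (real^'m) \<times> (real^'m) \<Rightarrow> real" where
  "Omega_K G \<theta> \<I> w0 q v w =
     - ext_deriv (deriv_TK G) (bracket_TK G) (liouville_form G \<theta> \<I> w0) q v w"

definition Omega_nh ::
    "('a, real^'m) lie_data \<Rightarrow> (real^'m \<Rightarrow> real^'m) \<Rightarrow> (real^'m \<Rightarrow> real^'m) \<Rightarrow> real^'m \<Rightarrow>
     'a \<times> (real^'m) \<Rightarrow> (real^'m) \<times> (real^'m) \<Rightarrow> (real^'m) \<times> (real^'m) \<Rightarrow> real" where
  "Omega_nh G \<theta> \<I> w0 q v w = Omega_K G \<theta> \<I> w0 q v w +
     theta_inner G \<theta> (nh_form G w0 (fst q) (snd q))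
       (ext_deriv (deriv_K G) (lie_bracket G) (nh_form G w0) (fst q) (fst v) (fst w))"

definition compressed_hamiltonian ::
    "('a, real^'m) lie_data \<Rightarrow> (real^'m \<Rightarrow> real^'m) \<Rightarrow> (real^'m \<Rightarrow> real^'m) \<Rightarrow> real^'m \<Rightarrow>
     'a \<times> (real^'m) \<Rightarrow> real" where
  "compressed_hamiltonian G \<theta> \<I> w0 = (\<lambda>(s, u).
     theta_inner G \<theta> (\<I> u) u / 2 + theta_inner G \<theta> (nh_form G w0 s u) (nh_form G w0 s u) / 2)"

definition X_nh ::
    "('a, real^'m) lie_data \<Rightarrow> (real^'m \<Rightarrow> real^'m) \<Rightarrow> (real^'m \<Rightarrow> real^'m) \<Rightarrow> real^'m \<Rightarrow>
     'a \<times> (real^'m) \<Rightarrow> (real^'m) \<times> (real^'m)" where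
  "X_nh G \<theta> \<I> w0 q = (THE x. x \<in> k_part \<theta> \<times> k_part \<theta> \<and>
     (\<forall>v\<in>k_part \<theta> \<times> k_part \<theta>.
        Omega_nh G \<theta> \<I> w0 q x v = deriv_TK G (compressed_hamiltonian G \<theta> \<I> w0) q v))"

definition nh_density ::
    "('a, real^'m) lie_data \<Rightarrow> (real^'m \<Rightarrow> real^'m) \<Rightarrow> (real^'m \<Rightarrow> real^'m) \<Rightarrow> real^'m \<Rightarrow>
     'a \<Rightarrow> real" where
  "nh_density G \<theta> \<I> w0 s = det_on (k_part \<theta>) (metric_tensor G \<theta> \<I> w0 s) powr (-1/2)"

end

theory Submission
  imports Defs
begin

text \<open>The vector field \<open>X\<^sub>n\<^sub>h\<close> is \<open>(u, Z)\<close> with \<open>\<mu>\<^sub>0(s) Z = - [u, \<I> u]\<close>: since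
  \<open>\<A>\<^sub>s = ad(w\<^sub>0) \<circ> Ad(s)\<close> has derivative \<open>\<A>\<^sub>s \<circ> ad(\<xi>)\<close> along \<open>s exp(t\<xi>)\<close>, the gyroscopic term cancels every
  contribution of \<open>\<A>\<close> to the equation of motion, apart from the one inside \<open>\<mu>\<^sub>0\<close>.
  On the other hand \<open>\<Omega>\<^sup>K\<close> is the pull-back of the constant form \<open>\<langle>\<eta>', \<xi>\<rangle> - \<langle>\<eta>, \<xi>'\<rangle>\<close> under a block triangular
  map with diagonal blocks 1 and \<open>\<mu>\<^sub>0\<close>, so that \<open>f (\<Omega>\<^sup>K)\<^sup>d\<close> is \<open>(det \<mu>\<^sub>0)\<^sup>1\<^sup>/\<^sup>2\<close> times an invariant volume.
  Its Lie derivative vanishes iff \<open>tr(\<mu>\<^sub>0\<^sup>-\<^sup>1 \<mu>\<^sub>0') / 2\<close> and the divergence of \<open>X\<^sub>n\<^sub>h\<close> add up to 0. As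
  \<open>\<mu>\<^sub>0' = [\<mu>\<^sub>0 - \<I>, ad u]\<close>, both are \<open>\<plusminus> tr(\<mu>\<^sub>0\<^sup>-\<^sup>1 ad(u) \<I>)\<close>; all other traces are zero, because \<open>ad u\<close> is
  skew and \<open>\<mu>\<^sub>0\<close>, \<open>\<I>\<close> are symmetric.\<close>

section \<open>Smooth maps in charts\<close>

text \<open>\<open>Ad\<close>, \<open>lie_bracket\<close>, \<open>exp_flow\<close>,
  \<open>X_nh\<close> and \<open>metric_tensor\<close> are given by derivatives or choice operators
  that carry no information until existence is shown; this shapes the proof. The one differentiation
  fact about the group that enters the mechanics is d/dt Ad(s \<gamma>(t)) v = Ad(s)[X, v], so the
  smooth structure mainly serves to make \<open>Ad\<close> differentiable at the identity. The
  hypotheses supply one-parameter subgroups for X in the Lie algebra of K, so antisymmetry is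
  obtained on k and the Jacobi identity with first argument in k, which is what motion on TK asks
  for. The inertia tensor, the metric tensor and its inverse are controlled on k only; hence
  determinants, traces and alternating forms are developed relative to a subspace. The cancellation
  of the \<A>-terms is a count: of the product of \<A> u with \<A>[x, \<xi>], the derivative terms
  of the canonical form contribute -2, its bracket term +1 and the gyroscopic form +1. Traces enter
  because the Lie derivative replaces one argument of a top-degree form at a time by a linear
  image.\<close>

lemma C_on_subset: "C_on k S f \<Longrightarrow> T \<subseteq> S \<Longrightarrow> C_on k T f"
  by (induction k arbitrary: f) (auto intro: continuous_on_subset)

lemma C_on_SucD: "C_on (Suc k) S f \<Longrightarrow> C_on k S f"
proof (induction k arbitrary: f)
  case 0
  then show ?case
    by (auto intro: continuous_at_imp_continuous_on differentiable_imp_continuous_within)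
next
  case (Suc k)
  then show ?case by (metis C_on.simps(2))
qed

text \<open>\<open>C_on\<close> looks at derivatives at points of S only, and S is open, so
  functions equal on S have the same ones. Derivative formulas valid just on S are substituted in
  this way.\<close>

lemma C_on_cong:
  assumes "open S" "\<And>x. x \<in> S \<Longrightarrow> f x = g x" "C_on k S f"
  shows "C_on k S g"
  using assms(2,3)
proof (induction k arbitrary: f g)
  case 0
  then show ?case by (auto cong: continuous_on_cong)
next
  case (Suc k)
  have eq: "frechet_derivative f (at x) = frechet_derivative g (at x)" if "x \<in> S" for x
    using frechet_derivative_transform_within_open[OF _ assms(1) that, of f g] Suc.prems that by auto
  have "g differentiable at x" if "x \<in> S" for x
    using Suc.prems that assms(1) differentiable_transform_within[of f x UNIV]
    by (metis (no_types, lifting) C_on.simps(2) differentiable_def has_derivative_transform_within_open)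
  moreover have "C_on k S (\<lambda>x. frechet_derivative g (at x) v)" for v
    by (rule Suc.IH[of "\<lambda>x. frechet_derivative f (at x) v"]) (use Suc.prems eq in auto)
  ultimately show ?case by auto
qed

lemma C_on_const: "C_on k S (\<lambda>x. c)"
  by (induction k arbitrary: c) auto

lemma C_on_linear:
  assumes "bounded_linear L"
  shows "C_on k S L"
proof (cases k)
  case 0
  then show ?thesis using assms by (simp add: linear_continuous_on)
next
  case (Suc n)
  then show ?thesis
    using assms by (simp add: bounded_linear_imp_differentiable frechet_derivative_at[OF bounded_linear_imp_has_derivative, symmetric] C_on_const)
qed

lemma C_on_add:
  assumes "open S" "C_on k S f" "C_on k S g"
  shows "C_on k S (\<lambda>x. f x + g x)"
  using assms(2,3)
proof (induction k arbitrary: f g)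
  case 0
  then show ?case by (auto intro: continuous_on_add)
next
  case (Suc k)
  have eq: "frechet_derivative f (at x) v + frechet_derivative g (at x) v
      = frechet_derivative (\<lambda>x. f x + g x) (at x) v" if "x \<in> S" for x v
  proof -
    have "((\<lambda>x. f x + g x) has_derivative
        (\<lambda>v. frechet_derivative f (at x) v + frechet_derivative g (at x) v)) (at x)"
      using Suc.prems that by (intro has_derivative_add) (auto simp: frechet_derivative_works[symmetric])
    from frechet_derivative_at[OF this] show ?thesis by (rule fun_cong)
  qed
  show ?case
    using Suc.prems by (auto intro!: C_on_cong[OF assms(1) eq] Suc.IH)
qed

lemma C_on_sum:
  assumes "open S" "\<And>i. i \<in> A \<Longrightarrow> C_on k S (f i)"
  shows "C_on k S (\<lambda>x. \<Sum>i\<in>A. f i x)"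
  using assms(2) by (induction A rule: infinite_finite_induct) (auto intro: C_on_const C_on_add assms(1))

text \<open>By the product rule each directional derivative is a sum of terms with one factor
  differentiated; the other factor gives up one order through \<open>C_on_SucD\<close>, and the
  induction hypothesis covers both.\<close>

lemma C_on_bilinear:
  assumes "open S" "bounded_bilinear p" "C_on k S f" "C_on k S g"
  shows "C_on k S (\<lambda>x. p (f x) (g x))"
  using assms(3,4)
proof (induction k arbitrary: f g)
  case 0
  then show ?case using bounded_bilinear.continuous_on[OF assms(2)] by auto
next
  case (Suc k)
  have der: "((\<lambda>x. p (f x) (g x)) has_derivative
       (\<lambda>v. p (f x) (frechet_derivative g (at x) v) + p (frechet_derivative f (at x) v) (g x))) (at x)"
    if "x \<in> S" for x
    using Suc.prems that
    by (intro bounded_bilinear.FDERIV[OF assms(2)]) (auto simp: frechet_derivative_works[symmetric])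
  have eq: "p (f x) (frechet_derivative g (at x) v) + p (frechet_derivative f (at x) v) (g x)
      = frechet_derivative (\<lambda>x. p (f x) (g x)) (at x) v" if "x \<in> S" for x v
    by (subst frechet_derivative_at[OF der[OF that], symmetric]) simp
  have "C_on k S f" "C_on k S g"
    using Suc.prems by (auto intro: C_on_SucD simp del: C_on.simps)
  then have "C_on k S (\<lambda>x. frechet_derivative (\<lambda>x. p (f x) (g x)) (at x) v)" for v
    using Suc.prems by (auto intro!: C_on_cong[OF assms(1) eq] C_on_add[OF assms(1)] Suc.IH)
  then show ?case
    using der by (auto simp: differentiable_def)
qed

text \<open>In the chain rule the derivative of g is applied to the moving vector
  \<open>?F x v\<close>. Expanding that vector in \<open>Basis\<close> leaves derivatives of g in
  fixed directions composed with f, to which the induction hypothesis applies.\<close>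

lemma C_on_compose:
  fixes f :: "'a::real_normed_vector \<Rightarrow> 'b::euclidean_space" and g :: "'b \<Rightarrow> 'c::real_normed_vector"
  assumes "open S" "C_on k S f" "C_on k T g" "f ` S \<subseteq> T"
  shows "C_on k S (\<lambda>x. g (f x))"
  using assms(2,3)
proof (induction k arbitrary: g)
  case 0
  then show ?case using continuous_on_compose2[of T g S f] assms(4) by auto
next
  case (Suc k)
  let ?F = "\<lambda>x. frechet_derivative f (at x)" and ?G = "\<lambda>y. frechet_derivative g (at y)"
  have der: "((\<lambda>x. g (f x)) has_derivative (\<lambda>v. ?G (f x) (?F x v))) (at x)" if "x \<in> S" for x
    using Suc.prems that assms(4)
    by (intro has_derivative_compose[of f _ _ _ g]) (auto simp: frechet_derivative_works[symmetric])
  have eq: "(\<Sum>b\<in>Basis. (?F x v \<bullet> b) *\<^sub>R ?G (f x) b)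
      = frechet_derivative (\<lambda>x. g (f x)) (at x) v" if "x \<in> S" for x v
  proof -
    have "linear (?G (f x))"
      using Suc.prems(2) that assms(4) by (intro linear_frechet_derivative) auto
    then have "?G (f x) (?F x v) = (\<Sum>b\<in>Basis. (?F x v \<bullet> b) *\<^sub>R ?G (f x) b)"
      by (subst euclidean_representation[symmetric, of "?F x v"]) (simp add: linear_sum linear_cmul)
    then show ?thesis
      by (subst frechet_derivative_at[OF der[OF that], symmetric]) simp
  qed
  have "C_on k S f"
    using Suc.prems by (auto intro: C_on_SucD simp del: C_on.simps)
  then have "C_on k S (\<lambda>x. ?G (f x) b)" for b
    using Suc.prems by (intro Suc.IH) auto
  moreover have "C_on k S (\<lambda>x. ?F x v \<bullet> b)" for v b
    using C_on_bilinear[OF assms(1) bounded_bilinear_inner _ C_on_const, of k "\<lambda>x. ?F x v" b] Suc.prems by auto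
  ultimately have "C_on k S (\<lambda>x. frechet_derivative (\<lambda>x. g (f x)) (at x) v)" for v
    by (intro C_on_cong[OF assms(1) eq] C_on_sum assms(1) C_on_bilinear[OF assms(1) bounded_bilinear_scaleR])
  then show ?case
    using der by (auto simp: differentiable_def)
qed

lemma C_on_Pair:
  fixes f :: "'a::real_normed_vector \<Rightarrow> 'b::euclidean_space" and g :: "'a \<Rightarrow> 'c::euclidean_space"
  assumes "open S" "C_on k S f" "C_on k S g"
  shows "C_on k S (\<lambda>x. (f x, g x))"
proof -
  have "C_on k S (\<lambda>x. (f x, 0::'c))"
    by (rule C_on_compose[OF assms(1,2) C_on_linear[of "\<lambda>y. (y, 0)" k UNIV]])
      (auto intro!: bounded_linear_Pair bounded_linear_ident bounded_linear_zero)
  moreover have "C_on k S (\<lambda>x. (0::'b, g x))"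
    by (rule C_on_compose[OF assms(1,3) C_on_linear[of "\<lambda>y. (0, y)" k UNIV]])
      (auto intro!: bounded_linear_Pair bounded_linear_ident bounded_linear_zero)
  ultimately show ?thesis
    using C_on_add[OF assms(1), of k "\<lambda>x. (f x, 0)" "\<lambda>x. (0, g x)"] by simp
qed

lemma smooth_on_open: "smooth_on S f \<Longrightarrow> open S"
  by (simp add: smooth_on_def)

lemma smooth_on_continuous: "smooth_on S f \<Longrightarrow> continuous_on S f"
  by (metis smooth_on_def C_on.simps(1))

lemma smooth_on_differentiable: "smooth_on S f \<Longrightarrow> x \<in> S \<Longrightarrow> f differentiable at x"
  by (metis smooth_on_def C_on.simps(2))

lemma smooth_on_frechet_differentiable:
  "smooth_on S f \<Longrightarrow> x \<in> S \<Longrightarrow> (\<lambda>x. frechet_derivative f (at x) v) differentiable at x"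
  by (metis smooth_on_def C_on.simps(2))

lemma smooth_on_subset: "smooth_on S f \<Longrightarrow> T \<subseteq> S \<Longrightarrow> open T \<Longrightarrow> smooth_on T f"
  by (auto simp: smooth_on_def intro: C_on_subset)

lemma smooth_on_cong:
  assumes "smooth_on S f" "\<And>x. x \<in> S \<Longrightarrow> f x = g x"
  shows "smooth_on S g"
  using assms(1) C_on_cong[of S f g, OF _ assms(2)] by (auto simp: smooth_on_def)

lemma smooth_on_compose:
  fixes f :: "'a::real_normed_vector \<Rightarrow> 'b::euclidean_space"
  assumes "smooth_on S f" "smooth_on T g" "f ` S \<subseteq> T"
  shows "smooth_on S (\<lambda>x. g (f x))"
  using assms C_on_compose[of S _ f T g] by (auto simp: smooth_on_def)

lemma smooth_on_Pair:
  fixes f :: "'a::real_normed_vector \<Rightarrow> 'b::euclidean_space" and g :: "'a \<Rightarrow> 'c::euclidean_space"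
  assumes "smooth_on S f" "smooth_on S g"
  shows "smooth_on S (\<lambda>x. (f x, g x))"
  using assms by (auto simp: smooth_on_def intro: C_on_Pair)

lemma smooth_on_linear: "open S \<Longrightarrow> bounded_linear L \<Longrightarrow> smooth_on S L"
  by (auto simp: smooth_on_def intro: C_on_linear)

text \<open>The fragment of the manifold structure that a change of charts uses. No topology occurs
  in it, so it passes to product atlases without a product manifold being constructed.\<close>

definition compatible_atlas :: "('a, 'e::euclidean_space) chart set \<Rightarrow> bool" where
  "compatible_atlas \<A> \<longleftrightarrow> (\<forall>c\<in>\<A>. inj_on (snd c) (fst c)) \<and>
     (\<forall>c\<in>\<A>. \<forall>d\<in>\<A>. smooth_on (snd c ` (fst c \<inter> fst d)) (snd d \<circ> chart_inv c))"

lemma chart_inv_apply: "compatible_atlas \<A> \<Longrightarrow> c \<in> \<A> \<Longrightarrow> p \<in> fst c \<Longrightarrow> chart_inv c (snd c p) = p"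
  by (simp add: compatible_atlas_def chart_inv_def)

lemma chart_inv_in: "z \<in> snd c ` fst c \<Longrightarrow> chart_inv c z \<in> fst c"
  by (simp add: chart_inv_def inv_into_into)

lemma apply_chart_inv: "z \<in> snd c ` fst c \<Longrightarrow> snd c (chart_inv c z) = z"
  by (simp add: chart_inv_def f_inv_into_f)

lemma compatible_prod_atlas:
  assumes A: "compatible_atlas \<A>" and B: "compatible_atlas \<B>"
  shows "compatible_atlas (prod_atlas \<A> \<B>)"
  unfolding compatible_atlas_def
proof (intro conjI ballI)
  fix p assume "p \<in> prod_atlas \<A> \<B>"
  then show "inj_on (snd p) (fst p)"
    using A B by (auto simp: prod_atlas_def compatible_atlas_def inj_on_def)
next
  fix p q assume "p \<in> prod_atlas \<A> \<B>" "q \<in> prod_atlas \<A> \<B>"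
  then obtain c d c' d' where p: "p = (fst c \<times> fst d, map_prod (snd c) (snd d))"
    and q: "q = (fst c' \<times> fst d', map_prod (snd c') (snd d'))"
    and cd: "c \<in> \<A>" "d \<in> \<B>" "c' \<in> \<A>" "d' \<in> \<B>" by (auto simp: prod_atlas_def)
  define S where "S = snd c ` (fst c \<inter> fst c')"
  define T where "T = snd d ` (fst d \<inter> fst d')"
  have sS: "smooth_on S (snd c' \<circ> chart_inv c)" and sT: "smooth_on T (snd d' \<circ> chart_inv d)"
    using A B cd by (auto simp: compatible_atlas_def S_def T_def)
  have im: "snd p ` (fst p \<inter> fst q) = S \<times> T"
    by (auto simp: p q S_def T_def image_iff)
  have oS: "open (S \<times> T)" using sS sT by (simp add: smooth_on_open open_Times)
  have f: "smooth_on (S \<times> T) (fst :: 'b \<times> 'd \<Rightarrow> 'b)" "smooth_on (S \<times> T) (snd :: 'b \<times> 'd \<Rightarrow> 'd)"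
    by (auto intro!: smooth_on_linear[OF oS] bounded_linear_fst bounded_linear_snd)
  have "smooth_on (S \<times> T) (\<lambda>z. ((snd c' \<circ> chart_inv c) (fst z), (snd d' \<circ> chart_inv d) (snd z)))"
    by (intro smooth_on_Pair smooth_on_compose[OF f(1) sS] smooth_on_compose[OF f(2) sT]) auto
  then have "smooth_on (S \<times> T) (snd q \<circ> chart_inv p)"
  proof (rule smooth_on_cong)
    fix z assume "z \<in> S \<times> T"
    then obtain a b where ab: "z = (snd c a, snd d b)" "a \<in> fst c" "b \<in> fst d" by (auto simp: S_def T_def)
    \<comment> \<open>\<open>chart_inv p\<close> is an inverse chosen on the product domain;
      injectivity identifies it with the pair of inverses.\<close>
    have "inj_on (snd p) (fst p)" using A B cd by (auto simp: p compatible_atlas_def inj_on_def)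
    then have "chart_inv p (snd p (a, b)) = (a, b)"
      unfolding chart_inv_def using ab by (intro inv_into_f_f) (auto simp: p)
    then have "chart_inv p z = (a, b)" by (simp add: ab p)
    then show "((snd c' \<circ> chart_inv c) (fst z), (snd d' \<circ> chart_inv d) (snd z)) = (snd q \<circ> chart_inv p) z"
      using chart_inv_apply[OF A cd(1) ab(2)] chart_inv_apply[OF B cd(2) ab(3)] by (simp add: ab(1) q)
  qed
  then show "smooth_on (snd p ` (fst p \<inter> fst q)) (snd q \<circ> chart_inv p)" by (simp add: im)
qed

lemma compatible_vector_atlas: "compatible_atlas (vector_atlas :: ('e::euclidean_space, 'e) chart set)"
  by (auto simp: compatible_atlas_def vector_atlas_def chart_inv_def o_def inv_into_def
      intro!: smooth_on_linear bounded_linear_ident)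

text \<open>\<open>smooth_map_on\<close> provides some charts near p, whereas c and d are prescribed
  here: the given local expression g is composed with the transition maps \<tau> and \<sigma>. Since
  S contains the whole space, the local extension F agrees with f on all of W.\<close>

lemma smooth_map_on_charts:
  fixes \<A> :: "('a, 'e::euclidean_space) chart set" and \<B> :: "('b, 'f::euclidean_space) chart set"
  assumes A: "compatible_atlas \<A>" and B: "compatible_atlas \<B>"
    and f: "smooth_map_on X \<A> S \<B> f" and S: "topspace X \<subseteq> S" and p: "p \<in> S"
    and c: "c \<in> \<A>" "p \<in> fst c" and d: "d \<in> \<B>" "f p \<in> fst d"
  obtains U where "snd c p \<in> U" "U \<subseteq> snd c ` fst c" "\<And>z. z \<in> U \<Longrightarrow> f (chart_inv c z) \<in> fst d"
    "smooth_on U (\<lambda>z. snd d (f (chart_inv c z)))"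
proof -
  obtain c' d' W F where c': "c' \<in> \<A>" and d': "d' \<in> \<B>" and W: "openin X W" "p \<in> W" "W \<subseteq> fst c'"
    and F: "F ` W \<subseteq> fst d'" "\<forall>q\<in>W \<inter> S. F q = f q"
    and sm: "smooth_on (snd c' ` W) (snd d' \<circ> F \<circ> chart_inv c')"
    using f p unfolding smooth_map_on_def by meson
  have WS: "W \<subseteq> S" using W(1) S openin_subset by blast
  have Ff: "F q = f q" if "q \<in> W" for q using F(2) WS that by blast
  define \<tau> where "\<tau> = (\<lambda>z. snd c' (chart_inv c z))"
  define \<sigma> where "\<sigma> = (\<lambda>z. snd d (chart_inv d' z))"
  define g where "g = (\<lambda>z. snd d' (F (chart_inv c' z)))"
  have \<tau>: "smooth_on (snd c ` (fst c \<inter> fst c')) \<tau>"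
    using A c c' by (auto simp: compatible_atlas_def \<tau>_def o_def)
  have \<sigma>: "smooth_on (snd d' ` (fst d' \<inter> fst d)) \<sigma>"
    using B d d' by (auto simp: compatible_atlas_def \<sigma>_def o_def)
  have g: "smooth_on (snd c' ` W) g" using sm by (simp add: g_def o_def)
  \<comment> \<open>Coordinates in c' that g sends into the overlap of d' and d; U is the preimage
    under \<tau>, so that \<sigma>, g and \<tau> compose on it.\<close>
  define O' where "O' = snd c' ` W \<inter> g -` (snd d' ` (fst d' \<inter> fst d))"
  have oO: "open O'" unfolding O'_def
    using continuous_open_preimage[OF smooth_on_continuous[OF g] smooth_on_open[OF g] smooth_on_open[OF \<sigma>]] .
  define U where "U = snd c ` (fst c \<inter> fst c') \<inter> \<tau> -` O'"
  have oU: "open U" unfolding U_def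
    using continuous_open_preimage[OF smooth_on_continuous[OF \<tau>] smooth_on_open[OF \<tau>] oO] .
  have key: "f (chart_inv c z) \<in> fst d \<and> snd d (f (chart_inv c z)) = \<sigma> (g (\<tau> z))" if z: "z \<in> U" for z
  proof -
    obtain q where q: "z = snd c q" "q \<in> fst c" "q \<in> fst c'" using z by (auto simp: U_def)
    have iq: "chart_inv c z = q" using chart_inv_apply[OF A c(1)] q by simp
    have \<tau>z: "\<tau> z = snd c' q" by (simp add: \<tau>_def iq)
    obtain r where r: "r \<in> W" "snd c' q = snd c' r" using z by (auto simp: U_def O'_def \<tau>z)
    then have "q = r" using A c' q(3) W(3) by (metis chart_inv_apply in_mono)
    then have qW: "q \<in> W" using r by simp
    have gz: "g (\<tau> z) = snd d' (f q)"
      by (simp add: g_def \<tau>z chart_inv_apply[OF A c' q(3)] Ff[OF qW])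
    obtain r' where r': "r' \<in> fst d'" "r' \<in> fst d" "snd d' (f q) = snd d' r'"
      using z by (auto simp: U_def O'_def gz)
    have fq: "f q \<in> fst d'" using F(1) qW Ff by force
    then have "f q = r'" using r' by (metis B d' chart_inv_apply)
    then show ?thesis
      using chart_inv_apply[OF B d' fq] r'(2) \<open>f q = r'\<close> unfolding iq gz \<sigma>_def by simp
  qed
  have "snd c p \<in> U"
  proof -
    have i: "chart_inv c (snd c p) = p" "chart_inv c' (snd c' p) = p"
      using chart_inv_apply[OF A c] chart_inv_apply[OF A c', of p] W(2,3) by auto
    have "f p \<in> fst d'" using F(1) W(2) Ff by force
    then show ?thesis
      using c W(2,3) d by (auto simp: U_def O'_def \<tau>_def g_def i Ff)
  qed
  moreover have "smooth_on U (\<lambda>z. snd d (f (chart_inv c z)))"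
  proof (rule smooth_on_cong)
    have \<tau>U: "smooth_on U \<tau>" using smooth_on_subset[OF \<tau> _ oU] by (auto simp: U_def)
    have "smooth_on U (\<lambda>z. g (\<tau> z))" by (rule smooth_on_compose[OF \<tau>U g]) (auto simp: U_def O'_def)
    then show "smooth_on U (\<lambda>z. \<sigma> (g (\<tau> z)))" by (rule smooth_on_compose[OF _ \<sigma>]) (auto simp: U_def O'_def)
  qed (use key in auto)
  moreover have "U \<subseteq> snd c ` fst c" by (auto simp: U_def)
  ultimately show ?thesis using that[of U] key by blast
qed

section \<open>The adjoint representation\<close>

text \<open>Base point and direction both vary with x. Expanding the direction in
  \<open>Basis\<close> separates them into scalar coefficients and derivatives in fixed directions,
  which are differentiable because P is smooth.\<close>

lemma differentiable_frechet_apply: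
  fixes P :: "'b::euclidean_space \<Rightarrow> 'c::real_normed_vector" and f :: "'a::real_normed_vector \<Rightarrow> 'b"
  assumes P: "smooth_on U P" and f: "f differentiable (at x0)" "f x0 \<in> U" and w: "w differentiable (at x0)"
  shows "(\<lambda>x. frechet_derivative P (at (f x)) (w x)) differentiable (at x0)"
proof -
  let ?g = "\<lambda>x. \<Sum>b\<in>Basis. (w x \<bullet> b) *\<^sub>R frechet_derivative P (at (f x)) b"
  have "(\<lambda>x. frechet_derivative P (at (f x)) b) differentiable (at x0)" for b
    using differentiable_chain_at[OF f(1) smooth_on_frechet_differentiable[OF P f(2)]] by (simp add: o_def)
  moreover have "(\<lambda>x. w x \<bullet> b) differentiable (at x0)" for b
    by (intro differentiable_inner w differentiable_const)
  ultimately have "(\<lambda>x. (w x \<bullet> b) *\<^sub>R frechet_derivative P (at (f x)) b) differentiable (at x0)" for b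
    using has_derivative_scaleR unfolding differentiable_def by blast
  then have g: "?g differentiable (at x0)"
    by (intro differentiable_sum) auto
  have "isCont f x0" using f(1) by (rule differentiable_imp_continuous_within)
  then have ev: "eventually (\<lambda>x. f x \<in> U) (nhds x0)"
    using smooth_on_open[OF P] f(2) by (metis isCont_def topological_tendstoD tendsto_nhds_iff)
  have "?g x = frechet_derivative P (at (f x)) (w x)" if "f x \<in> U" for x
  proof -
    have "linear (frechet_derivative P (at (f x)))"
      by (rule linear_frechet_derivative[OF smooth_on_differentiable[OF P that]])
    then show ?thesis
      by (subst (2) euclidean_representation[symmetric, of "w x"]) (simp add: linear_sum linear_cmul)
  qed
  with ev obtain T where T: "open T" "x0 \<in> T" "\<And>x. x \<in> T \<Longrightarrow> ?g x = frechet_derivative P (at (f x)) (w x)"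
    unfolding eventually_nhds by blast
  obtain g' where "(?g has_derivative g') (at x0)" using g by (auto simp: differentiable_def)
  then have "((\<lambda>x. frechet_derivative P (at (f x)) (w x)) has_derivative g') (at x0)"
    by (rule has_derivative_transform_within_open[OF _ T])
  then show ?thesis by (auto simp: differentiable_def)
qed

text \<open>Chart expressions satisfy group identities only where \<open>uncoord\<close> inverts the
  chart, so derivatives are transported along equalities valid near the point.\<close>

lemma has_derivative_eventually:
  assumes "(f has_derivative f') (at x)" "eventually (\<lambda>y. f y = g y) (nhds x)"
  shows "(g has_derivative f') (at x)"
  using assms has_derivative_transform_within_open unfolding eventually_nhds by blast

lemma has_vector_derivative_eventually:
  assumes "(f has_vector_derivative f') (at x)" "eventually (\<lambda>y. f y = g y) (nhds x)"
  shows "(g has_vector_derivative f') (at x)"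
  using assms has_derivative_eventually unfolding has_vector_derivative_def by blast

lemma has_derivative_has_vector_derivative:
  assumes "(f has_vector_derivative f') (at x)" "(g has_derivative g') (at (f x))"
  shows "((\<lambda>t. g (f t)) has_vector_derivative g' f') (at x)"
  using has_derivative_compose[OF assms(1)[unfolded has_vector_derivative_def] assms(2)]
  by (simp add: linear_cmul[OF has_derivative_linear[OF assms(2)]] has_vector_derivative_def)

section \<open>Charts of a Lie group, conjugation and the adjoint representation\<close>

locale lie = group G for G :: "('a, 'e::euclidean_space) lie_data" (structure) +
  assumes lie: "lie_group G"
begin

abbreviation origin :: 'e where "origin \<equiv> coord G \<one>"
abbreviation base_dom :: "'a set" where "base_dom \<equiv> fst (base_chart G)"

lemma manifold: "smooth_manifold (gtop G) (gatlas G)" and topspace: "topspace (gtop G) = carrier G"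
  using lie by (simp_all add: lie_group_def)

lemma compat: "compatible_atlas (gatlas G)"
  unfolding compatible_atlas_def
proof (intro conjI ballI)
  fix c assume "c \<in> gatlas G"
  then have "openin (gtop G) (fst c)"
    and "homeomorphic_map (subtopology (gtop G) (fst c)) (top_of_set (snd c ` fst c)) (snd c)"
    using manifold by (simp_all add: smooth_manifold_def is_chart_def)
  from this(1) homeomorphic_imp_injective_map[OF this(2)] show "inj_on (snd c) (fst c)"
    by (simp add: openin_subset inf.absorb2)
qed (use manifold in \<open>simp add: smooth_manifold_def\<close>)

lemma chart_carrier: "c \<in> gatlas G \<Longrightarrow> p \<in> fst c \<Longrightarrow> p \<in> carrier G"
  using manifold topspace unfolding smooth_manifold_def by blast

lemma ex_chart: "p \<in> carrier G \<Longrightarrow> \<exists>c\<in>gatlas G. p \<in> fst c"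
  using manifold topspace unfolding smooth_manifold_def by blast

lemma base_chart: "base_chart G \<in> gatlas G" "\<one> \<in> base_dom"
proof -
  have "\<exists>c. c \<in> gatlas G \<and> \<one> \<in> fst c" using ex_chart[OF one_closed] by blast
  from someI_ex[OF this] show "base_chart G \<in> gatlas G" "\<one> \<in> base_dom"
    unfolding base_chart_def by blast+
qed

lemma dom_carrier: "p \<in> base_dom \<Longrightarrow> p \<in> carrier G"
  using chart_carrier base_chart by blast

lemma uncoord_coord: "p \<in> base_dom \<Longrightarrow> uncoord G (coord G p) = p"
  by (simp add: uncoord_def coord_def chart_inv_apply[OF compat base_chart(1)])

lemma uncoord_dom: "z \<in> coord G ` base_dom \<Longrightarrow> uncoord G z \<in> base_dom"
  unfolding uncoord_def coord_def by (rule chart_inv_in)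

lemma coord_uncoord: "z \<in> coord G ` base_dom \<Longrightarrow> coord G (uncoord G z) = z"
  unfolding uncoord_def coord_def by (rule apply_chart_inv)

text \<open>Turns smoothness with respect to the product atlas into a statement about three
  separately chosen charts, by splitting the inverse of a product chart.\<close>

lemma mult_charts:
  assumes "g \<in> fst c1" "h \<in> fst c2" "g \<otimes> h \<in> fst d" and c: "c1 \<in> gatlas G" "c2 \<in> gatlas G" "d \<in> gatlas G"
  obtains U where "(snd c1 g, snd c2 h) \<in> U" "U \<subseteq> snd c1 ` fst c1 \<times> snd c2 ` fst c2"
    "\<And>a b. (a, b) \<in> U \<Longrightarrow> chart_inv c1 a \<otimes> chart_inv c2 b \<in> fst d"
    "smooth_on U (\<lambda>z. snd d (chart_inv c1 (fst z) \<otimes> chart_inv c2 (snd z)))"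
proof -
  let ?c = "(fst c1 \<times> fst c2, map_prod (snd c1) (snd c2))"
  have cp: "compatible_atlas (prod_atlas (gatlas G) (gatlas G))"
    by (rule compatible_prod_atlas[OF compat compat])
  have mem: "?c \<in> prod_atlas (gatlas G) (gatlas G)" using c unfolding prod_atlas_def by blast
  have inv: "chart_inv ?c z = (chart_inv c1 (fst z), chart_inv c2 (snd z))" if z: "z \<in> snd ?c ` fst ?c" for z
  proof -
    obtain p where p: "p \<in> fst c1 \<times> fst c2" "z = map_prod (snd c1) (snd c2) p" using z by auto
    then have ab: "z = snd ?c (fst p, snd p)" "fst p \<in> fst c1" "snd p \<in> fst c2" by auto
    then have "chart_inv ?c z = p" using chart_inv_apply[OF cp mem, of p] p by simp
    then show ?thesis using ab chart_inv_apply[OF compat] c by simp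
  qed
  have sm: "smooth_map_on (prod_topology (gtop G) (gtop G)) (prod_atlas (gatlas G) (gatlas G))
       (carrier G \<times> carrier G) (gatlas G) (\<lambda>(x, y). x \<otimes> y)" and top: "topspace (gtop G) = carrier G"
    using lie by (auto simp: lie_group_def)
  obtain U where U: "snd ?c (g, h) \<in> U" "U \<subseteq> snd ?c ` fst ?c"
    "\<And>z. z \<in> U \<Longrightarrow> (case chart_inv ?c z of (x, y) \<Rightarrow> x \<otimes> y) \<in> fst d"
    "smooth_on U (\<lambda>z. snd d (case chart_inv ?c z of (x, y) \<Rightarrow> x \<otimes> y))"
    by (rule smooth_map_on_charts[OF cp compat sm _ _ mem _ c(3), of "(g, h)"])
      (use assms chart_carrier top in auto)
  have eq: "chart_inv ?c z = (chart_inv c1 (fst z), chart_inv c2 (snd z))" if "z \<in> U" for z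
    using inv U(2) that by blast
  have "smooth_on U (\<lambda>z. snd d (chart_inv c1 (fst z) \<otimes> chart_inv c2 (snd z)))"
    by (rule smooth_on_cong[OF U(4)]) (simp add: eq)
  then show ?thesis
    using that[of U] U(1,2) U(3)[of "(_, _)"] eq by auto
qed

lemma inv_chart:
  obtains V where "origin \<in> V" "V \<subseteq> coord G ` base_dom" "\<And>x. x \<in> V \<Longrightarrow> inv (uncoord G x) \<in> base_dom"
    "smooth_on V (\<lambda>x. coord G (inv (uncoord G x)))"
proof -
  have sm: "smooth_map_on (gtop G) (gatlas G) (carrier G) (gatlas G) (\<lambda>x. inv x)"
    and top: "topspace (gtop G) = carrier G"
    using lie by (auto simp: lie_group_def)
  show ?thesis
    by (rule smooth_map_on_charts[OF compat compat sm _ _ base_chart(1) base_chart(2) base_chart(1)])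
      (use that base_chart top in \<open>auto simp: coord_def uncoord_def\<close>)
qed

definition conj_coord :: "'a \<Rightarrow> 'e \<Rightarrow> 'e" where
  "conj_coord g x = coord G (g \<otimes> uncoord G x \<otimes> inv g)"

text \<open>For g far from the identity the base chart need not contain g x, so conjugation is
  factored through a chart around g: left translation by g, then right multiplication by its
  inverse, each smooth by \<open>mult_charts\<close>.\<close>

lemma conj_local:
  assumes g: "g \<in> carrier G"
  obtains V where "open V" "origin \<in> V" "V \<subseteq> coord G ` base_dom"
    "\<And>x. x \<in> V \<Longrightarrow> g \<otimes> uncoord G x \<otimes> inv g \<in> base_dom" "smooth_on V (conj_coord g)"
proof -
  obtain c where c: "c \<in> gatlas G" "g \<in> fst c" using ex_chart g by blast
  obtain c2 where c2: "c2 \<in> gatlas G" "inv g \<in> fst c2" using ex_chart g by blast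
  obtain U1 where U1: "(snd c g, origin) \<in> U1" "U1 \<subseteq> snd c ` fst c \<times> coord G ` base_dom"
    "\<And>a b. (a, b) \<in> U1 \<Longrightarrow> chart_inv c a \<otimes> uncoord G b \<in> fst c"
    "smooth_on U1 (\<lambda>z. snd c (chart_inv c (fst z) \<otimes> uncoord G (snd z)))"
    by (rule mult_charts[of g c \<one> "base_chart G" c])
      (use c g base_chart in \<open>auto simp: coord_def uncoord_def\<close>)
  obtain U2 where U2: "(snd c g, snd c2 (inv g)) \<in> U2"
    "\<And>a b. (a, b) \<in> U2 \<Longrightarrow> chart_inv c a \<otimes> chart_inv c2 b \<in> base_dom"
    "smooth_on U2 (\<lambda>z. coord G (chart_inv c (fst z) \<otimes> chart_inv c2 (snd z)))"
    by (rule mult_charts[of g c "inv g" c2 "base_chart G"])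
      (use c c2 g base_chart in \<open>auto simp: coord_def\<close>)
  define f where "f = (\<lambda>x. snd c (g \<otimes> uncoord G x))"
  have ig: "chart_inv c (snd c g) = g" "chart_inv c2 (snd c2 (inv g)) = inv g"
    using chart_inv_apply[OF compat] c c2 by auto
  define V1 where "V1 = (\<lambda>x. (snd c g, x)) -` U1"
  have oV1: "open V1" unfolding V1_def
    by (rule open_vimage[OF smooth_on_open[OF U1(4)]]) (intro continuous_intros)
  have s1: "smooth_on V1 (\<lambda>x. (snd c g, x))"
    by (auto simp: smooth_on_def oV1 intro!: C_on_Pair C_on_const C_on_linear[OF bounded_linear_ident])
  have f: "smooth_on V1 f"
    using smooth_on_compose[OF s1 U1(4)] by (auto simp: f_def ig V1_def)
  define V where "V = V1 \<inter> (\<lambda>x. (f x, snd c2 (inv g))) -` U2"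
  have s2: "smooth_on V1 (\<lambda>x. (f x, snd c2 (inv g)))"
    using f by (auto simp: smooth_on_def oV1 intro!: C_on_Pair C_on_const)
  have oV: "open V" unfolding V_def
    by (rule continuous_open_preimage[OF smooth_on_continuous[OF s2] oV1 smooth_on_open[OF U2(3)]])
  have fx: "chart_inv c (f x) = g \<otimes> uncoord G x" if "x \<in> V1" for x
    using chart_inv_apply[OF compat c(1)] U1(3)[of "snd c g" x] that by (simp add: f_def V1_def ig)
  have f0: "f origin = snd c g" using g by (simp add: f_def uncoord_coord base_chart)
  have "smooth_on V (\<lambda>x. coord G (chart_inv c (f x) \<otimes> chart_inv c2 (snd c2 (inv g))))"
    using smooth_on_compose[OF smooth_on_subset[OF s2 _ oV] U2(3)] by (auto simp: V_def)
  then have "smooth_on V (conj_coord g)"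
    by (rule smooth_on_cong) (simp add: V_def fx ig conj_coord_def)
  moreover have "origin \<in> V" using U1(1) U2(1) by (auto simp: V_def V1_def f0)
  moreover have "V \<subseteq> coord G ` base_dom" using U1(2) by (auto simp: V_def V1_def)
  moreover have "g \<otimes> uncoord G x \<otimes> inv g \<in> base_dom" if "x \<in> V" for x
    using U2(2)[of "f x" "snd c2 (inv g)"] that fx[of x] by (simp add: V_def ig)
  ultimately show ?thesis using that[of V] oV by blast
qed

lemma eventually_dom: "eventually (\<lambda>x. x \<in> coord G ` base_dom) (nhds origin)"
  by (rule conj_local[OF one_closed]) (auto simp: eventually_nhds)

lemma eventually_conj:
  assumes "g \<in> carrier G"
  shows "eventually (\<lambda>x. g \<otimes> uncoord G x \<otimes> inv g \<in> base_dom) (nhds origin)"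
  by (rule conj_local[OF assms]) (auto simp: eventually_nhds)

lemma conj_coord_origin: "g \<in> carrier G \<Longrightarrow> conj_coord g origin = origin"
  by (simp add: conj_coord_def uncoord_coord base_chart)

lemma Ad_has_derivative:
  assumes "g \<in> carrier G"
  shows "(conj_coord g has_derivative Ad G g) (at origin)"
proof -
  have "conj_coord g differentiable (at origin)"
    by (rule conj_local[OF assms]) (rule smooth_on_differentiable)
  moreover have "Ad G g = frechet_derivative (conj_coord g) (at origin)"
    by (simp add: Ad_def conj_coord_def[abs_def])
  ultimately show ?thesis by (simp add: frechet_derivative_works)
qed

lemma Ad_linear: "g \<in> carrier G \<Longrightarrow> linear (Ad G g)"
  using Ad_has_derivative has_derivative_linear by blast

lemma Ad_one: "Ad G \<one> = (\<lambda>v. v)"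
proof -
  have "eventually (\<lambda>x. x = conj_coord \<one> x) (nhds origin)"
    using eventually_dom
    by eventually_elim (use dom_carrier uncoord_dom coord_uncoord in \<open>auto simp: conj_coord_def\<close>)
  then have "(conj_coord \<one> has_derivative (\<lambda>v. v)) (at origin)"
    using has_derivative_eventually[of "\<lambda>x. x"] has_derivative_ident by blast
  then show ?thesis
    using has_derivative_unique[OF Ad_has_derivative[OF one_closed]] by blast
qed

lemma Ad_mult:
  assumes g: "g \<in> carrier G" and h: "h \<in> carrier G"
  shows "Ad G (g \<otimes> h) v = Ad G g (Ad G h v)"
proof -
  have "((\<lambda>x. conj_coord g (conj_coord h x)) has_derivative (\<lambda>v. Ad G g (Ad G h v))) (at origin)"
    by (rule has_derivative_compose[OF Ad_has_derivative[OF h]])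
      (simp add: conj_coord_origin h Ad_has_derivative g)
  moreover have "eventually (\<lambda>x. conj_coord g (conj_coord h x) = conj_coord (g \<otimes> h) x) (nhds origin)"
    using eventually_conj[OF h] eventually_dom
  proof eventually_elim
    case (elim x)
    then have "uncoord G x \<in> carrier G" using uncoord_dom dom_carrier by blast
    with elim show ?case using g h by (simp add: conj_coord_def uncoord_coord inv_mult_group m_assoc)
  qed
  ultimately have "(conj_coord (g \<otimes> h) has_derivative (\<lambda>v. Ad G g (Ad G h v))) (at origin)"
    by (rule has_derivative_eventually)
  from has_derivative_unique[OF this Ad_has_derivative] g h show ?thesis by (metis m_closed)
qed

text \<open>With P the product and J the inverse in coordinates, conjugation is
  \<open>z \<mapsto> P (P (x, z), J x)\<close>; its derivative at the origin involves first derivatives of P only,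
  hence is differentiable in x.\<close>

lemma Ad_uncoord_differentiable: "(\<lambda>x. Ad G (uncoord G x) Y) differentiable (at origin)"
proof -
  define P where "P = (\<lambda>z. coord G (uncoord G (fst z) \<otimes> uncoord G (snd z)))"
  define J where "J = (\<lambda>x. coord G (inv (uncoord G x)))"
  obtain U where U: "(origin, origin) \<in> U" "U \<subseteq> coord G ` base_dom \<times> coord G ` base_dom"
    "\<And>a b. (a, b) \<in> U \<Longrightarrow> uncoord G a \<otimes> uncoord G b \<in> base_dom" and P: "smooth_on U P"
    unfolding P_def
    by (rule mult_charts[of \<one> "base_chart G" \<one> "base_chart G" "base_chart G"])
      (use base_chart in \<open>auto simp: coord_def uncoord_def\<close>)
  obtain V where V: "origin \<in> V" "V \<subseteq> coord G ` base_dom" "\<And>x. x \<in> V \<Longrightarrow> inv (uncoord G x) \<in> base_dom"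
    and J: "smooth_on V J" unfolding J_def by (rule inv_chart) blast
  have J0: "J origin = origin" by (simp add: J_def uncoord_coord base_chart)
  have oU: "open U" and oV: "open V" using P J smooth_on_open by auto
  define N where "N = (V \<inter> (\<lambda>x. (x, J x)) -` U) \<inter> (\<lambda>x. (x, origin)) -` U"
  have oN: "open N" unfolding N_def
    by (intro open_Int continuous_open_preimage[OF _ oV oU] open_vimage[OF oU] continuous_intros
        smooth_on_continuous[OF J])
  have N0: "origin \<in> N" using U(1) V(1) by (simp add: N_def J0)
  let ?D = "\<lambda>z. frechet_derivative P (at z)"
  have DP: "(P has_derivative ?D z) (at z)" if "z \<in> U" for z
    using smooth_on_differentiable[OF P that] by (simp add: frechet_derivative_works)
  have eq: "?D (x, J x) (?D (x, origin) (0, Y), 0) = Ad G (uncoord G x) Y" if x: "x \<in> N" for x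
  proof -
    let ?h = "uncoord G x"
    have xd: "x \<in> coord G ` base_dom" using x V(2) by (auto simp: N_def)
    then have h: "?h \<in> carrier G" using uncoord_dom dom_carrier by blast
    have Pxo: "P (x, origin) = x" using h coord_uncoord[OF xd] by (simp add: P_def uncoord_coord base_chart)
    define Z where "Z = (\<lambda>z. (x, z)) -` U"
    have oZ: "open Z" unfolding Z_def by (intro open_vimage[OF oU] continuous_intros)
    have Z0: "origin \<in> Z" using x by (simp add: Z_def N_def)
    have d1: "((\<lambda>z. P (x, z)) has_derivative (\<lambda>v. ?D (x, origin) (0, v))) (at origin)"
      by (rule has_derivative_compose[of "\<lambda>z. (x, z)" _ _ _ P])
        (use Z0 DP in \<open>auto simp: Z_def intro!: derivative_eq_intros\<close>)
    have d2: "((\<lambda>z. P (P (x, z), J x)) has_derivative (\<lambda>v. ?D (x, J x) (?D (x, origin) (0, v), 0))) (at origin)"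
      by (rule has_derivative_compose[of "\<lambda>z. (P (x, z), J x)" _ _ _ P])
        (use x DP in \<open>auto simp: N_def Pxo intro!: derivative_eq_intros d1\<close>)
    have "P (P (x, z), J x) = conj_coord ?h z" if "z \<in> Z" for z
    proof -
      have "?h \<otimes> uncoord G z \<in> base_dom" using U(3) that by (simp add: Z_def)
      moreover have "inv ?h \<in> base_dom" using V(3) x by (simp add: N_def)
      ultimately show ?thesis by (simp add: P_def J_def conj_coord_def uncoord_coord)
    qed
    with oZ Z0 have "(conj_coord ?h has_derivative (\<lambda>v. ?D (x, J x) (?D (x, origin) (0, v), 0))) (at origin)"
      by (intro has_derivative_transform_within_open[OF d2]) auto
    from has_derivative_unique[OF this Ad_has_derivative[OF h]] show ?thesis by metis
  qed
  have dJ: "J differentiable (at origin)" by (rule smooth_on_differentiable[OF J V(1)])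
  have w: "(\<lambda>x. ?D (x, origin) (0, Y)) differentiable (at origin)"
    by (rule differentiable_frechet_apply[OF P])
      (use U(1) in \<open>auto intro!: differentiable_Pair\<close>)
  have "(\<lambda>x. ?D (x, J x) (?D (x, origin) (0, Y), 0)) differentiable (at origin)"
    by (rule differentiable_frechet_apply[OF P])
      (use U(1) dJ w in \<open>auto intro!: differentiable_Pair simp: J0\<close>)
  then obtain D where "((\<lambda>x. ?D (x, J x) (?D (x, origin) (0, Y), 0)) has_derivative D) (at origin)"
    by (auto simp: differentiable_def)
  from has_derivative_transform_within_open[OF this oN N0 eq] show ?thesis
    by (auto simp: differentiable_def)
qed

lemma Ad_uncoord_has_derivative:
  "((\<lambda>x. Ad G (uncoord G x) Y) has_derivative (\<lambda>X. lie_bracket G X Y)) (at origin)"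
  using Ad_uncoord_differentiable[of Y] by (simp add: frechet_derivative_works lie_bracket_def[abs_def])

text \<open>In the first slot the bracket is a Frechet derivative. In the second it inherits
  linearity from \<open>Ad\<close>, by uniqueness of the derivative.\<close>

lemma bilinear_lie_bracket: "bilinear (lie_bracket G)"
proof -
  have 1: "linear (\<lambda>X. lie_bracket G X Y)" for Y
    using Ad_uncoord_has_derivative has_derivative_linear by blast
  have ev: "eventually (\<lambda>x. linear (Ad G (uncoord G x))) (nhds origin)"
    using eventually_dom by eventually_elim (use Ad_linear uncoord_dom dom_carrier in blast)
  have 2: "lie_bracket G X (r *\<^sub>R Y + Z) = r *\<^sub>R lie_bracket G X Y + lie_bracket G X Z" for r X Y Z
  proof -
    have "((\<lambda>x. r *\<^sub>R Ad G (uncoord G x) Y + Ad G (uncoord G x) Z) has_derivative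
        (\<lambda>X. r *\<^sub>R lie_bracket G X Y + lie_bracket G X Z)) (at origin)"
      by (intro has_derivative_add has_derivative_scaleR_right Ad_uncoord_has_derivative)
    moreover have "eventually (\<lambda>x. r *\<^sub>R Ad G (uncoord G x) Y + Ad G (uncoord G x) Z
         = Ad G (uncoord G x) (r *\<^sub>R Y + Z)) (nhds origin)"
      using ev by eventually_elim (simp add: linear_add linear_cmul)
    ultimately have "((\<lambda>x. Ad G (uncoord G x) (r *\<^sub>R Y + Z)) has_derivative
        (\<lambda>X. r *\<^sub>R lie_bracket G X Y + lie_bracket G X Z)) (at origin)"
      by (rule has_derivative_eventually)
    from has_derivative_unique[OF this Ad_uncoord_has_derivative] show ?thesis by metis
  qed
  have "linear (lie_bracket G X)" for X
    using 2[of X 1] 2[of X _ _ 0] 2[of X 1 0 0] by (intro linearI) auto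
  with 1 show ?thesis by (simp add: bilinear_def)
qed

section \<open>One-parameter subgroups and the identities of the bracket\<close>

lemma one_parameter_zero:
  assumes "one_parameter_subgroup G X \<gamma>"
  shows "\<gamma> 0 = \<one>"
proof -
  have "\<gamma> 0 \<in> carrier G" "\<gamma> (0 + 0) = \<gamma> 0 \<otimes> \<gamma> 0"
    using assms unfolding one_parameter_subgroup_def by blast+
  then show ?thesis by (simp add: l_cancel_one')
qed

text \<open>The velocity condition concerns \<open>coord G (\<gamma> t)\<close>, which carries no
  information outside the chart domain; that \<gamma> stays inside for small t comes from its
  smoothness.\<close>

lemma one_parameter_dom:
  assumes "one_parameter_subgroup G X \<gamma>"
  shows "eventually (\<lambda>t. \<gamma> t \<in> base_dom) (nhds 0)"
proof -
  have sm: "smooth_map_on euclidean vector_atlas UNIV (gatlas G) \<gamma>"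
    using assms by (simp add: one_parameter_subgroup_def)
  let ?c = "(UNIV, id) :: (real, real) chart"
  have c: "?c \<in> vector_atlas" by (simp add: vector_atlas_def)
  have ci: "chart_inv ?c t = t" for t by (simp add: chart_inv_def inv_into_def)
  obtain U where "snd ?c 0 \<in> U" "\<And>t. t \<in> U \<Longrightarrow> \<gamma> (chart_inv ?c t) \<in> base_dom"
      "smooth_on U (\<lambda>t. snd (base_chart G) (\<gamma> (chart_inv ?c t)))"
    by (rule smooth_map_on_charts[OF compatible_vector_atlas compat sm _ _ c _ base_chart(1), of 0])
      (use one_parameter_zero[OF assms] base_chart in auto)
  then show ?thesis by (auto simp: ci eventually_nhds dest: smooth_on_open)
qed

lemma one_parameter_carrier: "one_parameter_subgroup G X \<gamma> \<Longrightarrow> \<gamma> t \<in> carrier G"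
  by (simp add: one_parameter_subgroup_def)

text \<open>All derivatives along s exp(tX) go back to this formula: differentiate at the identity,
  where the bracket is the derivative of \<open>Ad\<close>, then apply the fixed linear map
  \<open>Ad G g\<close>.\<close>

lemma Ad_one_parameter:
  assumes g: "g \<in> carrier G" and \<gamma>: "one_parameter_subgroup G X \<gamma>"
  shows "((\<lambda>t. Ad G (g \<otimes> \<gamma> t) v) has_vector_derivative Ad G g (lie_bracket G X v)) (at 0)"
proof -
  have "((\<lambda>t. coord G (\<gamma> t)) has_vector_derivative X) (at 0)"
    using \<gamma> by (simp add: one_parameter_subgroup_def)
  then have 1: "((\<lambda>t. Ad G (uncoord G (coord G (\<gamma> t))) v) has_vector_derivative lie_bracket G X v) (at 0)"
    by (rule has_derivative_has_vector_derivative)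
      (simp add: one_parameter_zero[OF \<gamma>] Ad_uncoord_has_derivative)
  have "eventually (\<lambda>t. Ad G (uncoord G (coord G (\<gamma> t))) v = Ad G (\<gamma> t) v) (nhds 0)"
    using one_parameter_dom[OF \<gamma>] by eventually_elim (simp add: uncoord_coord)
  from has_vector_derivative_eventually[OF 1 this]
  have "((\<lambda>t. Ad G (\<gamma> t) v) has_vector_derivative lie_bracket G X v) (at 0)" .
  from has_derivative_has_vector_derivative[OF this linear_imp_has_derivative[OF Ad_linear[OF g]]]
  show ?thesis using g one_parameter_carrier[OF \<gamma>] by (simp add: Ad_mult)
qed

text \<open>Yields \<open>[X, X] = 0\<close>, hence the antisymmetry of the bracket, in those directions that integrate to
  one-parameter subgroups; this avoids an existence theorem for differential equations.\<close>

lemma Ad_one_parameter_self: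
  assumes \<gamma>: "one_parameter_subgroup G X \<gamma>"
  shows "Ad G (\<gamma> t) X = X"
proof -
  have d: "((\<lambda>s. coord G (\<gamma> s)) has_vector_derivative X) (at 0)"
    using \<gamma> by (simp add: one_parameter_subgroup_def)
  have car: "\<gamma> s \<in> carrier G" for s using one_parameter_carrier[OF \<gamma>] .
  have comm: "\<gamma> t \<otimes> \<gamma> s \<otimes> inv (\<gamma> t) = \<gamma> s" for s
  proof -
    have "\<gamma> t \<otimes> \<gamma> s = \<gamma> s \<otimes> \<gamma> t"
      using \<gamma> unfolding one_parameter_subgroup_def by (metis add.commute)
    then show ?thesis using car by (simp add: m_assoc)
  qed
  have 1: "((\<lambda>s. conj_coord (\<gamma> t) (coord G (\<gamma> s))) has_vector_derivative Ad G (\<gamma> t) X) (at 0)"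
    by (rule has_derivative_has_vector_derivative[OF d])
      (simp add: one_parameter_zero[OF \<gamma>] Ad_has_derivative car)
  have "eventually (\<lambda>s. conj_coord (\<gamma> t) (coord G (\<gamma> s)) = coord G (\<gamma> s)) (nhds 0)"
    using one_parameter_dom[OF \<gamma>] by eventually_elim (simp add: uncoord_coord conj_coord_def comm)
  from has_vector_derivative_eventually[OF 1 this] show ?thesis
    using d vector_derivative_unique_at by blast
qed

lemma lie_bracket_self:
  assumes \<gamma>: "one_parameter_subgroup G X \<gamma>"
  shows "lie_bracket G X X = 0"
proof -
  have "((\<lambda>t. X) has_vector_derivative lie_bracket G X X) (at 0)"
    using Ad_one_parameter[OF one_closed \<gamma>, of X]
    by (simp add: Ad_one one_parameter_carrier[OF \<gamma>] Ad_one_parameter_self[OF \<gamma>])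
  then show ?thesis using vector_derivative_unique_at has_vector_derivative_const by blast
qed

text \<open>Differentiate Ad(g x g^-1)(Ad(g) Z) = Ad(g)(Ad(x) Z) in x at the identity; on the left,
  conjugation contributes the inner derivative \<open>Ad G g\<close>.\<close>

lemma Ad_lie_bracket:
  assumes g: "g \<in> carrier G"
  shows "Ad G g (lie_bracket G Y Z) = lie_bracket G (Ad G g Y) (Ad G g Z)"
proof -
  let ?Z = "Ad G g Z"
  have 1: "((\<lambda>x. Ad G (uncoord G (conj_coord g x)) ?Z) has_derivative (\<lambda>Y. lie_bracket G (Ad G g Y) ?Z)) (at origin)"
    by (rule has_derivative_compose[OF Ad_has_derivative[OF g]])
      (simp add: conj_coord_origin g Ad_uncoord_has_derivative)
  have "eventually (\<lambda>x. Ad G (uncoord G (conj_coord g x)) ?Z = Ad G g (Ad G (uncoord G x) Z)) (nhds origin)"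
    using eventually_conj[OF g] eventually_dom
  proof eventually_elim
    case (elim x)
    then have x: "uncoord G x \<in> carrier G" using uncoord_dom dom_carrier by blast
    have "Ad G (inv g) ?Z = Z" using g Ad_mult[of "inv g" g Z] by (simp add: Ad_one)
    with elim x show ?case using g by (simp add: conj_coord_def uncoord_coord Ad_mult)
  qed
  from has_derivative_eventually[OF 1 this]
  have 2: "((\<lambda>x. Ad G g (Ad G (uncoord G x) Z)) has_derivative (\<lambda>Y. lie_bracket G (Ad G g Y) ?Z)) (at origin)" .
  have "((\<lambda>x. Ad G g (Ad G (uncoord G x) Z)) has_derivative (\<lambda>Y. Ad G g (lie_bracket G Y Z))) (at origin)"
    by (rule has_derivative_compose[OF Ad_uncoord_has_derivative linear_imp_has_derivative[OF Ad_linear[OF g]]])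
  from has_derivative_unique[OF this 2] show ?thesis by metis
qed

text \<open>The Jacobi identity in derivation form, obtained by differentiating
  \<open>Ad_lie_bracket\<close> along \<gamma> at 0. Only X has to integrate to a one-parameter
  subgroup.\<close>

lemma lie_bracket_derivation:
  assumes \<gamma>: "one_parameter_subgroup G X \<gamma>"
  shows "lie_bracket G X (lie_bracket G Y Z)
    = lie_bracket G (lie_bracket G X Y) Z + lie_bracket G Y (lie_bracket G X Z)"
proof -
  have d: "((\<lambda>t. Ad G (\<gamma> t) v) has_vector_derivative lie_bracket G X v) (at 0)" for v
    using Ad_one_parameter[OF one_closed \<gamma>, of v] by (simp add: Ad_one one_parameter_carrier[OF \<gamma>])
  have "((\<lambda>t. lie_bracket G (Ad G (\<gamma> t) Y) (Ad G (\<gamma> t) Z)) has_vector_derivative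
     lie_bracket G (Ad G (\<gamma> 0) Y) (lie_bracket G X Z) + lie_bracket G (lie_bracket G X Y) (Ad G (\<gamma> 0) Z)) (at 0)"
    by (rule bounded_bilinear.has_vector_derivative[OF _ d d])
      (use bilinear_lie_bracket bilinear_conv_bounded_bilinear in blast)
  then have "((\<lambda>t. Ad G (\<gamma> t) (lie_bracket G Y Z)) has_vector_derivative
     lie_bracket G Y (lie_bracket G X Z) + lie_bracket G (lie_bracket G X Y) Z) (at 0)"
    by (simp add: Ad_lie_bracket one_parameter_carrier[OF \<gamma>] one_parameter_zero[OF \<gamma>] Ad_one)
  from vector_derivative_unique_at[OF d this] show ?thesis by (simp add: add.commute)
qed

end

section \<open>Alternating forms\<close>

text \<open>Families are total functions and vectors live in an ambient space, so a form is asked to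
  ignore slots outside I and to be linear just for arguments in S.\<close>

definition multilinear_form :: "'i set \<Rightarrow> 'w::real_vector set \<Rightarrow> (('i \<Rightarrow> 'w) \<Rightarrow> real) \<Rightarrow> bool" where
  "multilinear_form I S \<omega> \<longleftrightarrow>
     (\<forall>y z. (\<forall>i\<in>I. y i = z i) \<longrightarrow> \<omega> y = \<omega> z) \<and>
     (\<forall>y i a v w. y \<in> I \<rightarrow> S \<longrightarrow> i \<in> I \<longrightarrow> v \<in> S \<longrightarrow> w \<in> S \<longrightarrow>
        \<omega> (y(i := a *\<^sub>R v + w)) = a * \<omega> (y(i := v)) + \<omega> (y(i := w)))"

definition alternating_form :: "'i set \<Rightarrow> 'w::real_vector set \<Rightarrow> (('i \<Rightarrow> 'w) \<Rightarrow> real) \<Rightarrow> bool" where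
  "alternating_form I S \<omega> \<longleftrightarrow> multilinear_form I S \<omega> \<and>
     (\<forall>y i j. y \<in> I \<rightarrow> S \<longrightarrow> i \<in> I \<longrightarrow> j \<in> I \<longrightarrow> i \<noteq> j \<longrightarrow> y i = y j \<longrightarrow> \<omega> y = 0)"

lemma multilinear_form_cong:
  "multilinear_form I S \<omega> \<Longrightarrow> (\<And>i. i \<in> I \<Longrightarrow> y i = z i) \<Longrightarrow> \<omega> y = \<omega> z"
  by (simp add: multilinear_form_def)

lemma multilinear_form_linear:
  "multilinear_form I S \<omega> \<Longrightarrow> y \<in> I \<rightarrow> S \<Longrightarrow> i \<in> I \<Longrightarrow> v \<in> S \<Longrightarrow> w \<in> S \<Longrightarrow>
    \<omega> (y(i := a *\<^sub>R v + w)) = a * \<omega> (y(i := v)) + \<omega> (y(i := w))"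
  unfolding multilinear_form_def by blast

lemma multilinear_form_sum:
  assumes \<omega>: "multilinear_form I S \<omega>" and S: "subspace S" and y: "y \<in> I \<rightarrow> S" "i \<in> I"
    and v: "\<And>k. k \<in> A \<Longrightarrow> v k \<in> S"
  shows "\<omega> (y(i := \<Sum>k\<in>A. c k *\<^sub>R v k)) = (\<Sum>k\<in>A. c k * \<omega> (y(i := v k)))"
proof -
  have "\<omega> (y(i := 1 *\<^sub>R 0 + 0)) = 1 * \<omega> (y(i := 0)) + \<omega> (y(i := 0))"
    by (rule multilinear_form_linear[OF \<omega> y]) (auto simp: subspace_0 S)
  then have 0: "\<omega> (y(i := 0)) = 0" by simp
  show ?thesis using v
  proof (induction A rule: infinite_finite_induct)
    case (insert k A)
    then have "\<omega> (y(i := c k *\<^sub>R v k + (\<Sum>k\<in>A. c k *\<^sub>R v k)))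
        = c k * \<omega> (y(i := v k)) + \<omega> (y(i := (\<Sum>k\<in>A. c k *\<^sub>R v k)))"
      by (intro multilinear_form_linear[OF \<omega> y] subspace_sum[OF S] subspace_scale[OF S]) auto
    moreover have "\<omega> (y(i := (\<Sum>k\<in>A. c k *\<^sub>R v k))) = (\<Sum>k\<in>A. c k * \<omega> (y(i := v k)))"
      by (rule insert.IH) (use insert.prems in blast)
    ultimately show ?case by (simp only: sum.insert[OF insert.hyps])
  qed (simp_all add: 0)
qed

lemma alternating_form_multilinear: "alternating_form I S \<omega> \<Longrightarrow> multilinear_form I S \<omega>"
  by (simp add: alternating_form_def)

lemma alternating_form_eq_0:
  "alternating_form I S \<omega> \<Longrightarrow> y \<in> I \<rightarrow> S \<Longrightarrow> i \<in> I \<Longrightarrow> j \<in> I \<Longrightarrow> i \<noteq> j \<Longrightarrow> y i = y j \<Longrightarrow> \<omega> y = 0"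
  unfolding alternating_form_def by blast

text \<open>Polarization: the form vanishes when slots a and b both hold \<open>y a + y b\<close>,
  and expanding leaves the two mixed terms.\<close>

lemma alternating_form_swap:
  assumes \<omega>: "alternating_form I S \<omega>" and S: "subspace S" and y: "y \<in> I \<rightarrow> S"
    and ab: "a \<in> I" "b \<in> I" "a \<noteq> b"
  shows "\<omega> (\<lambda>i. y (Transposition.transpose a b i)) = - \<omega> y"
proof -
  have lin: "\<omega> (z(i := v + w)) = \<omega> (z(i := v)) + \<omega> (z(i := w))"
    if "z \<in> I \<rightarrow> S" "i \<in> I" "v \<in> S" "w \<in> S" for z i v w
    using multilinear_form_linear[OF alternating_form_multilinear[OF \<omega>] that, of 1] by simp
  have S': "y a \<in> S" "y b \<in> S" using y ab by auto
  have sum: "y a + y b \<in> S" using S' S by (simp add: subspace_add)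
  have mem: "y(a := u, b := v) \<in> I \<rightarrow> S" "y(a := u) \<in> I \<rightarrow> S" if "u \<in> S" "v \<in> S" for u v
    using y that by auto
  have zero: "\<omega> (y(a := u, b := u)) = 0" if "u \<in> S" for u
    by (rule alternating_form_eq_0[OF \<omega> mem(1)[OF that that] ab]) (use ab in auto)
  have tw: "y(a := u, b := v) = y(b := v, a := u)" for u v using ab by (simp add: fun_upd_twist)
  have "0 = \<omega> (y(a := y a + y b, b := y a + y b))" using zero[OF sum] by simp
  also have "\<dots> = \<omega> (y(a := y a + y b, b := y a)) + \<omega> (y(a := y a + y b, b := y b))"
    using S' sum ab mem by (intro lin) auto
  also have "\<omega> (y(a := y a + y b, b := y a)) = \<omega> (y(a := y a, b := y a)) + \<omega> (y(a := y b, b := y a))"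
    unfolding tw using S' ab y by (intro lin) auto
  also have "\<omega> (y(a := y a + y b, b := y b)) = \<omega> (y(a := y a, b := y b)) + \<omega> (y(a := y b, b := y b))"
    unfolding tw using S' ab y by (intro lin) auto
  finally have "\<omega> (y(a := y b, b := y a)) = - \<omega> (y(a := y a, b := y b))"
    unfolding zero[OF S'(1)] zero[OF S'(2)] by linarith
  then have "\<omega> (y(a := y b, b := y a)) = - \<omega> y" by (simp only: fun_upd_triv)
  moreover have "(\<lambda>i. y (Transposition.transpose a b i)) = y(a := y b, b := y a)"
    using ab by (auto simp: fun_eq_iff Transposition.transpose_def)
  ultimately show ?thesis by simp
qed

text \<open>Expanding all slots in e leaves values on families of frame vectors. A repeated index
  gives 0; otherwise, the frame having as many members as there are slots, the family is a
  rearrangement of e, which transpositions undo.\<close>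

lemma alternating_form_zero_on_frame:
  assumes \<omega>: "alternating_form I S \<omega>" and S: "subspace S" and I: "finite I"
    and e: "e \<in> I \<rightarrow> S" and c: "\<And>v. v \<in> S \<Longrightarrow> v = (\<Sum>i\<in>I. c v i *\<^sub>R e i)"
    and 0: "\<omega> e = 0" and y: "y \<in> I \<rightarrow> S"
  shows "\<omega> y = 0"
proof -
  note ml = alternating_form_multilinear[OF \<omega>]
  have perm: "\<omega> (\<lambda>i. z (\<pi> i)) = 0" if "\<pi> permutes I" "z \<in> I \<rightarrow> S" "\<omega> z = 0" for \<pi> z
    using that
  proof (induction arbitrary: z rule: permutes_induct[consumes 1, case_names fin id swap])
    case (swap a b p)
    have "(\<lambda>i. z (Transposition.transpose a b i)) \<in> I \<rightarrow> S"
      using swap.hyps(1,2) swap.prems by (auto simp: Transposition.transpose_def)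
    moreover have "\<omega> (\<lambda>i. z (Transposition.transpose a b i)) = 0"
      using alternating_form_swap[OF \<omega> S swap.prems(1) swap.hyps(1-3)] swap.prems by simp
    ultimately show ?case using swap.IH by simp
  qed (use I in auto)
  have fr: "\<omega> (\<lambda>i. e (f i)) = 0" if f: "f ` I \<subseteq> I" for f
  proof (cases "inj_on f I")
    case True
    define \<pi> where "\<pi> = (\<lambda>i. if i \<in> I then f i else i)"
    have "bij_betw f I I" using True f endo_inj_surj[OF I f] by (simp add: bij_betw_def)
    then have "bij_betw \<pi> I I" by (simp add: \<pi>_def cong: bij_betw_cong)
    then have "\<pi> permutes I" by (intro bij_imp_permutes) (auto simp: \<pi>_def)
    then have "\<omega> (\<lambda>i. e (\<pi> i)) = 0" using perm e 0 by blast
    then show ?thesis using multilinear_form_cong[OF ml, of "\<lambda>i. e (f i)" "\<lambda>i. e (\<pi> i)"] by (simp add: \<pi>_def)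
  next
    case False
    then obtain i j where "i \<in> I" "j \<in> I" "i \<noteq> j" "f i = f j" by (auto simp: inj_on_def)
    then show ?thesis using e f by (intro alternating_form_eq_0[OF \<omega>, of _ i j]) auto
  qed
  \<comment> \<open>Induction on the set J of slots that need not yet hold frame vectors; each step
    expands one of them.\<close>
  have "\<omega> y = 0" if "J \<subseteq> I" "y \<in> I \<rightarrow> S" "\<And>i. i \<in> I - J \<Longrightarrow> y i \<in> e ` I" for J y
    using finite_subset[OF that(1) I] that
  proof (induction J arbitrary: y rule: finite_induct)
    case empty
    then have "\<forall>i\<in>I. \<exists>k\<in>I. y i = e k" by auto
    from bchoice[OF this[unfolded Bex_def]] obtain f where "\<forall>i\<in>I. f i \<in> I \<and> y i = e (f i)" by blast
    then show ?case using fr[of f] multilinear_form_cong[OF ml, of y "\<lambda>i. e (f i)"] by auto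
  next
    case (insert j J)
    have j: "j \<in> I" using insert by auto
    have "y j \<in> S" using insert.prems j by auto
    then have "\<omega> y = \<omega> (y(j := \<Sum>k\<in>I. c (y j) k *\<^sub>R e k))"
      by (simp only: c[symmetric] fun_upd_triv)
    also have "\<dots> = (\<Sum>k\<in>I. c (y j) k * \<omega> (y(j := e k)))"
      using e insert.prems j by (intro multilinear_form_sum[OF ml S]) auto
    also have "\<dots> = 0"
    proof (intro sum.neutral ballI)
      fix k assume k: "k \<in> I"
      have "\<omega> (y(j := e k)) = 0"
        by (rule insert.IH) (use insert.prems e k in auto)
      then show "c (y j) k * \<omega> (y(j := e k)) = 0" by simp
    qed
    finally show ?case .
  qed
  from this[of I y] y show ?thesis by simp
qed

lemma alternating_form_lincomb:
  assumes "alternating_form I S \<omega>" "alternating_form I S \<eta>"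
  shows "alternating_form I S (\<lambda>y. a * \<omega> y + b * \<eta> y)"
proof -
  have "multilinear_form I S (\<lambda>y. a * \<omega> y + b * \<eta> y)"
    unfolding multilinear_form_def
  proof (intro conjI allI impI)
    fix y z :: "'a \<Rightarrow> 'b" assume "\<forall>i\<in>I. y i = z i"
    then have "\<omega> y = \<omega> z" "\<eta> y = \<eta> z"
      using multilinear_form_cong[OF alternating_form_multilinear[OF assms(1)]]
        multilinear_form_cong[OF alternating_form_multilinear[OF assms(2)]] by blast+
    then show "a * \<omega> y + b * \<eta> y = a * \<omega> z + b * \<eta> z" by simp
  next
    fix y i r v w assume yi: "y \<in> I \<rightarrow> S" "i \<in> I" "v \<in> S" "w \<in> S"
    from multilinear_form_linear[OF alternating_form_multilinear[OF assms(1)] yi, of r]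
      multilinear_form_linear[OF alternating_form_multilinear[OF assms(2)] yi, of r]
    show "a * \<omega> (y(i := r *\<^sub>R v + w)) + b * \<eta> (y(i := r *\<^sub>R v + w)) =
       r * (a * \<omega> (y(i := v)) + b * \<eta> (y(i := v))) + (a * \<omega> (y(i := w)) + b * \<eta> (y(i := w)))"
      by (simp only: distrib_left mult.left_commute[of _ r] add_ac)
  qed
  then show ?thesis using assms by (auto simp: alternating_form_def)
qed

text \<open>Top-degree forms make up a line, so two of them are compared on a single frame.
  Determinants, traces and pull-back factors are all read off in this way.\<close>

lemma alternating_form_unique:
  assumes "alternating_form I S \<omega>" "alternating_form I S \<eta>" and S: "subspace S" and I: "finite I"
    and e: "e \<in> I \<rightarrow> S" and c: "\<And>v. v \<in> S \<Longrightarrow> v = (\<Sum>i\<in>I. c v i *\<^sub>R e i)"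
    and eq: "\<omega> e = a * \<eta> e" and y: "y \<in> I \<rightarrow> S"
  shows "\<omega> y = a * \<eta> y"
  using alternating_form_zero_on_frame[OF alternating_form_lincomb[OF assms(1,2), of 1 "- a"] S I e c _ y] eq
  by simp

lemma alternating_form_compose:
  assumes \<omega>: "alternating_form I S' \<omega>" and T: "\<And>v. v \<in> S \<Longrightarrow> T v \<in> S'"
    and lin: "\<And>a v w. v \<in> S \<Longrightarrow> w \<in> S \<Longrightarrow> T (a *\<^sub>R v + w) = a *\<^sub>R T v + T w"
  shows "alternating_form I S (\<lambda>y. \<omega> (\<lambda>i. T (y i)))"
proof -
  have upd: "(\<lambda>k. T ((y(i := v)) k)) = (\<lambda>k. T (y k))(i := T v)" for y i v
    by auto
  have mem: "(\<lambda>k. T (y k)) \<in> I \<rightarrow> S'" if "y \<in> I \<rightarrow> S" for y using that T by auto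
  note ml = alternating_form_multilinear[OF \<omega>]
  have "multilinear_form I S (\<lambda>y. \<omega> (\<lambda>i. T (y i)))"
    unfolding multilinear_form_def
  proof (intro conjI allI impI)
    fix y z :: "'a \<Rightarrow> 'c" assume "\<forall>i\<in>I. y i = z i"
    then show "\<omega> (\<lambda>i. T (y i)) = \<omega> (\<lambda>i. T (z i))" by (intro multilinear_form_cong[OF ml]) simp
  qed (simp only: upd lin, rule multilinear_form_linear[OF ml], auto simp: T mem)
  then show ?thesis unfolding alternating_form_def
    using alternating_form_eq_0[OF \<omega> mem] by auto
qed

text \<open>If slots j and k agree, replacing any other slot leaves them equal and gives 0; the two
  remaining terms differ by the transposition of j and k and cancel.\<close>

lemma alternating_form_derivation:
  assumes \<omega>: "alternating_form I S \<omega>" and S: "subspace S" and I: "finite I"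
    and A: "\<And>v. v \<in> S \<Longrightarrow> A v \<in> S"
    and lin: "\<And>a v w. v \<in> S \<Longrightarrow> w \<in> S \<Longrightarrow> A (a *\<^sub>R v + w) = a *\<^sub>R A v + A w"
  shows "alternating_form I S (\<lambda>y. \<Sum>i\<in>I. \<omega> (y(i := A (y i))))"
  unfolding alternating_form_def multilinear_form_def
proof (intro conjI allI impI)
  note ml = alternating_form_multilinear[OF \<omega>]
  fix y z :: "'a \<Rightarrow> 'b" assume "\<forall>i\<in>I. y i = z i"
  then show "(\<Sum>i\<in>I. \<omega> (y(i := A (y i)))) = (\<Sum>i\<in>I. \<omega> (z(i := A (z i))))"
    by (intro sum.cong multilinear_form_cong[OF ml]) auto
next
  note ml = alternating_form_multilinear[OF \<omega>]
  fix y j a v w assume y: "y \<in> I \<rightarrow> S" "j \<in> I" "v \<in> S" "w \<in> S"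
  have "\<omega> ((y(j := a *\<^sub>R v + w))(i := A ((y(j := a *\<^sub>R v + w)) i)))
      = a * \<omega> ((y(j := v))(i := A ((y(j := v)) i))) + \<omega> ((y(j := w))(i := A ((y(j := w)) i)))"
    if "i \<in> I" for i
  proof (cases "i = j")
    case True
    from multilinear_form_linear[OF ml y(1,2) A[OF y(3)] A[OF y(4)]] show ?thesis
      unfolding True fun_upd_same fun_upd_upd lin[OF y(3,4)] .
  next
    case False
    have "y(i := A (y i)) \<in> I \<rightarrow> S" using y(1) A that by (simp add: Pi_iff)
    from multilinear_form_linear[OF ml this y(2-4)] show ?thesis
      using False by (simp add: fun_upd_twist)
  qed
  then show "(\<Sum>i\<in>I. \<omega> ((y(j := a *\<^sub>R v + w))(i := A ((y(j := a *\<^sub>R v + w)) i)))) =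
      a * (\<Sum>i\<in>I. \<omega> ((y(j := v))(i := A ((y(j := v)) i)))) + (\<Sum>i\<in>I. \<omega> ((y(j := w))(i := A ((y(j := w)) i))))"
    by (simp add: sum_distrib_left sum.distrib)
next
  fix y j k assume y: "y \<in> I \<rightarrow> S" "j \<in> I" "k \<in> I" "j \<noteq> k" "y j = y k"
  have Ay: "y(i := A (y i)) \<in> I \<rightarrow> S" if "i \<in> I" for i using y(1) A that by (simp add: Pi_iff)
  have "(\<Sum>i\<in>I. \<omega> (y(i := A (y i)))) = (\<Sum>i\<in>{j,k}. \<omega> (y(i := A (y i))))"
    using y I by (intro sum.mono_neutral_right) (auto intro!: alternating_form_eq_0[OF \<omega> Ay, of _ j k])
  also have "\<dots> = \<omega> (y(j := A (y j))) + \<omega> (y(k := A (y k)))" using y by simp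
  also have "y(k := A (y k)) = (\<lambda>i. (y(j := A (y j))) (Transposition.transpose j k i))"
    using y by (auto simp: fun_eq_iff Transposition.transpose_def)
  also have "\<omega> \<dots> = - \<omega> (y(j := A (y j)))"
    by (rule alternating_form_swap[OF \<omega> S Ay]) (use y in auto)
  finally show "(\<Sum>i\<in>I. \<omega> (y(i := A (y i)))) = 0" by (simp only: add.right_inverse)
qed

text \<open>On the frame, inserting \<open>A (e i)\<close> in slot i keeps just the component along
  \<open>e i\<close>, since every other one repeats a vector. This turns the slot sum of a Lie
  derivative into a trace.\<close>

lemma alternating_form_trace:
  assumes \<omega>: "alternating_form I S \<omega>" and S: "subspace S" and I: "finite I"
    and e: "e \<in> I \<rightarrow> S" and c: "\<And>v. v \<in> S \<Longrightarrow> v = (\<Sum>i\<in>I. c v i *\<^sub>R e i)"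
    and A: "\<And>v. v \<in> S \<Longrightarrow> A v \<in> S"
    and lin: "\<And>a v w. v \<in> S \<Longrightarrow> w \<in> S \<Longrightarrow> A (a *\<^sub>R v + w) = a *\<^sub>R A v + A w"
    and y: "y \<in> I \<rightarrow> S"
  shows "(\<Sum>i\<in>I. \<omega> (y(i := A (y i)))) = (\<Sum>i\<in>I. c (A (e i)) i) * \<omega> y"
proof (rule alternating_form_unique[OF alternating_form_derivation[OF \<omega> S I A lin] \<omega> S I e c _ y])
  have "\<omega> (e(i := A (e i))) = c (A (e i)) i * \<omega> e" if i: "i \<in> I" for i
  proof -
    have "\<omega> (e(i := A (e i))) = \<omega> (e(i := \<Sum>k\<in>I. c (A (e i)) k *\<^sub>R e k))"
      by (subst c[symmetric]) (use A e i in auto)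
    also have "\<dots> = (\<Sum>k\<in>I. c (A (e i)) k * \<omega> (e(i := e k)))"
      using e i by (intro multilinear_form_sum[OF alternating_form_multilinear[OF \<omega>] S]) auto
    also have "\<dots> = (\<Sum>k\<in>{i}. c (A (e i)) k * \<omega> (e(i := e k)))"
    proof (rule sum.mono_neutral_right)
      have "\<omega> (e(i := e k)) = 0" if "k \<in> I - {i}" for k
        by (rule alternating_form_eq_0[OF \<omega>, of _ i k]) (use that e i in auto)
      then show "\<forall>k\<in>I - {i}. c (A (e i)) k * \<omega> (e(i := e k)) = 0" by simp
    qed (use i I in auto)
    finally show ?thesis by simp
  qed
  then show "(\<Sum>i\<in>I. \<omega> (e(i := A (e i)))) = (\<Sum>i\<in>I. c (A (e i)) i) * \<omega> e"
    by (simp add: sum_distrib_right)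
qed

section \<open>Antisymmetrization and wedge powers\<close>

lemma sum_permutations_eq_0:
  fixes F :: "('a \<Rightarrow> 'a) \<Rightarrow> real"
  assumes "finite I" "j \<in> I" "k \<in> I" "j \<noteq> k" and F: "\<And>\<pi>. \<pi> permutes I \<Longrightarrow> F (Transposition.transpose j k \<circ> \<pi>) = F \<pi>"
  shows "(\<Sum>\<pi> | \<pi> permutes I. of_int (sign \<pi>) * F \<pi>) = 0"
proof -
  let ?t = "Transposition.transpose j k"
  have t: "?t permutes I" by (rule permutes_swap_id[OF assms(2,3)])
  have sg: "sign (?t \<circ> \<pi>) = - sign \<pi>" if "\<pi> permutes I" for \<pi>
  proof -
    have "permutation \<pi>" "permutation ?t" using that t assms(1) permutation_permutes by blast+
    then show ?thesis using sign_compose[of ?t \<pi>] sign_swap_id[of j k] assms(4) by simp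
  qed
  have "(\<Sum>\<pi> | \<pi> permutes I. of_int (sign \<pi>) * F \<pi>) = (\<Sum>\<pi> | \<pi> permutes I. of_int (sign (?t \<circ> \<pi>)) * F (?t \<circ> \<pi>))"
    by (rule setum_permutations_compose_left[OF t])
  also have "\<dots> = - (\<Sum>\<pi> | \<pi> permutes I. of_int (sign \<pi>) * F \<pi>)"
    unfolding sum_negf[symmetric] by (intro sum.cong refl) (simp add: sg F)
  finally show ?thesis by simp
qed

text \<open>Alternation comes from the signed sum over permutations rather than from the factors, so
  multilinear \<alpha> and \<beta> suffice.\<close>

lemma alternating_form_wedge:
  assumes \<alpha>: "multilinear_form {..<m} S \<alpha>" and \<beta>: "multilinear_form {..<n} S \<beta>"
  shows "alternating_form {..<m + n} S (wedge m n \<alpha> \<beta>)"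
  unfolding alternating_form_def multilinear_form_def
proof (intro conjI allI impI)
  fix y z :: "nat \<Rightarrow> 'a" assume eq: "\<forall>i\<in>{..<m + n}. y i = z i"
  have "y (\<pi> i) = z (\<pi> i)" if "\<pi> permutes {..<m + n}" "i < m + n" for \<pi> i
    using permutes_in_image[OF that(1), of i] that(2) eq by simp
  then show "wedge m n \<alpha> \<beta> y = wedge m n \<alpha> \<beta> z"
    unfolding wedge_def
    by (intro arg_cong2[of _ _ _ _ "(/)"] sum.cong arg_cong2[of _ _ _ _ "(*)"]
        multilinear_form_cong[OF \<alpha>] multilinear_form_cong[OF \<beta>] refl) auto
next
  fix y j a v w assume y: "y \<in> {..<m + n} \<rightarrow> S" "j \<in> {..<m + n}" "v \<in> S" "w \<in> S"
  let ?t = "\<lambda>y \<pi>. of_int (sign \<pi>) * \<alpha> (\<lambda>i. y (\<pi> i)) * \<beta> (\<lambda>i. y (\<pi> (m + i)))"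
  have "?t (y(j := a *\<^sub>R v + w)) \<pi> = a * ?t (y(j := v)) \<pi> + ?t (y(j := w)) \<pi>"
    if \<pi>: "\<pi> permutes {..<m + n}" for \<pi>
  proof -
    \<comment> \<open>The modified argument j is seen at position k of the permuted list; comparing
      k with m tells whether \<alpha> or \<beta> receives it.\<close>
    define k where "k = inv_into UNIV \<pi> j"
    have k: "\<pi> k = j" by (simp add: k_def permutes_inverses[OF \<pi>])
    have "k < m + n" using permutes_in_image[OF \<pi>, of k] y(2) by (simp add: k)
    have in_j: "\<pi> i = j \<longleftrightarrow> i = k" for i by (auto simp: k_def permutes_inverses[OF \<pi>])
    have ym: "(\<lambda>i. y (\<pi> i)) \<in> {..<m} \<rightarrow> S" "(\<lambda>i. y (\<pi> (m + i))) \<in> {..<n} \<rightarrow> S"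
      using y(1) permutes_in_image[OF \<pi>] by (auto simp: Pi_iff)
    show ?thesis
    proof (cases "k < m")
      case True
      have "(\<lambda>i. (y(j := u)) (\<pi> i)) = (\<lambda>i. y (\<pi> i))(k := u)" for u by (auto simp: in_j k)
      moreover have "(\<lambda>i. (y(j := u)) (\<pi> (m + i))) = (\<lambda>i. y (\<pi> (m + i)))" for u
        using True by (auto simp: in_j)
      moreover have "\<alpha> ((\<lambda>i. y (\<pi> i))(k := a *\<^sub>R v + w)) = a * \<alpha> ((\<lambda>i. y (\<pi> i))(k := v)) + \<alpha> ((\<lambda>i. y (\<pi> i))(k := w))"
        by (rule multilinear_form_linear[OF \<alpha> ym(1)]) (use True y in auto)
      ultimately show ?thesis by (simp only:) (simp add: algebra_simps)
    next
      case False
      then obtain l where l: "k = m + l" "l < n" using \<open>k < m + n\<close> by (auto simp: not_less le_iff_add)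
      have "\<alpha> (\<lambda>i. (y(j := u)) (\<pi> i)) = \<alpha> (\<lambda>i. y (\<pi> i))" for u
        by (rule multilinear_form_cong[OF \<alpha>]) (use False in_j in auto)
      moreover have "(\<lambda>i. (y(j := u)) (\<pi> (m + i))) = (\<lambda>i. y (\<pi> (m + i)))(l := u)" for u
        by (auto simp: in_j l)
      moreover have "\<beta> ((\<lambda>i. y (\<pi> (m + i)))(l := a *\<^sub>R v + w))
          = a * \<beta> ((\<lambda>i. y (\<pi> (m + i)))(l := v)) + \<beta> ((\<lambda>i. y (\<pi> (m + i)))(l := w))"
        by (rule multilinear_form_linear[OF \<beta> ym(2)]) (use l y in auto)
      ultimately show ?thesis by (simp only:) (simp add: algebra_simps)
    qed
  qed
  then have "(\<Sum>\<pi> | \<pi> permutes {..<m + n}. ?t (y(j := a *\<^sub>R v + w)) \<pi>)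
     = a * (\<Sum>\<pi> | \<pi> permutes {..<m + n}. ?t (y(j := v)) \<pi>) + (\<Sum>\<pi> | \<pi> permutes {..<m + n}. ?t (y(j := w)) \<pi>)"
    by (simp only: sum_distrib_left sum.distrib[symmetric]) (intro sum.cong refl, simp)
  then show "wedge m n \<alpha> \<beta> (y(j := a *\<^sub>R v + w)) = a * wedge m n \<alpha> \<beta> (y(j := v)) + wedge m n \<alpha> \<beta> (y(j := w))"
    unfolding wedge_def by (simp only: add_divide_distrib times_divide_eq_right)
next
  fix y j k assume y: "y \<in> {..<m + n} \<rightarrow> S" "j \<in> {..<m + n}" "k \<in> {..<m + n}" "j \<noteq> k" "y j = y k"
  have yt: "y (Transposition.transpose j k i) = y i" for i using y by (auto simp: Transposition.transpose_def)
  have "(\<Sum>\<pi> | \<pi> permutes {..<m + n}. of_int (sign \<pi>) * (\<alpha> (\<lambda>i. y (\<pi> i)) * \<beta> (\<lambda>i. y (\<pi> (m + i))))) = 0"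
    by (rule sum_permutations_eq_0[of _ j k]) (use y in \<open>auto simp: yt\<close>)
  then show "wedge m n \<alpha> \<beta> y = 0" unfolding wedge_def by (simp add: mult.assoc)
qed

lemma alternating_form_wedge_power:
  assumes lin: "\<And>a v w u. v \<in> S \<Longrightarrow> w \<in> S \<Longrightarrow> u \<in> S \<Longrightarrow> \<Omega> (a *\<^sub>R v + w) u = a * \<Omega> v u + \<Omega> w u"
    "\<And>a v w u. v \<in> S \<Longrightarrow> w \<in> S \<Longrightarrow> u \<in> S \<Longrightarrow> \<Omega> u (a *\<^sub>R v + w) = a * \<Omega> u v + \<Omega> u w"
  shows "alternating_form {..<2 * n} S (wedge_power \<Omega> n)"
proof (induction n)
  case 0
  then show ?case by (auto simp: alternating_form_def multilinear_form_def)
next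
  case (Suc n)
  have "multilinear_form {..<2::nat} S (\<lambda>y. \<Omega> (y 0) (y 1))"
    unfolding multilinear_form_def
  proof (intro conjI allI impI)
    fix y and i :: nat and a v w assume "y \<in> {..<2::nat} \<rightarrow> S" "i \<in> {..<2}" "v \<in> S" "w \<in> S"
    moreover from this have "i = 0 \<or> i = 1" "y 0 \<in> S" "y 1 \<in> S" by auto
    ultimately show "\<Omega> ((y(i := a *\<^sub>R v + w)) 0) ((y(i := a *\<^sub>R v + w)) 1) =
       a * \<Omega> ((y(i := v)) 0) ((y(i := v)) 1) + \<Omega> ((y(i := w)) 0) ((y(i := w)) 1)"
      using lin by auto
  qed auto
  from alternating_form_wedge[OF this alternating_form_multilinear[OF Suc]] show ?case
    by simp
qed

text \<open>Serves to replace \<open>Omega_K\<close> by a pull-back with which it agrees on tangent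
  vectors whose components lie in k.\<close>

lemma wedge_power_cong:
  assumes "\<And>v w. v \<in> S \<Longrightarrow> w \<in> S \<Longrightarrow> \<Omega> v w = \<Omega>' v w" "y \<in> {..<2 * n} \<rightarrow> S"
  shows "wedge_power \<Omega> n y = wedge_power \<Omega>' n y"
  using assms(2)
proof (induction n arbitrary: y)
  case (Suc n)
  have S: "y (\<pi> i) \<in> S" if "\<pi> permutes {..<2 + 2 * n}" "i < 2 + 2 * n" for \<pi> i
    using Suc.prems permutes_in_image[OF that(1), of i] that(2) by (simp add: Pi_iff)
  show ?case unfolding wedge_power.simps wedge_def
    by (intro arg_cong2[of _ _ _ _ "(/)"] sum.cong arg_cong2[of _ _ _ _ "(*)"] refl assms(1) Suc.IH)
      (auto intro: S)
qed simp

lemma wedge_power_compose: "wedge_power (\<lambda>v w. \<Omega> (T v) (T w)) n y = wedge_power \<Omega> n (\<lambda>i. T (y i))"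
  by (induction n arbitrary: y) (simp_all add: wedge_def)

section \<open>The Killing form\<close>

text \<open>The assumption \<open>flow\<close> is how K enters: its Lie algebra is k, so each X in k
  is the velocity of a one-parameter subgroup.\<close>

locale cartan = lie G for G :: "('a, real^'m) lie_data" (structure) +
  fixes \<theta> :: "real^'m \<Rightarrow> real^'m"
  assumes involution: "cartan_involution G \<theta>"
    and flow: "X \<in> k_part \<theta> \<Longrightarrow> \<exists>\<gamma>. one_parameter_subgroup G X \<gamma>"
begin

abbreviation kk :: "(real^'m) set" where "kk \<equiv> k_part \<theta>"
abbreviation br :: "real^'m \<Rightarrow> real^'m \<Rightarrow> real^'m" where "br \<equiv> lie_bracket G"
abbreviation ip :: "real^'m \<Rightarrow> real^'m \<Rightarrow> real" where "ip \<equiv> theta_inner G \<theta>"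

lemma linear_\<theta>: "linear \<theta>" and \<theta>_\<theta>: "\<theta> (\<theta> X) = X"
  and \<theta>_br: "\<theta> (br X Y) = br (\<theta> X) (\<theta> Y)" and ip_pos: "X \<noteq> 0 \<Longrightarrow> ip X X > 0"
  using involution by (simp_all add: cartan_involution_def)

lemma k_iff: "X \<in> kk \<longleftrightarrow> \<theta> X = X"
  by (simp add: k_part_def)

lemma subspace_k: "subspace kk"
  using linear_\<theta> by (auto simp: subspace_def k_iff linear_0 linear_add linear_cmul)

lemma br_right: "linear (br X)" and br_left: "linear (\<lambda>X. br X Y)"
  using bilinear_lie_bracket by (auto simp: bilinear_def)

lemmas br_linear = linear_add[OF br_right] linear_add[OF br_left] linear_cmul[OF br_right]
  linear_cmul[OF br_left] linear_neg[OF br_right] linear_neg[OF br_left] linear_0[OF br_right] linear_0[OF br_left]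
  linear_diff[OF br_right] linear_diff[OF br_left]

lemma br_k: "X \<in> kk \<Longrightarrow> Y \<in> kk \<Longrightarrow> br X Y \<in> kk"
  by (simp add: k_iff \<theta>_br)

lemma br_self: "X \<in> kk \<Longrightarrow> br X X = 0"
  using flow lie_bracket_self by blast

lemma br_antisym:
  assumes "X \<in> kk" "Y \<in> kk"
  shows "br Y X = - br X Y"
proof -
  have "br (X + Y) (X + Y) = 0" using assms subspace_k by (simp add: br_self subspace_add)
  then have "br Y X + br X Y = 0" using assms by (simp add: br_linear br_self)
  then show ?thesis by (simp only: eq_neg_iff_add_eq_0)
qed

lemma br_jacobi: "X \<in> kk \<Longrightarrow> br X (br Y Z) = br (br X Y) Z + br Y (br X Z)"
  using flow lie_bracket_derivation by blast

section \<open>Trace on the whole Lie algebra and invariance of the inner product\<close>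

definition trm :: "(real^'m \<Rightarrow> real^'m) \<Rightarrow> real" where "trm f = trace (matrix f)"

lemma trm_eq: "trm f = (\<Sum>i\<in>UNIV. f (axis i 1) $ i)"
  by (simp add: trm_def trace_def matrix_def)

lemma trm_add: "trm (\<lambda>x. f x + g x) = trm f + trm g"
  by (simp add: trm_eq sum.distrib)

lemma trm_diff: "trm (\<lambda>x. f x - g x) = trm f - trm g"
  by (simp add: trm_eq sum_subtractf)

lemma trm_scale: "trm (\<lambda>x. a *\<^sub>R f x) = a * trm f"
  by (simp add: trm_eq sum_distrib_left)

lemma trm_comm: "linear f \<Longrightarrow> linear g \<Longrightarrow> trm (\<lambda>x. f (g x)) = trm (\<lambda>x. g (f x))"
  using trace_mul_sym[of "matrix f" "matrix g"]
  by (simp add: trm_def matrix_compose[unfolded o_def, symmetric])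

lemma killing_eq: "killing_form G X Y = trm (\<lambda>Z. br X (br Y Z))"
  by (simp add: killing_form_def trm_def)

lemma killing_sym: "killing_form G X Y = killing_form G Y X"
  unfolding killing_eq by (rule trm_comm[OF br_right br_right])

lemma killing_left: "killing_form G (a *\<^sub>R X + Y) Z = a * killing_form G X Z + killing_form G Y Z"
  by (simp add: killing_eq br_linear trm_add trm_scale)

text \<open>As \<theta> is an automorphism and an involution, ad(\<theta> X) is the conjugate of ad
  X by \<theta>, and the trace does not see conjugation.\<close>

lemma killing_\<theta>: "killing_form G (\<theta> X) (\<theta> Y) = killing_form G X Y"
proof -
  have "br (\<theta> X) (br (\<theta> Y) Z) = \<theta> (br X (br Y (\<theta> Z)))" for Z
    by (simp add: \<theta>_br \<theta>_\<theta>)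
  then have "killing_form G (\<theta> X) (\<theta> Y) = trm (\<lambda>Z. \<theta> (br X (br Y (\<theta> Z))))"
    by (simp add: killing_eq)
  also have "\<dots> = trm (\<lambda>Z. br X (br Y (\<theta> (\<theta> Z))))"
    using trm_comm[OF linear_\<theta> linear_compose[OF linear_\<theta> linear_compose[OF br_right br_right]], of X Y]
    by (simp add: o_def)
  finally show ?thesis by (simp add: \<theta>_\<theta> killing_eq)
qed

lemma ip_sym: "ip X Y = ip Y X"
  unfolding theta_inner_def using killing_\<theta>[of X "\<theta> Y"] killing_sym[of "\<theta> X"] by (simp add: \<theta>_\<theta>)

lemma ip_left: "ip (a *\<^sub>R X + Y) Z = a * ip X Z + ip Y Z"
  by (simp add: theta_inner_def killing_left)

lemma linear_ip: "linear (\<lambda>X. ip X Z)" "linear (ip Z)"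
proof -
  have 0: "ip 0 Z = 0" for Z using ip_left[of 1 0 0 Z] by simp
  show l: "linear (\<lambda>X. ip X Z)" for Z
    using ip_left[of 1 _ _ Z] ip_left[of _ _ 0 Z] 0 by (intro linearI) auto
  have "ip Z = (\<lambda>X. ip X Z)" by (rule ext) (rule ip_sym)
  then show "linear (ip Z)" using l[of Z] by simp
qed

lemmas ip_linear = linear_add[OF linear_ip(1)] linear_add[OF linear_ip(2)] linear_cmul[OF linear_ip(1)]
  linear_cmul[OF linear_ip(2)] linear_neg[OF linear_ip(1)] linear_neg[OF linear_ip(2)]
  linear_0[OF linear_ip(1)] linear_0[OF linear_ip(2)] linear_diff[OF linear_ip(1)] linear_diff[OF linear_ip(2)]

lemma bounded_bilinear_ip: "bounded_bilinear ip"
  using bilinear_conv_bounded_bilinear linear_ip by (auto simp: bilinear_def)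

text \<open>Invariance of the Killing form, from cyclicity of the trace and the Jacobi identity for
  the derivation \<open>br u\<close>. As \<theta> fixes w and \<open>br u w\<close>, the inner
  product is minus the Killing form at these arguments.\<close>

lemma ip_skew:
  assumes u: "u \<in> kk" and v: "v \<in> kk" and w: "w \<in> kk"
  shows "ip (br u v) w = - ip v (br u w)"
proof -
  have l3: "linear (\<lambda>z. br x (br y z))" for x y
    using linear_compose[OF br_right br_right] by (simp add: o_def)
  have "br (br u v) (br w Z) = br u (br v (br w Z)) - br v (br u (br w Z))" for Z
    using br_jacobi[OF u, of v "br w Z"] by simp
  then have 1: "killing_form G (br u v) w = trm (\<lambda>Z. br u (br v (br w Z))) - trm (\<lambda>Z. br v (br u (br w Z)))"
    by (simp add: killing_eq trm_diff)
  have "br v (br (br u w) Z) = br v (br u (br w Z)) - br v (br w (br u Z))" for Z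
    using br_jacobi[OF u, of w Z] by (simp add: br_linear)
  then have 2: "killing_form G v (br u w) = trm (\<lambda>Z. br v (br u (br w Z))) - trm (\<lambda>Z. br v (br w (br u Z)))"
    by (simp add: killing_eq trm_diff)
  have "trm (\<lambda>Z. br u (br v (br w Z))) = trm (\<lambda>Z. br v (br w (br u Z)))"
    by (rule trm_comm[OF br_right l3])
  with 1 2 have "killing_form G (br u v) w = - killing_form G v (br u w)" by simp
  then show ?thesis using w br_k[OF u w] by (simp add: theta_inner_def k_iff)
qed

definition E :: "real^'m \<Rightarrow> real \<Rightarrow> 'a" where "E \<xi> = exp_flow G \<xi>"

lemma E: "\<xi> \<in> kk \<Longrightarrow> one_parameter_subgroup G \<xi> (E \<xi>)"
  unfolding E_def exp_flow_def using flow by (rule someI_ex)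

end

section \<open>Determinant and trace on a subspace\<close>

locale basis_subspace =
  fixes S :: "'e::euclidean_space set"
  assumes subspace_S: "subspace S"
begin

text \<open>The same choice expression as in \<open>det_on\<close>, so that determinants unfold over
  this very basis.\<close>

definition B :: "'e set" where "B = (SOME B. independent B \<and> span B = S)"

abbreviation rep :: "'e \<Rightarrow> 'e \<Rightarrow> real" where "rep \<equiv> representation B"

lemma B: "independent B" "span B = S"
proof -
  obtain B' where "B' \<subseteq> S" "independent B'" "S \<subseteq> span B'" by (rule basis_exists)
  then have "independent B' \<and> span B' = S" using span_minimal[OF _ subspace_S] by blast
  from someI[of "\<lambda>B. independent B \<and> span B = S", OF this] show "independent B" "span B = S"
    unfolding B_def by blast+
qed

lemma finite_B: "finite B"
  using B(1) independent_imp_finite by blast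

lemma B_S: "b \<in> B \<Longrightarrow> b \<in> S"
  using B(2) span_base by blast

lemma card_B: "card B = dim S"
  using dim_span_eq_card_independent[OF B(1)] by (simp only: B(2))

lemma rep_linear: "v \<in> S \<Longrightarrow> w \<in> S \<Longrightarrow> rep (a *\<^sub>R v + w) b = a * rep v b + rep w b"
  using representation_add[OF B(1), of "a *\<^sub>R v" w] representation_scale[OF B(1), of v a] span_scale[of v B a]
  unfolding B(2) by (simp add: add.commute)

lemma rep_basis: "b \<in> B \<Longrightarrow> rep b c = (if c = b then 1 else 0)"
  using B by (simp add: representation_basis)

lemma rep_sum: "v \<in> S \<Longrightarrow> (\<Sum>b\<in>B. rep v b *\<^sub>R b) = v"
  using sum_representation_eq[of B v B] B finite_B by simp

text \<open>The operators of the mechanical system are known to be linear on k only, so linearity is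
  taken relative to S.\<close>

definition endo :: "('e \<Rightarrow> 'e) \<Rightarrow> bool" where
  "endo T \<longleftrightarrow> (\<forall>v\<in>S. T v \<in> S) \<and> (\<forall>a. \<forall>v\<in>S. \<forall>w\<in>S. T (a *\<^sub>R v + w) = a *\<^sub>R T v + T w)"

lemma endoI:
  "(\<And>v. v \<in> S \<Longrightarrow> T v \<in> S) \<Longrightarrow> (\<And>a v w. v \<in> S \<Longrightarrow> w \<in> S \<Longrightarrow> T (a *\<^sub>R v + w) = a *\<^sub>R T v + T w) \<Longrightarrow> endo T"
  by (simp add: endo_def)

lemma endo_mem: "endo T \<Longrightarrow> v \<in> S \<Longrightarrow> T v \<in> S"
  by (simp add: endo_def)

lemma endo_lin: "endo T \<Longrightarrow> v \<in> S \<Longrightarrow> w \<in> S \<Longrightarrow> T (a *\<^sub>R v + w) = a *\<^sub>R T v + T w"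
  by (simp add: endo_def)

lemma endo_comp: "endo T \<Longrightarrow> endo U \<Longrightarrow> endo (\<lambda>v. T (U v))"
  by (simp add: endo_def)

lemma endo_lincomb:
  assumes T: "endo T" and U: "endo U"
  shows "endo (\<lambda>v. a *\<^sub>R T v + U v)"
proof (rule endoI)
  fix b v w assume v: "v \<in> S" "w \<in> S"
  show "a *\<^sub>R T (b *\<^sub>R v + w) + U (b *\<^sub>R v + w) = b *\<^sub>R (a *\<^sub>R T v + U v) + (a *\<^sub>R T w + U w)"
    unfolding endo_lin[OF T v] endo_lin[OF U v] by (simp add: algebra_simps)
qed (simp add: subspace_add[OF subspace_S] subspace_scale[OF subspace_S] endo_mem[OF T] endo_mem[OF U])

lemma sum_lin:
  fixes f :: "'e \<Rightarrow> 'v::real_vector"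
  assumes lin: "\<And>a v w. v \<in> S \<Longrightarrow> w \<in> S \<Longrightarrow> f (a *\<^sub>R v + w) = a *\<^sub>R f v + f w"
    and v: "\<And>i. i \<in> A \<Longrightarrow> v i \<in> S"
  shows "f (\<Sum>i\<in>A. c i *\<^sub>R v i) = (\<Sum>i\<in>A. c i *\<^sub>R f (v i))"
proof -
  have 0: "f 0 = 0" using lin[of 0 0 1] subspace_0[OF subspace_S] by simp
  show ?thesis using v
  proof (induction A rule: infinite_finite_induct)
    case (insert i A)
    have "(\<Sum>i\<in>A. c i *\<^sub>R v i) \<in> S"
      by (intro subspace_sum subspace_S subspace_scale) (use insert.prems in auto)
    with insert show ?case by (simp add: lin)
  qed (simp_all add: 0)
qed

text \<open>A map controlled on S alone is replaced by a globally linear one with the same values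
  there, which makes boundedness and differentiation available.\<close>

lemma endo_extend:
  assumes "endo T"
  obtains T' where "linear T'" "\<And>v. v \<in> S \<Longrightarrow> T' v = T v"
proof -
  obtain g where g: "linear g" "\<forall>x\<in>B. g x = T x" using linear_independent_extend[OF B(1)] by blast
  have "g v = T v" if "v \<in> S" for v
  proof -
    have "T v = (\<Sum>b\<in>B. rep v b *\<^sub>R T b)"
      using sum_lin[of T B "\<lambda>b. b" "rep v", OF endo_lin[OF assms] B_S] by (simp add: rep_sum[OF that])
    also have "\<dots> = (\<Sum>b\<in>B. rep v b *\<^sub>R g b)" using g by simp
    also have "\<dots> = g (\<Sum>b\<in>B. rep v b *\<^sub>R b)" using g(1) by (simp add: linear_sum linear_cmul)
    also have "\<dots> = g v" by (simp add: rep_sum[OF that])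
    finally show ?thesis by simp
  qed
  with g that show ?thesis by blast
qed

lemma endo_inverse:
  assumes T: "endo T" and inj: "\<And>v. v \<in> S \<Longrightarrow> T v = 0 \<Longrightarrow> v = 0"
  obtains T' where "endo T'" "\<And>v. v \<in> S \<Longrightarrow> T' (T v) = v" "\<And>v. v \<in> S \<Longrightarrow> T (T' v) = v"
proof -
  obtain g where g: "linear g" "\<And>v. v \<in> S \<Longrightarrow> g v = T v" by (rule endo_extend[OF T]) blast
  have inj: "inj_on g S"
    using linear_inj_on_iff_eq_0[OF g(1) subspace_S] inj g(2) by auto
  have "g ` S \<subseteq> S" using g(2) endo_mem[OF T] by auto
  moreover have "dim (g ` S) = dim S"
    using inj by (intro dim_image_eq[OF g(1)]) (simp add: span_eq_iff[THEN iffD2, OF subspace_S])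
  ultimately have surj: "g ` S = S"
    by (intro subspace_dim_equal) (auto simp: linear_subspace_image g(1) subspace_S)
  define T' where "T' = inv_into S g"
  have T': "T' v \<in> S" "g (T' v) = v" if "v \<in> S" for v
    using that surj by (auto simp: T'_def inv_into_into f_inv_into_f)
  have T'g: "T' (g v) = v" if "v \<in> S" for v using inj that by (simp add: T'_def)
  have "endo T'"
  proof (rule endoI)
    fix a v w assume "v \<in> S" "w \<in> S"
    then have "a *\<^sub>R v + w = g (a *\<^sub>R T' v + T' w)" using T' g(1) by (simp add: linear_add linear_cmul)
    then show "T' (a *\<^sub>R v + w) = a *\<^sub>R T' v + T' w"
      using T'g \<open>v \<in> S\<close> \<open>w \<in> S\<close> T' subspace_S by (simp add: subspace_add subspace_scale)
  qed (rule T')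
  with that g(2) T' T'g show ?thesis by metis
qed

text \<open>The determinant as a form in the images of the basis vectors. Slots are indexed by the
  basis itself, so an endomorphism already is such a family.\<close>

definition det_form :: "('e \<Rightarrow> 'e) \<Rightarrow> real" where
  "det_form y = (\<Sum>\<pi> | \<pi> permutes B. of_int (sign \<pi>) * (\<Prod>b\<in>B. rep (y b) (\<pi> b)))"

lemma det_on_eq: "det_on S T = det_form T"
  by (simp add: det_on_def det_form_def B_def Let_def)

lemma alternating_det_form: "alternating_form B S det_form"
  unfolding alternating_form_def multilinear_form_def
proof (intro conjI allI impI)
  fix y z :: "'e \<Rightarrow> 'e" assume "\<forall>i\<in>B. y i = z i"
  then show "det_form y = det_form z" by (simp add: det_form_def)
next
  fix y i a v w assume y: "y \<in> B \<rightarrow> S" "i \<in> B" "v \<in> S" "w \<in> S"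
  have upd: "(\<Prod>b\<in>B. rep ((y(i := u)) b) (\<pi> b)) = rep u (\<pi> i) * (\<Prod>b\<in>B - {i}. rep (y b) (\<pi> b))" for u \<pi>
    using prod.remove[OF finite_B y(2), of "\<lambda>b. rep ((y(i := u)) b) (\<pi> b)"] by simp
  show "det_form (y(i := a *\<^sub>R v + w)) = a * det_form (y(i := v)) + det_form (y(i := w))"
    unfolding det_form_def upd rep_linear[OF y(3,4)]
    by (simp add: sum_distrib_left sum.distrib[symmetric] algebra_simps)
next
  fix y i j assume y: "y \<in> B \<rightarrow> S" "i \<in> B" "j \<in> B" "i \<noteq> j" "y i = y j"
  let ?t = "Transposition.transpose i j"
  have t: "?t permutes B" by (rule permutes_swap_id[OF y(2,3)])
  have yt: "y (?t b) = y b" for b using y by (auto simp: Transposition.transpose_def)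
  have F: "(\<Prod>b\<in>B. rep (y b) (\<pi> (?t b))) = (\<Prod>b\<in>B. rep (y b) (\<pi> b))" for \<pi>
    using prod.permute[OF t, of "\<lambda>b. rep (y b) (\<pi> b)"] by (simp add: o_def yt)
  have sg: "sign (\<pi> \<circ> ?t) = - sign \<pi>" if "\<pi> permutes B" for \<pi>
  proof -
    have "permutation \<pi>" "permutation ?t" using that t finite_B permutation_permutes by blast+
    then show ?thesis using sign_compose[of \<pi> ?t] sign_swap_id[of i j] y(4) by simp
  qed
  have "det_form y = (\<Sum>\<pi> | \<pi> permutes B. of_int (sign (\<pi> \<circ> ?t)) * (\<Prod>b\<in>B. rep (y b) ((\<pi> \<circ> ?t) b)))"
    unfolding det_form_def by (rule sum_permutations_compose_right[OF t])
  also have "\<dots> = - det_form y"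
    unfolding det_form_def sum_negf[symmetric] by (intro sum.cong refl) (simp add: sg F)
  finally show "det_form y = 0" by simp
qed

lemma det_form_id: "det_form (\<lambda>b. b) = 1"
proof -
  have "(\<Prod>b\<in>B. rep b (\<pi> b)) = (if \<pi> = id then 1 else 0)" if "\<pi> permutes B" for \<pi>
  proof (cases "\<pi> = id")
    case False
    then obtain b where b: "\<pi> b \<noteq> b" by (auto simp: fun_eq_iff)
    then have "b \<in> B" using that permutes_not_in by metis
    with b have "\<exists>b\<in>B. rep b (\<pi> b) = 0" by (auto simp: rep_basis)
    with False show ?thesis by (simp add: prod_zero[OF finite_B])
  qed (simp add: rep_basis)
  then have "det_form (\<lambda>b. b) = (\<Sum>\<pi> | \<pi> permutes B. if \<pi> = id then 1 else 0)"
    unfolding det_form_def by (intro sum.cong) auto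
  also have "\<dots> = 1" using finite_B by (simp add: finite_permutations permutes_id)
  finally show ?thesis .
qed

text \<open>\<open>det_form\<close> takes the value 1 on the basis, so every alternating form is the
  multiple of it given by its own value there.\<close>

lemma alternating_form_det_on:
  assumes "alternating_form B S \<omega>" "endo T"
  shows "\<omega> T = det_on S T * \<omega> (\<lambda>b. b)"
proof -
  have "\<omega> T = \<omega> (\<lambda>b. b) * det_form T"
  proof (rule alternating_form_unique[OF assms(1) alternating_det_form subspace_S finite_B])
    show "v = (\<Sum>b\<in>B. rep v b *\<^sub>R b)" if "v \<in> S" for v by (rule rep_sum[OF that, symmetric])
  qed (use B_S endo_mem[OF assms(2)] in \<open>auto simp: det_form_id\<close>)
  then show ?thesis by (simp add: det_on_eq)
qed

lemma det_on_cong: "(\<And>v. v \<in> S \<Longrightarrow> T v = U v) \<Longrightarrow> det_on S T = det_on S U"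
  using B_S by (simp add: det_on_eq det_form_def)

lemma det_on_id: "(\<And>v. v \<in> S \<Longrightarrow> T v = v) \<Longrightarrow> det_on S T = 1"
  using det_on_cong[of T "\<lambda>v. v"] by (simp add: det_on_eq det_form_id)

text \<open>T pulls \<open>det_form\<close> back to another alternating form, whose value at U is
  found by \<open>alternating_form_det_on\<close>.\<close>

lemma det_on_comp:
  assumes T: "endo T" and U: "endo U"
  shows "det_on S (\<lambda>v. T (U v)) = det_on S T * det_on S U"
proof -
  have "alternating_form B S (\<lambda>y. det_form (\<lambda>i. T (y i)))"
    by (rule alternating_form_compose[OF alternating_det_form endo_mem[OF T] endo_lin[OF T]])
  from alternating_form_det_on[OF this U] show ?thesis
    by (simp add: det_on_eq)
qed

lemma det_on_neq_0:
  assumes T: "endo T" and inj: "\<And>v. v \<in> S \<Longrightarrow> T v = 0 \<Longrightarrow> v = 0"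
  shows "det_on S T \<noteq> 0"
proof -
  obtain T' where "endo T'" "\<And>v. v \<in> S \<Longrightarrow> T' (T v) = v" by (rule endo_inverse[OF T inj]) auto
  then show ?thesis using det_on_comp[of T' T] det_on_id[of "\<lambda>v. T' (T v)"] T by auto
qed

text \<open>The segment from the identity to T consists of invertible maps.\<close>

lemma det_on_pos:
  assumes T: "endo T"
    and lin: "\<And>a v w u. v \<in> S \<Longrightarrow> w \<in> S \<Longrightarrow> u \<in> S \<Longrightarrow> \<beta> (a *\<^sub>R v + w) u = a * \<beta> v u + \<beta> w u"
    and pos: "\<And>v. v \<in> S \<Longrightarrow> v \<noteq> 0 \<Longrightarrow> \<beta> v v > 0" "\<And>v. v \<in> S \<Longrightarrow> v \<noteq> 0 \<Longrightarrow> \<beta> (T v) v > 0"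
  shows "det_on S T > 0"
proof (rule ccontr)
  assume neg: "\<not> det_on S T > 0"
  define P where "P = (\<lambda>t v. (1 - t) *\<^sub>R v + t *\<^sub>R T v)"
  have P: "endo (P t)" for t
  proof (rule endoI)
    show "P t v \<in> S" if "v \<in> S" for v
      unfolding P_def using that by (intro subspace_add subspace_scale subspace_S endo_mem[OF T])
    show "P t (a *\<^sub>R v + w) = a *\<^sub>R P t v + P t w" if "v \<in> S" "w \<in> S" for a v w
      unfolding P_def endo_lin[OF T that] by (simp add: algebra_simps)
  qed
  have rP: "rep (P t b) c = (1 - t) * rep b c + t * rep (T b) c" if "b \<in> S" for t b c
    using rep_linear[of b "t *\<^sub>R T b" "1 - t" c] rep_linear[of "T b" 0 t c] subspace_S endo_mem[OF T that] that
    by (simp add: P_def subspace_scale subspace_0 representation_zero)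
  have "continuous_on {0..1} (\<lambda>t. det_on S (P t))"
    unfolding det_on_eq det_form_def by (simp add: rP B_S) (intro continuous_intros)
  moreover have "det_on S (P 0) = 1" by (rule det_on_id) (simp add: P_def)
  moreover have "det_on S (P 1) = det_on S T" by (rule det_on_cong) (simp add: P_def)
  ultimately obtain t where t: "0 \<le> t" "t \<le> 1" "det_on S (P t) = 0"
    using IVT2'[of "\<lambda>t. det_on S (P t)" 1 0 0] neg by force
  have inj: "v = 0" if v: "v \<in> S" "P t v = 0" for v
  proof (rule ccontr)
    assume "v \<noteq> 0"
    have \<beta>0: "\<beta> 0 v = 0" using lin[of 0 0 v 1] subspace_0[OF subspace_S] v by simp
    have "\<beta> (P t v) v = (1 - t) * \<beta> v v + t * \<beta> (T v) v"
      using lin[of v "t *\<^sub>R T v" v "1 - t"] lin[of "T v" 0 v t] v endo_mem[OF T v(1)] subspace_S \<beta>0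
      by (simp add: P_def subspace_scale subspace_0)
    moreover have "\<dots> > 0"
    proof (cases "t = 0")
      case True then show ?thesis using pos(1)[OF v(1) \<open>v \<noteq> 0\<close>] by simp
    next
      case False
      then have "t * \<beta> (T v) v > 0" using t pos(2)[OF v(1) \<open>v \<noteq> 0\<close>] by simp
      moreover have "(1 - t) * \<beta> v v \<ge> 0" using t pos(1)[OF v(1) \<open>v \<noteq> 0\<close>] by simp
      ultimately show ?thesis by linarith
    qed
    ultimately show False using \<beta>0 v by simp
  qed
  have "det_on S (P t) \<noteq> 0" by (rule det_on_neq_0[OF P]) (rule inj)
  with t(3) show False by simp
qed

section \<open>Trace on a subspace and the derivative of a determinant\<close>

definition tr :: "('e \<Rightarrow> 'e) \<Rightarrow> real" where "tr T = (\<Sum>b\<in>B. rep (T b) b)"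

lemma tr_cong: "(\<And>v. v \<in> S \<Longrightarrow> T v = U v) \<Longrightarrow> tr T = tr U"
  using B_S by (simp add: tr_def)

lemma tr_lin: "endo T \<Longrightarrow> endo U \<Longrightarrow> tr (\<lambda>v. a *\<^sub>R T v + U v) = a * tr T + tr U"
  by (simp add: tr_def rep_linear endo_mem[of T] endo_mem[of U] B_S sum.distrib sum_distrib_left)

lemma rep_endo:
  assumes T: "endo T" and v: "v \<in> S"
  shows "rep (T v) c = (\<Sum>b\<in>B. rep v b * rep (T b) c)"
proof -
  have "rep (T (\<Sum>b\<in>B. rep v b *\<^sub>R b)) c = (\<Sum>b\<in>B. rep v b *\<^sub>R rep (T b) c)"
    by (rule sum_lin) (simp_all add: endo_lin[OF T] endo_mem[OF T] rep_linear B_S)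
  then show ?thesis by (simp add: rep_sum[OF v])
qed

lemma tr_comm:
  assumes "endo T" "endo U"
  shows "tr (\<lambda>v. T (U v)) = tr (\<lambda>v. U (T v))"
proof -
  have "tr (\<lambda>v. T (U v)) = (\<Sum>b\<in>B. \<Sum>c\<in>B. rep (U b) c * rep (T c) b)"
    unfolding tr_def by (rule sum.cong[OF refl], rule rep_endo[OF assms(1)]) (use B_S endo_mem[OF assms(2)] in blast)
  also have "\<dots> = (\<Sum>b\<in>B. \<Sum>c\<in>B. rep (T b) c * rep (U c) b)"
    by (subst sum.swap) (simp add: mult.commute)
  also have "\<dots> = tr (\<lambda>v. U (T v))"
    unfolding tr_def by (rule sum.cong[OF refl], rule rep_endo[OF assms(2), symmetric])
      (use B_S endo_mem[OF assms(1)] in blast)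
  finally show ?thesis .
qed

text \<open>Jacobi's formula at the identity. The product rule in the Leibniz expansion replaces one
  basis vector b by \<open>N' b\<close> at a time; by alternation only the coefficient along b
  survives.\<close>

lemma det_on_has_derivative_id:
  assumes N: "\<And>t b. b \<in> B \<Longrightarrow> N t b \<in> S" and N0: "\<And>b. b \<in> B \<Longrightarrow> N 0 b = b"
    and N': "\<And>b. b \<in> B \<Longrightarrow> N' b \<in> S" "\<And>b. b \<in> B \<Longrightarrow> ((\<lambda>t. N t b) has_vector_derivative N' b) (at 0)"
  shows "((\<lambda>t. det_on S (N t)) has_real_derivative tr N') (at 0)"
proof -
  have rd: "((\<lambda>t. rep (N t b) c) has_real_derivative rep (N' b) c) (at 0)" if b: "b \<in> B" for b c
  proof -
    obtain g :: "'e \<Rightarrow> real" where g: "linear g" "\<forall>x\<in>B. g x = rep x c"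
      using linear_independent_extend[OF B(1), of "\<lambda>x. rep x c"] by blast
    have gv: "g v = rep v c" if "v \<in> S" for v
    proof -
      have "rep (\<Sum>b\<in>B. rep v b *\<^sub>R b) c = (\<Sum>b\<in>B. rep v b *\<^sub>R rep b c)"
        by (rule sum_lin) (use B_S in \<open>auto simp: rep_linear\<close>)
      also have "\<dots> = g (\<Sum>b\<in>B. rep v b *\<^sub>R b)" using g by (simp add: linear_sum linear_cmul)
      finally show ?thesis by (simp add: rep_sum[OF that])
    qed
    have "((\<lambda>t. g (N t b)) has_vector_derivative g (N' b)) (at 0)"
      using bounded_linear.has_vector_derivative[OF linear_conv_bounded_linear[THEN iffD1, OF g(1)] N'(2)[OF b]] .
    then show ?thesis using N[OF b] N'(1)[OF b] by (simp add: gv has_real_derivative_iff_has_vector_derivative)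
  qed
  have "((\<lambda>t. det_on S (N t)) has_real_derivative
     (\<Sum>\<pi> | \<pi> permutes B. of_int (sign \<pi>) *
        (\<Sum>b\<in>B. rep (N' b) (\<pi> b) * (\<Prod>c\<in>B - {b}. rep (N 0 c) (\<pi> c))))) (at 0)"
    unfolding det_on_eq det_form_def
    by (intro DERIV_sum DERIV_cmult has_field_derivative_prod rd)
  moreover have "(\<Sum>\<pi> | \<pi> permutes B. of_int (sign \<pi>) *
        (\<Sum>b\<in>B. rep (N' b) (\<pi> b) * (\<Prod>c\<in>B - {b}. rep (N 0 c) (\<pi> c)))) = (\<Sum>b\<in>B. det_form ((\<lambda>b. b)(b := N' b)))"
  proof -
    have upd: "(\<Prod>c\<in>B. rep (((\<lambda>b. b)(b := u)) c) (\<pi> c)) = rep u (\<pi> b) * (\<Prod>c\<in>B - {b}. rep c (\<pi> c))"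
      if "b \<in> B" for u b \<pi>
      using prod.remove[OF finite_B that, of "\<lambda>c. rep (((\<lambda>b. b)(b := u)) c) (\<pi> c)"] by simp
    show ?thesis unfolding det_form_def sum_distrib_left
    proof (subst sum.swap, intro sum.cong refl)
      fix b \<pi> assume b: "b \<in> B"
      have "(\<Prod>c\<in>B - {b}. rep (N 0 c) (\<pi> c)) = (\<Prod>c\<in>B - {b}. rep c (\<pi> c))"
        by (intro prod.cong) (auto simp: N0)
      then show "of_int (sign \<pi>) * (rep (N' b) (\<pi> b) * (\<Prod>c\<in>B - {b}. rep (N 0 c) (\<pi> c)))
          = of_int (sign \<pi>) * (\<Prod>c\<in>B. rep (((\<lambda>b. b)(b := N' b)) c) (\<pi> c))"
        by (simp only: upd[OF b])
    qed
  qed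
  moreover have "(\<Sum>b\<in>B. det_form ((\<lambda>b. b)(b := N' b))) = tr N'"
    unfolding tr_def
  proof (rule sum.cong[OF refl])
    fix b assume b: "b \<in> B"
    have "det_form ((\<lambda>b. b)(b := N' b)) = det_form ((\<lambda>b. b)(b := \<Sum>c\<in>B. rep (N' b) c *\<^sub>R c))"
      by (simp add: rep_sum[OF N'(1)[OF b]])
    also have "\<dots> = (\<Sum>c\<in>B. rep (N' b) c * det_form ((\<lambda>b. b)(b := c)))"
      by (rule multilinear_form_sum[OF alternating_form_multilinear[OF alternating_det_form] subspace_S])
        (use b B_S in auto)
    also have "\<dots> = (\<Sum>c\<in>{b}. rep (N' b) c * det_form ((\<lambda>b. b)(b := c)))"
    proof (rule sum.mono_neutral_right)
      have "det_form ((\<lambda>b. b)(b := c)) = 0" if "c \<in> B - {b}" for c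
        by (rule alternating_form_eq_0[OF alternating_det_form, of _ b c]) (use that b B_S in auto)
      then show "\<forall>c\<in>B - {b}. rep (N' b) c * det_form ((\<lambda>b. b)(b := c)) = 0" by simp
    qed (use b finite_B in auto)
    also have "\<dots> = rep (N' b) b"
    proof -
      have "(\<lambda>b. b)(b := b) = (\<lambda>b. b)" by auto
      then show ?thesis using det_form_id by (simp del: fun_upd_triv)
    qed
    finally show "det_form ((\<lambda>b. b)(b := N' b)) = rep (N' b) b" .
  qed
  ultimately show ?thesis by simp
qed

text \<open>Composition with the inverse L of \<open>M 0\<close> moves the base point to the
  identity; multiplicativity restores the factor \<open>det_on S (M 0)\<close>.\<close>

lemma det_on_has_derivative:
  assumes M: "\<And>t. endo (M t)" and M': "\<And>v. v \<in> S \<Longrightarrow> M' v \<in> S"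
    and d: "\<And>v. v \<in> S \<Longrightarrow> ((\<lambda>t. M t v) has_vector_derivative M' v) (at 0)"
    and L: "endo L" "\<And>v. v \<in> S \<Longrightarrow> L (M 0 v) = v" "\<And>v. v \<in> S \<Longrightarrow> M 0 (L v) = v"
  shows "((\<lambda>t. det_on S (M t)) has_real_derivative det_on S (M 0) * tr (\<lambda>v. L (M' v))) (at 0)"
proof -
  obtain g where g: "linear g" "\<And>v. v \<in> S \<Longrightarrow> g v = L v" by (rule endo_extend[OF L(1)]) blast
  have d1: "((\<lambda>t. det_on S (\<lambda>v. L (M t v))) has_real_derivative tr (\<lambda>v. L (M' v))) (at 0)"
  proof (rule det_on_has_derivative_id)
    fix b assume b: "b \<in> B"
    have "((\<lambda>t. g (M t b)) has_vector_derivative g (M' b)) (at 0)"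
      using bounded_linear.has_vector_derivative[OF linear_conv_bounded_linear[THEN iffD1, OF g(1)] d[OF B_S[OF b]]] .
    then show "((\<lambda>t. L (M t b)) has_vector_derivative L (M' b)) (at 0)"
      using g(2)[OF endo_mem[OF M B_S[OF b]]] g(2)[OF M'[OF B_S[OF b]]] by simp
  qed (simp_all add: L(2) endo_mem[OF L(1)] endo_mem[OF M] M' B_S)
  have "det_on S (M t) = det_on S (M 0) * det_on S (\<lambda>v. L (M t v))" for t
  proof -
    have "det_on S (M t) = det_on S (\<lambda>v. M 0 (L (M t v)))"
      by (rule det_on_cong) (simp add: L(3) endo_mem[OF M])
    also have "\<dots> = det_on S (M 0) * det_on S (\<lambda>v. L (M t v))"
      by (rule det_on_comp[OF M endo_comp[OF L(1) M]])
    finally show ?thesis .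
  qed
  then have eq: "(\<lambda>t. det_on S (M t)) = (\<lambda>t. det_on S (M 0) * det_on S (\<lambda>v. L (M t v)))" by (rule ext)
  show ?thesis by (subst eq) (rule DERIV_cmult[OF d1])
qed

text \<open>R is the Gram operator of \<beta> in the basis. Definiteness makes it injective, hence
  invertible, and the representing vector is the one that R sends to the vector with coordinates
  \<open>\<phi> b\<close>.\<close>

lemma riesz:
  assumes lin: "\<And>a v w u. v \<in> S \<Longrightarrow> w \<in> S \<Longrightarrow> u \<in> S \<Longrightarrow> \<beta> (a *\<^sub>R v + w) u = a * \<beta> v u + \<beta> w u"
    and sym: "\<And>v w. v \<in> S \<Longrightarrow> w \<in> S \<Longrightarrow> \<beta> v w = \<beta> w v"
    and pos: "\<And>v. v \<in> S \<Longrightarrow> v \<noteq> 0 \<Longrightarrow> \<beta> v v > (0::real)"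
    and \<phi>: "\<And>a v w. v \<in> S \<Longrightarrow> w \<in> S \<Longrightarrow> \<phi> (a *\<^sub>R v + w) = a * \<phi> v + \<phi> w"
  obtains z where "z \<in> S" "\<And>u. u \<in> S \<Longrightarrow> \<beta> u z = \<phi> u"
proof -
  have expand: "\<beta> v u = (\<Sum>b\<in>B. rep v b * \<beta> b u)" if "v \<in> S" "u \<in> S" for v u
  proof -
    have "\<beta> (\<Sum>b\<in>B. rep v b *\<^sub>R b) u = (\<Sum>b\<in>B. rep v b *\<^sub>R \<beta> b u)"
      by (rule sum_lin[of "\<lambda>v. \<beta> v u"]) (simp_all add: lin that(2) B_S)
    then show ?thesis by (simp add: rep_sum[OF that(1)])
  qed
  have expand\<phi>: "\<phi> v = (\<Sum>b\<in>B. rep v b * \<phi> b)" if "v \<in> S" for v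
  proof -
    have "\<phi> (\<Sum>b\<in>B. rep v b *\<^sub>R b) = (\<Sum>b\<in>B. rep v b *\<^sub>R \<phi> b)"
      by (rule sum_lin[of \<phi>]) (simp_all add: \<phi> B_S)
    then show ?thesis by (simp add: rep_sum[OF that(1)])
  qed
  have repS: "(\<Sum>b\<in>B. f b *\<^sub>R b) \<in> S" for f
    by (intro subspace_sum subspace_S subspace_scale B_S)
  have unrep: "rep (\<Sum>b\<in>B. f b *\<^sub>R b) c = f c" if "c \<in> B" for f c
  proof -
    have "rep (\<Sum>b\<in>B. f b *\<^sub>R b) c = (\<Sum>b\<in>B. f b *\<^sub>R rep b c)"
      by (rule sum_lin) (use B_S in \<open>auto simp: rep_linear\<close>)
    also have "\<dots> = (\<Sum>b\<in>B. if b = c then f b else 0)" by (intro sum.cong) (auto simp: rep_basis)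
    finally show ?thesis using that finite_B by simp
  qed
  define R where "R = (\<lambda>z. \<Sum>b\<in>B. \<beta> z b *\<^sub>R b)"
  have R: "endo R"
    by (rule endoI) (auto simp: R_def repS lin B_S scaleR_left_distrib sum.distrib scaleR_sum_right)
  have \<beta>R: "\<beta> z b = rep (R z) b" if "b \<in> B" for z b by (simp add: R_def unrep that)
  have Rinj: "z = 0" if "z \<in> S" "R z = 0" for z
  proof (rule ccontr)
    assume "z \<noteq> 0"
    have "\<beta> b z = 0" if "b \<in> B" for b
      using \<beta>R[OF that, of z] sym[of b z] \<open>z \<in> S\<close> B_S[OF that] \<open>R z = 0\<close> by (simp add: representation_zero)
    then have "\<beta> z z = 0" using expand[of z z] that by simp
    with pos[OF that(1) \<open>z \<noteq> 0\<close>] show False by simp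
  qed
  obtain L where L: "endo L" "\<And>v. v \<in> S \<Longrightarrow> R (L v) = v" by (rule endo_inverse[OF R Rinj]) blast+
  let ?z = "L (\<Sum>b\<in>B. \<phi> b *\<^sub>R b)"
  have zS: "?z \<in> S" by (rule endo_mem[OF L(1) repS])
  have "\<beta> b ?z = \<phi> b" if "b \<in> B" for b
    using \<beta>R[OF that, of ?z] sym[OF B_S[OF that] zS] by (simp add: L(2) repS unrep that)
  then have "\<beta> u ?z = \<phi> u" if "u \<in> S" for u
    using expand[OF that zS] expand\<phi>[OF that] by simp
  with zS that show ?thesis by blast
qed

text \<open>With D the \<beta>-dual basis, the trace of T is the sum of
  \<open>\<beta> (T b) (D b)\<close>. Expanding \<open>D b\<close> in the basis produces the
  symmetric matrix \<beta>(D b, D c), and this symmetry lets the adjoint take over.\<close>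

lemma tr_adjoint:
  assumes lin: "\<And>a v w u. v \<in> S \<Longrightarrow> w \<in> S \<Longrightarrow> u \<in> S \<Longrightarrow> \<beta> (a *\<^sub>R v + w) u = a * \<beta> v u + \<beta> w u"
    and sym: "\<And>v w. v \<in> S \<Longrightarrow> w \<in> S \<Longrightarrow> \<beta> v w = \<beta> w v"
    and pos: "\<And>v. v \<in> S \<Longrightarrow> v \<noteq> 0 \<Longrightarrow> \<beta> v v > (0::real)"
    and T: "endo T" and U: "endo U" and adj: "\<And>v w. v \<in> S \<Longrightarrow> w \<in> S \<Longrightarrow> \<beta> (T v) w = \<beta> v (U w)"
  shows "tr T = tr U"
proof -
  have "\<exists>z. z \<in> S \<and> (\<forall>u\<in>S. \<beta> u z = rep u b)" for b
    by (rule riesz[where \<beta> = \<beta> and \<phi> = "\<lambda>u. rep u b"]) (use lin sym pos in \<open>blast intro: rep_linear\<close>)+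
  then have "\<forall>b. \<exists>z. z \<in> S \<and> (\<forall>u\<in>S. \<beta> u z = rep u b)" by (rule allI)
  from choice[OF this] obtain D
    where D: "\<And>b. D b \<in> S" "\<And>b u. u \<in> S \<Longrightarrow> \<beta> u (D b) = rep u b" by blast
  have TS: "T b \<in> S" "U b \<in> S" if "b \<in> S" for b using T U endo_mem that by auto
  have expand: "\<beta> v u = (\<Sum>b\<in>B. rep v b * \<beta> b u)" if "v \<in> S" "u \<in> S" for v u
  proof -
    have "\<beta> (\<Sum>b\<in>B. rep v b *\<^sub>R b) u = (\<Sum>b\<in>B. rep v b *\<^sub>R \<beta> b u)"
      by (rule sum_lin[of "\<lambda>v. \<beta> v u"]) (simp_all add: lin that(2) B_S)
    then show ?thesis by (simp add: rep_sum[OF that(1)])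
  qed
  have "tr T = (\<Sum>b\<in>B. \<beta> (T b) (D b))" by (simp add: tr_def D(2) TS B_S)
  also have "\<dots> = (\<Sum>b\<in>B. \<beta> (D b) (T b))" using sym D(1) TS B_S by (intro sum.cong) auto
  also have "\<dots> = (\<Sum>b\<in>B. \<Sum>c\<in>B. rep (D b) c * \<beta> c (T b))"
    using D(1) TS B_S by (intro sum.cong expand refl) auto
  also have "\<dots> = (\<Sum>b\<in>B. \<Sum>c\<in>B. rep (D c) b * \<beta> (U c) b)"
  proof (intro sum.cong refl)
    fix b c assume b: "b \<in> B" "c \<in> B"
    have "rep (D b) c = rep (D c) b" using D(2)[OF D(1)] sym[OF D(1) D(1)] by metis
    moreover have "\<beta> c (T b) = \<beta> (U c) b"
      using adj[of b c] sym[of "T b" c] sym[of b "U c"] TS b B_S by simp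
    ultimately show "rep (D b) c * \<beta> c (T b) = rep (D c) b * \<beta> (U c) b" by simp
  qed
  also have "\<dots> = (\<Sum>c\<in>B. \<Sum>b\<in>B. rep (D c) b * \<beta> b (U c))"
    using sym TS B_S by (subst sum.swap) (intro sum.cong refl, auto)
  also have "\<dots> = (\<Sum>c\<in>B. \<beta> (D c) (U c))"
    using D(1) TS B_S by (intro sum.cong expand[symmetric] refl) auto
  also have "\<dots> = (\<Sum>c\<in>B. \<beta> (U c) (D c))" using sym D(1) TS B_S by (intro sum.cong) auto
  also have "\<dots> = tr U" by (simp add: tr_def D(2) TS B_S)
  finally show ?thesis .
qed

end

lemma has_vector_derivative_iff_quotient:
  "(f has_vector_derivative f') (at (0::real)) \<longleftrightarrow> ((\<lambda>h. (f h - f 0) /\<^sub>R h) \<longlongrightarrow> f') (at 0)"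
  for f :: "real \<Rightarrow> 'c::real_normed_vector"
proof -
  have eq: "norm (f h - f 0 - h *\<^sub>R f') / norm h = norm ((f h - f 0) /\<^sub>R h - f')" if "h \<noteq> 0" for h :: real
  proof -
    have "(f h - f 0) /\<^sub>R h - f' = (f h - f 0 - h *\<^sub>R f') /\<^sub>R h" using that by (simp add: scaleR_diff_right)
    then show ?thesis by (simp add: divide_inverse mult.commute)
  qed
  have "(f has_vector_derivative f') (at 0) \<longleftrightarrow> ((\<lambda>h. norm (f h - f 0 - h *\<^sub>R f') / norm h) \<longlongrightarrow> 0) (at 0)"
    unfolding has_vector_derivative_def has_derivative_at by (simp add: bounded_linear_scaleR_left)
  also have "\<dots> \<longleftrightarrow> ((\<lambda>h. norm ((f h - f 0) /\<^sub>R h - f')) \<longlongrightarrow> 0) (at 0)"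
    by (rule filterlim_cong[OF refl refl]) (use eq in \<open>auto simp: eventually_at_filter\<close>)
  finally show ?thesis by (simp only: tendsto_norm_zero_iff LIM_zero_iff)
qed

lemma sum_lessThan_add: "(\<Sum>i<m + n. f i) = (\<Sum>i<m. f i) + (\<Sum>i<n. f (m + i :: nat))"
  for f :: "nat \<Rightarrow> 'a::comm_monoid_add"
  by (induction n) (simp_all add: add.assoc)

section \<open>Top-degree forms on two copies of a subspace, and inverses of curves of
  endomorphisms\<close>

context basis_subspace
begin

text \<open>Forms on TK have slots numbered by naturals, determinants have slots in the basis; this
  bijection links the two.\<close>

definition enum :: "nat \<Rightarrow> 'e" where "enum = (SOME h. bij_betw h {..<dim S} B)"

lemma enum: "bij_betw enum {..<dim S} B"
proof -
  have "\<exists>h. bij_betw h {..<dim S} B"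
    using ex_bij_betw_nat_finite[OF finite_B] by (simp add: card_B atLeast0LessThan)
  then show ?thesis unfolding enum_def by (rule someI_ex)
qed

lemma enum_B: "i < dim S \<Longrightarrow> enum i \<in> B"
  using enum by (auto simp: bij_betw_def)

lemma ex_enum: "b \<in> B \<Longrightarrow> \<exists>k<dim S. enum k = b"
  using bij_betw_imp_surj_on[OF enum] by force

lemma sum_enum: "(\<Sum>i<dim S. f (enum i)) = (\<Sum>b\<in>B. f b)"
  by (rule sum.reindex_bij_betw[OF enum])

definition frame :: "nat \<Rightarrow> 'e \<times> 'e" where
  "frame i = (if i < dim S then (enum i, 0) else (0, enum (i - dim S)))"

definition frame_rep :: "'e \<times> 'e \<Rightarrow> nat \<Rightarrow> real" where
  "frame_rep v i = (if i < dim S then rep (fst v) (enum i) else rep (snd v) (enum (i - dim S)))"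

lemma subspace_SS: "subspace (S \<times> S)"
  by (rule subspace_Times[OF subspace_S subspace_S])

lemma zero_S: "0 \<in> S"
  by (rule subspace_0[OF subspace_S])

lemma frame_mem: "frame \<in> {..<2 * dim S} \<rightarrow> S \<times> S"
  by (auto simp: frame_def zero_S intro!: B_S enum_B)

lemma frame_expand:
  assumes "v \<in> S \<times> S"
  shows "v = (\<Sum>i<2 * dim S. frame_rep v i *\<^sub>R frame i)"
proof -
  have "(\<Sum>i<2 * dim S. frame_rep v i *\<^sub>R frame i)
     = (\<Sum>i<dim S. rep (fst v) (enum i) *\<^sub>R (enum i, 0)) + (\<Sum>i<dim S. rep (snd v) (enum i) *\<^sub>R (0, enum i))"
    unfolding mult_2 sum_lessThan_add by (simp add: frame_rep_def frame_def)
  also have "\<dots> = (\<Sum>b\<in>B. rep (fst v) b *\<^sub>R (b, 0)) + (\<Sum>b\<in>B. rep (snd v) b *\<^sub>R (0, b))"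
    by (rule arg_cong2[of _ _ _ _ "(+)"], rule sum_enum[of "\<lambda>b. rep (fst v) b *\<^sub>R (b, 0)"],
        rule sum_enum[of "\<lambda>b. rep (snd v) b *\<^sub>R (0, b)"])
  also have "\<dots> = (\<Sum>b\<in>B. rep (fst v) b *\<^sub>R b, \<Sum>b\<in>B. rep (snd v) b *\<^sub>R b)"
    by (simp add: prod_eq_iff fst_sum snd_sum)
  also have "\<dots> = v" using assms by (auto simp: rep_sum)
  finally show ?thesis by simp
qed

text \<open>The trace of a block matrix sees its diagonal blocks only.\<close>

lemma alternating_form_trace_prod:
  assumes \<omega>: "alternating_form {..<2 * dim S} (S \<times> S) \<omega>"
    and A: "\<And>v. v \<in> S \<times> S \<Longrightarrow> A v \<in> S \<times> S"
      "\<And>a v w. v \<in> S \<times> S \<Longrightarrow> w \<in> S \<times> S \<Longrightarrow> A (a *\<^sub>R v + w) = a *\<^sub>R A v + A w"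
    and y: "y \<in> {..<2 * dim S} \<rightarrow> S \<times> S"
  shows "(\<Sum>i<2 * dim S. \<omega> (y(i := A (y i))))
    = (tr (\<lambda>v. fst (A (v, 0))) + tr (\<lambda>v. snd (A (0, v)))) * \<omega> y"
proof -
  have "(\<Sum>i<2 * dim S. frame_rep (A (frame i)) i)
      = (\<Sum>i<dim S. rep (fst (A (enum i, 0))) (enum i)) + (\<Sum>i<dim S. rep (snd (A (0, enum i))) (enum i))"
    unfolding mult_2 sum_lessThan_add by (simp add: frame_rep_def frame_def)
  also have "\<dots> = tr (\<lambda>v. fst (A (v, 0))) + tr (\<lambda>v. snd (A (0, v)))"
    using sum_enum[of "\<lambda>b. rep (fst (A (b, 0))) b"] sum_enum[of "\<lambda>b. rep (snd (A (0, b))) b"] by (simp add: tr_def)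
  finally show ?thesis
    using alternating_form_trace[OF \<omega> subspace_SS finite_lessThan frame_mem frame_expand A y] by simp
qed

text \<open>With the horizontal arguments held at the basis, the form is alternating in the vertical
  ones, whose slots are indexed by the basis; \<open>alternating_form_det_on\<close> then gives the
  determinant.\<close>

lemma alternating_form_diag:
  assumes \<omega>: "alternating_form {..<2 * dim S} (S \<times> S) \<omega>" and M: "endo M"
    and y: "y \<in> {..<2 * dim S} \<rightarrow> S \<times> S"
  shows "\<omega> (\<lambda>i. (fst (y i), M (snd (y i)))) = det_on S M * \<omega> y"
proof (rule alternating_form_unique[OF _ \<omega> subspace_SS finite_lessThan frame_mem frame_expand _ y])
  show "alternating_form {..<2 * dim S} (S \<times> S) (\<lambda>y. \<omega> (\<lambda>i. (fst (y i), M (snd (y i)))))"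
    by (rule alternating_form_compose[OF \<omega>, of _ "\<lambda>v. (fst v, M (snd v))"])
      (auto simp: endo_mem[OF M] endo_lin[OF M])
  let ?e = "\<lambda>z i. if i < dim S then (enum i, 0) else (0, z (enum (i - dim S)))"
  have inj: "i = j" if "enum i = enum j" "i < dim S" "j < dim S" for i j
    using enum that by (auto simp: bij_betw_def inj_on_def)
  have mem: "?e z \<in> {..<2 * dim S} \<rightarrow> S \<times> S" if "z \<in> B \<rightarrow> S" for z
    using that enum_B B_S zero_S by (simp add: Pi_iff)
  note ml = alternating_form_multilinear[OF \<omega>]
  have alt: "alternating_form B S (\<lambda>z. \<omega> (?e z))"
    unfolding alternating_form_def multilinear_form_def
  proof (intro conjI allI impI)
    fix y z :: "'e \<Rightarrow> 'e" assume "\<forall>i\<in>B. y i = z i"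
    then show "\<omega> (?e y) = \<omega> (?e z)" by (intro multilinear_form_cong[OF ml]) (auto simp: enum_B)
  next
    fix z b a v w assume z: "z \<in> B \<rightarrow> S" "b \<in> B" "v \<in> S" "w \<in> S"
    obtain k where k: "k < dim S" "enum k = b" using ex_enum[OF z(2)] by blast
    have upd: "\<omega> (?e (z(b := u))) = \<omega> ((?e z)(dim S + k := (0, u)))" for u
    proof (rule multilinear_form_cong[OF ml])
      fix i assume i: "i \<in> {..<2 * dim S}"
      show "?e (z(b := u)) i = ((?e z)(dim S + k := (0, u))) i"
      proof (cases "i < dim S \<or> i = dim S + k")
        case False
        then have "enum (i - dim S) \<noteq> b" using i k(1) inj[of "i - dim S" k] unfolding k(2)[symmetric] by force
        with False show ?thesis by simp
      qed (use k in auto)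
    qed
    have "\<omega> ((?e z)(dim S + k := a *\<^sub>R (0, v) + (0, w)))
        = a * \<omega> ((?e z)(dim S + k := (0, v))) + \<omega> ((?e z)(dim S + k := (0, w)))"
      by (rule multilinear_form_linear[OF ml mem[OF z(1)]]) (use k z zero_S in auto)
    then show "\<omega> (?e (z(b := a *\<^sub>R v + w))) = a * \<omega> (?e (z(b := v))) + \<omega> (?e (z(b := w)))"
      unfolding upd by simp
  next
    fix z b c assume z: "z \<in> B \<rightarrow> S" "b \<in> B" "c \<in> B" "b \<noteq> c" "z b = z c"
    obtain k where k: "k < dim S" "enum k = b" using ex_enum[OF z(2)] by blast
    obtain l where l: "l < dim S" "enum l = c" using ex_enum[OF z(3)] by blast
    show "\<omega> (?e z) = 0"
      by (rule alternating_form_eq_0[OF \<omega> mem[OF z(1)], of "dim S + k" "dim S + l"]) (use k l z in auto)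
  qed
  have "\<omega> (\<lambda>i. (fst (frame i), M (snd (frame i)))) = \<omega> (?e M)"
    using endo_lin[OF M zero_S zero_S, of 1] by (intro multilinear_form_cong[OF ml]) (auto simp: frame_def)
  also have "\<dots> = det_on S M * \<omega> (?e (\<lambda>b. b))"
    by (rule alternating_form_det_on[OF alt M])
  also have "?e (\<lambda>b. b) = frame" by (auto simp: frame_def)
  finally show "\<omega> (\<lambda>i. (fst (frame i), M (snd (frame i)))) = det_on S M * \<omega> frame" .
qed

text \<open>The vertical part added to a horizontal frame vector is a combination of vertical frame
  vectors, each of which already fills another slot.\<close>

lemma alternating_form_shear:
  assumes \<omega>: "alternating_form {..<2 * dim S} (S \<times> S) \<omega>" and C: "endo C"
    and y: "y \<in> {..<2 * dim S} \<rightarrow> S \<times> S"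
  shows "\<omega> (\<lambda>i. (fst (y i), snd (y i) + C (fst (y i)))) = \<omega> y"
proof -
  note ml = alternating_form_multilinear[OF \<omega>]
  let ?L = "\<lambda>v. (fst v, snd v + C (fst v))"
  \<comment> \<open>Interpolates between the frame and its image by shearing the first n vectors.
    Vertical frame vectors are fixed by the shear, so the end is reached at n =
    \<open>dim S\<close>.\<close>
  let ?e = "\<lambda>n i. if i < n then ?L (frame i) else frame i"
  have L: "?L v \<in> S \<times> S" if "v \<in> S \<times> S" for v
    using that by (auto intro!: subspace_add subspace_S endo_mem[OF C])
  have mem: "?e n \<in> {..<2 * dim S} \<rightarrow> S \<times> S" for n
    using frame_mem L by (auto simp: Pi_iff simp del: mem_Times_iff)
  have C0: "C 0 = 0" using endo_lin[OF C zero_S zero_S, of 1] by simp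
  have "\<omega> (?e n) = \<omega> frame" if "n \<le> dim S" for n
    using that
  proof (induction n)
    case (Suc n)
    have n: "n < dim S" using Suc.prems by simp
    have CS: "C (enum n) \<in> S" using endo_mem[OF C B_S[OF enum_B[OF n]]] .
    have "\<omega> (?e (Suc n)) = \<omega> ((?e n)(n := 1 *\<^sub>R (enum n, 0) + (0, C (enum n))))"
      by (rule multilinear_form_cong[OF ml]) (auto simp: frame_def n less_Suc_eq)
    also have "\<dots> = 1 * \<omega> ((?e n)(n := (enum n, 0))) + \<omega> ((?e n)(n := (0, C (enum n))))"
      by (rule multilinear_form_linear[OF ml mem]) (use n zero_S CS enum_B B_S in auto)
    also have "(?e n)(n := (enum n, 0)) = ?e n" by (auto simp: frame_def n)
    also have "(0, C (enum n)) = (\<Sum>b\<in>B. rep (C (enum n)) b *\<^sub>R (0, b))"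
      by (simp add: prod_eq_iff fst_sum snd_sum rep_sum[OF CS])
    also have "\<omega> ((?e n)(n := \<dots>)) = (\<Sum>b\<in>B. rep (C (enum n)) b * \<omega> ((?e n)(n := (0, b))))"
      by (rule multilinear_form_sum[OF ml subspace_SS mem]) (use n zero_S B_S in auto)
    also have "\<dots> = 0"
    proof (intro sum.neutral ballI)
      fix b assume "b \<in> B"
      then obtain k where k: "k < dim S" "enum k = b" using ex_enum by blast
      have "(?e n)(n := (0, b)) \<in> {..<2 * dim S} \<rightarrow> S \<times> S"
        using mem[of n] \<open>b \<in> B\<close> by (auto simp: Pi_iff zero_S B_S)
      then have "\<omega> ((?e n)(n := (0, b))) = 0"
        by (rule alternating_form_eq_0[OF \<omega>, of _ n "dim S + k"]) (use n k in \<open>auto simp: frame_def\<close>)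
      then show "rep (C (enum n)) b * \<omega> ((?e n)(n := (0, b))) = 0" by simp
    qed
    finally show ?case using Suc.IH n by simp
  qed simp
  moreover have "\<omega> (\<lambda>i. ?L (frame i)) = \<omega> (?e (dim S))"
    by (rule multilinear_form_cong[OF ml]) (auto simp: frame_def C0)
  ultimately have e: "\<omega> (\<lambda>i. ?L (frame i)) = 1 * \<omega> frame" by simp
  have "alternating_form {..<2 * dim S} (S \<times> S) (\<lambda>y. \<omega> (\<lambda>i. ?L (y i)))"
    by (rule alternating_form_compose[OF \<omega> L]) (auto simp: endo_lin[OF C] scaleR_add_right)
  from alternating_form_unique[OF this \<omega> subspace_SS finite_lessThan frame_mem frame_expand e y]
  show ?thesis by simp
qed

text \<open>Riesz representation for each v separately; definiteness forces the chosen vectors to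
  depend linearly on v.\<close>

lemma endo_of_form:
  assumes lin: "\<And>a v w u. v \<in> S \<Longrightarrow> w \<in> S \<Longrightarrow> u \<in> S \<Longrightarrow> \<beta> (a *\<^sub>R v + w) u = a * \<beta> v u + \<beta> w u"
    and sym: "\<And>v w. v \<in> S \<Longrightarrow> w \<in> S \<Longrightarrow> \<beta> v w = \<beta> w v"
    and pos: "\<And>v. v \<in> S \<Longrightarrow> v \<noteq> 0 \<Longrightarrow> \<beta> v v > (0::real)"
    and \<gamma>: "\<And>a v w u. v \<in> S \<Longrightarrow> w \<in> S \<Longrightarrow> u \<in> S \<Longrightarrow> \<gamma> (a *\<^sub>R v + w) u = a * \<gamma> v u + \<gamma> w u"
      "\<And>a v w u. v \<in> S \<Longrightarrow> w \<in> S \<Longrightarrow> u \<in> S \<Longrightarrow> \<gamma> u (a *\<^sub>R v + w) = a * \<gamma> u v + \<gamma> u w"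
  obtains C where "endo C" "\<And>v w. v \<in> S \<Longrightarrow> w \<in> S \<Longrightarrow> \<beta> (C v) w = \<gamma> v w"
proof -
  have "\<exists>z. v \<in> S \<longrightarrow> z \<in> S \<and> (\<forall>u\<in>S. \<beta> u z = \<gamma> v u)" for v
  proof (cases "v \<in> S")
    case True
    obtain z where "z \<in> S" "\<And>u. u \<in> S \<Longrightarrow> \<beta> u z = \<gamma> v u"
      by (rule riesz[where \<beta> = \<beta> and \<phi> = "\<gamma> v"]) (use lin sym pos \<gamma>(2) True in blast)+
    then show ?thesis by blast
  qed simp
  then have "\<forall>v. \<exists>z. v \<in> S \<longrightarrow> z \<in> S \<and> (\<forall>u\<in>S. \<beta> u z = \<gamma> v u)" by (rule allI)
  from choice[OF this] obtain C where C: "\<And>v. v \<in> S \<Longrightarrow> C v \<in> S" "\<And>v u. v \<in> S \<Longrightarrow> u \<in> S \<Longrightarrow> \<beta> u (C v) = \<gamma> v u"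
    by blast
  have CC: "\<beta> (C v) u = \<gamma> v u" if "v \<in> S" "u \<in> S" for v u
    using C(2)[OF that] sym[OF C(1)[OF that(1)] that(2)] by simp
  have "endo C"
  proof (rule endoI)
    fix a v w assume v: "v \<in> S" "w \<in> S"
    let ?l = "C (a *\<^sub>R v + w)" and ?r = "a *\<^sub>R C v + C w"
    have mem: "a *\<^sub>R v + w \<in> S" "?r \<in> S" using v C(1) by (auto intro!: subspace_add subspace_scale subspace_S)
    have d: "?l - ?r \<in> S" using mem C(1) by (intro subspace_diff subspace_S) auto
    have "\<beta> (- 1 *\<^sub>R ?r + ?l) u = - 1 * \<beta> ?r u + \<beta> ?l u" if "u \<in> S" for u
      by (rule lin) (use mem C(1) that in auto)
    moreover have "\<beta> ?r u = a * \<beta> (C v) u + \<beta> (C w) u" if "u \<in> S" for u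
      by (rule lin) (use v C(1) that in auto)
    ultimately have "\<beta> (- 1 *\<^sub>R ?r + ?l) (?l - ?r) = 0"
      using CC[OF v(1) d] CC[OF v(2) d] CC[OF mem(1) d] \<gamma>(1)[OF v d] d by simp
    moreover have "- 1 *\<^sub>R ?r + ?l = ?l - ?r" by simp
    ultimately show "?l = ?r" using pos[OF d] by (metis eq_iff_diff_eq_0 less_irrefl)
  qed (rule C)
  with that CC show ?thesis by blast
qed

text \<open>One constant serves all T because it bounds the coordinate functionals. Convergence to 0
  on the basis thereby becomes a bound uniform in v, needed for a family of operators applied to a
  moving vector.\<close>

lemma endo_bound:
  obtains K where "K > 0" "\<And>T v. endo T \<Longrightarrow> v \<in> S \<Longrightarrow> norm (T v) \<le> K * (\<Sum>b\<in>B. norm (T b)) * norm v"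
proof -
  have "\<exists>K>0. \<forall>v\<in>S. \<bar>rep v b\<bar> \<le> K * norm v" for b
  proof -
    obtain g :: "'e \<Rightarrow> real" where g: "linear g" "\<forall>x\<in>B. g x = rep x b"
      using linear_independent_extend[OF B(1), of "\<lambda>x. rep x b"] by blast
    have gv: "g v = rep v b" if "v \<in> S" for v
    proof -
      have "rep (\<Sum>c\<in>B. rep v c *\<^sub>R c) b = (\<Sum>c\<in>B. rep v c *\<^sub>R rep c b)"
        by (rule sum_lin) (use B_S in \<open>auto simp: rep_linear\<close>)
      also have "\<dots> = g (\<Sum>c\<in>B. rep v c *\<^sub>R c)" using g by (simp add: linear_sum linear_cmul)
      finally show ?thesis by (simp add: rep_sum[OF that])
    qed
    obtain K where "K > 0" "\<And>x. norm (g x) \<le> K * norm x" using linear_bounded_pos[OF g(1)] by blast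
    then show ?thesis using gv by (metis real_norm_def)
  qed
  then have "\<forall>b. \<exists>K>0. \<forall>v\<in>S. \<bar>rep v b\<bar> \<le> K * norm v" by (rule allI)
  from choice[OF this] obtain k where k: "\<And>b. k b > 0" "\<And>b v. v \<in> S \<Longrightarrow> \<bar>rep v b\<bar> \<le> k b * norm v" by blast
  \<comment> \<open>The summand 1 keeps K positive also when the basis is empty.\<close>
  define K where "K = 1 + (\<Sum>b\<in>B. k b)"
  have kK: "k b \<le> K" if "b \<in> B" for b
    using member_le_sum[OF that, of k] finite_B k(1) by (force simp: K_def intro: less_imp_le)
  have "norm (T v) \<le> K * (\<Sum>b\<in>B. norm (T b)) * norm v" if T: "endo T" and v: "v \<in> S" for T v
  proof -
    have "T v = (\<Sum>b\<in>B. rep v b *\<^sub>R T b)"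
      using sum_lin[of T B "\<lambda>b. b" "rep v", OF endo_lin[OF T] B_S] by (simp add: rep_sum[OF v])
    also have "norm \<dots> \<le> (\<Sum>b\<in>B. \<bar>rep v b\<bar> * norm (T b))"
      by (rule order_trans[OF norm_sum]) simp
    also have "\<dots> \<le> (\<Sum>b\<in>B. K * norm v * norm (T b))"
    proof (rule sum_mono, rule mult_right_mono)
      fix b assume "b \<in> B"
      then show "\<bar>rep v b\<bar> \<le> K * norm v"
        using k(2)[OF v, of b] kK mult_right_mono[OF kK norm_ge_zero, of b v] by linarith
    qed simp
    also have "\<dots> = K * (\<Sum>b\<in>B. norm (T b)) * norm v" by (simp add: sum_distrib_left mult_ac)
    finally show ?thesis .
  qed
  moreover have "K > 0" using sum_nonneg[of B k] k(1) by (force simp: K_def intro: less_imp_le)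
  ultimately show ?thesis using that by blast
qed

text \<open>Differentiability of an inverse, in terms of the solution z of \<open>M z = w\<close>. With
  \<open>E = M\<^sub>0\<^sup>-\<^sup>1 M - 1\<close>, which tends to 0, the increment \<open>\<delta>\<close> of z satisfies \<open>\<delta> = r - E \<delta>\<close>, where r has
  the expected derivative.\<close>

lemma solution_has_vector_derivative:
  assumes M: "\<And>t. endo (M t)" and M': "\<And>v. v \<in> S \<Longrightarrow> M' v \<in> S"
    and dM: "\<And>v. v \<in> S \<Longrightarrow> ((\<lambda>t. M t v) has_vector_derivative M' v) (at 0)"
    and L: "endo L" "\<And>v. v \<in> S \<Longrightarrow> L (M 0 v) = v"
    and z: "\<And>t. z t \<in> S" "\<And>t. M t (z t) = w t"
    and w': "w' \<in> S" "(w has_vector_derivative w') (at 0)"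
  shows "(z has_vector_derivative L (w' - M' (z 0))) (at 0)"
proof -
  obtain K where K: "K > 0" "\<And>T v. endo T \<Longrightarrow> v \<in> S \<Longrightarrow> norm (T v) \<le> K * (\<Sum>b\<in>B. norm (T b)) * norm v"
    by (rule endo_bound) blast
  obtain g where g: "linear g" "\<And>v. v \<in> S \<Longrightarrow> g v = L v" by (rule endo_extend[OF L(1)]) blast
  have bl: "bounded_linear g" using g(1) linear_conv_bounded_linear by blast
  have wS: "w t \<in> S" for t using z endo_mem[OF M] by metis
  define E where "E = (\<lambda>t v. L (M t v) - v)"
  have E: "endo (E t)" for t
  proof (rule endoI)
    show "E t v \<in> S" if "v \<in> S" for v
      unfolding E_def by (intro subspace_diff subspace_S that endo_mem[OF L(1)] endo_mem[OF M])
    show "E t (a *\<^sub>R v + w) = a *\<^sub>R E t v + E t w" if "v \<in> S" "w \<in> S" for a v w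
      unfolding E_def endo_lin[OF M that] endo_lin[OF L(1) endo_mem[OF M that(1)] endo_mem[OF M that(2)]]
      by (simp add: algebra_simps)
  qed
  define \<epsilon> where "\<epsilon> = (\<lambda>t. K * (\<Sum>b\<in>B. norm (E t b)))"
  have \<epsilon>: "norm (E t v) \<le> \<epsilon> t * norm v" if "v \<in> S" for t v
    using K(2)[OF E that] by (simp add: \<epsilon>_def)
  have "((\<lambda>t. E t b) \<longlongrightarrow> 0) (at 0)" if b: "b \<in> B" for b
  proof -
    have "isCont (\<lambda>t. M t b) 0"
      using dM[OF B_S[OF b]] has_vector_derivative_continuous by blast
    then have "((\<lambda>t. g (M t b) - b) \<longlongrightarrow> g (M 0 b) - b) (at 0)"
      by (intro tendsto_diff bounded_linear.tendsto[OF bl] tendsto_const) (simp add: isCont_def)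
    then show ?thesis by (simp add: E_def g(2) endo_mem[OF M] L(2) B_S[OF b])
  qed
  then have \<epsilon>0: "(\<epsilon> \<longlongrightarrow> 0) (at 0)"
    unfolding \<epsilon>_def by (intro tendsto_mult_right_zero tendsto_null_sum tendsto_norm_zero)
  define \<delta> where "\<delta> = (\<lambda>t. z t - z 0)"
  define r where "r = (\<lambda>t. g (w t) - g (M t (z 0)))"
  have \<delta>S: "\<delta> t \<in> S" for t unfolding \<delta>_def by (intro subspace_diff subspace_S z)
  have split: "\<delta> t = r t - E t (\<delta> t)" for t
  proof -
    have "L (M t (\<delta> t)) = L (M t (z t)) - L (M t (z 0))"
      using endo_lin[OF endo_comp[OF L(1) M[of t]] z(1)[of 0] z(1)[of t], of "- 1"] by (simp add: \<delta>_def)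
    then have "L (M t (\<delta> t)) = r t" by (simp add: r_def z(2) g(2) wS endo_mem[OF M z(1)])
    then show ?thesis by (simp add: E_def)
  qed
  have r0: "r 0 = 0" using z(2)[of 0] by (simp add: r_def)
  have "(r has_vector_derivative g w' - g (M' (z 0))) (at 0)"
    unfolding r_def
    by (intro has_vector_derivative_diff bounded_linear.has_vector_derivative[OF bl] w'(2) dM z)
  then have rq: "((\<lambda>h. r h /\<^sub>R h) \<longlongrightarrow> g w' - g (M' (z 0))) (at 0)"
    unfolding has_vector_derivative_iff_quotient by (simp add: r0)
  \<comment> \<open>Below 1/2 the term \<open>E h (\<delta> h)\<close> can be absorbed on the left,
    so that \<delta> is at most twice as large as r and the error is o(h).\<close>
  have ev: "eventually (\<lambda>h. \<epsilon> h < 1/2) (at 0)" using order_tendstoD(2)[OF \<epsilon>0, of "1/2"] by simp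
  have bd: "eventually (\<lambda>h. norm (E h (\<delta> h) /\<^sub>R h) \<le> \<epsilon> h * (2 * norm (r h /\<^sub>R h))) (at 0)"
    using ev
  proof eventually_elim
    case (elim h)
    have pe: "0 \<le> \<epsilon> h" unfolding \<epsilon>_def using K(1) by (intro mult_nonneg_nonneg sum_nonneg) auto
    have "norm (\<delta> h) \<le> norm (r h) + norm (E h (\<delta> h))" by (subst split) (rule norm_triangle_ineq4)
    also have "norm (E h (\<delta> h)) \<le> 1/2 * norm (\<delta> h)"
      using \<epsilon>[OF \<delta>S, of h h] mult_right_mono[of "\<epsilon> h" "1/2" "norm (\<delta> h)"] elim by simp
    finally have "norm (\<delta> h) \<le> 2 * norm (r h)" by simp
    then have "norm (E h (\<delta> h)) \<le> \<epsilon> h * (2 * norm (r h))"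
      using \<epsilon>[OF \<delta>S, of h h] mult_left_mono[OF _ pe, of "norm (\<delta> h)" "2 * norm (r h)"] by linarith
    then have "\<bar>inverse h\<bar> * norm (E h (\<delta> h)) \<le> \<bar>inverse h\<bar> * (\<epsilon> h * (2 * norm (r h)))"
      by (rule mult_left_mono) simp
    then show ?case by (simp add: mult_ac)
  qed
  have "((\<lambda>h. \<epsilon> h * (2 * norm (r h /\<^sub>R h))) \<longlongrightarrow> 0 * (2 * norm (g w' - g (M' (z 0))))) (at 0)"
    by (intro tendsto_mult \<epsilon>0 tendsto_const tendsto_norm rq)
  then have "((\<lambda>h. E h (\<delta> h) /\<^sub>R h) \<longlongrightarrow> 0) (at 0)"
    by (intro Lim_null_comparison[OF bd]) simp
  from tendsto_diff[OF rq this]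
  have "((\<lambda>h. (r h - E h (\<delta> h)) /\<^sub>R h) \<longlongrightarrow> g w' - g (M' (z 0))) (at 0)"
    by (simp add: scaleR_diff_right)
  then have "((\<lambda>h. (z h - z 0) /\<^sub>R h) \<longlongrightarrow> g w' - g (M' (z 0))) (at 0)"
    unfolding split[symmetric] by (simp add: \<delta>_def)
  then have "(z has_vector_derivative g w' - g (M' (z 0))) (at 0)"
    unfolding has_vector_derivative_iff_quotient .
  moreover have "g w' - g (M' (z 0)) = L (w' - M' (z 0))"
    using g(2)[of "w' - M' (z 0)"] w'(1) M'[OF z(1)] subspace_S
    by (simp add: linear_diff[OF g(1)] subspace_diff)
  ultimately show ?thesis by simp
qed

end

section \<open>The compressed system\<close>

locale compressed = cartan G \<theta> for G :: "('a, real^'m) lie_data" (structure) and \<theta> +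
  fixes \<I> :: "real^'m \<Rightarrow> real^'m" and w0 :: "real^'m"
  assumes inertia: "inertia_tensor G \<theta> \<I>"
begin

sublocale k: basis_subspace kk
  by unfold_locales (rule subspace_k)

abbreviation A :: "'a \<Rightarrow> real^'m \<Rightarrow> real^'m" where "A \<equiv> nh_form G w0"
abbreviation M :: "'a \<Rightarrow> real^'m \<Rightarrow> real^'m" where "M \<equiv> metric_tensor G \<theta> \<I> w0"

text \<open>The metric as a bilinear form. Unlike \<open>metric_tensor\<close>, which hides an
  adjoint in a definite description, it is explicit and can be differentiated by the product
  rule.\<close>

definition m :: "'a \<Rightarrow> real^'m \<Rightarrow> real^'m \<Rightarrow> real" where
  "m s x y = ip (\<I> x) y + ip (A s x) (A s y)"

lemma k_closed: "x \<in> kk \<Longrightarrow> y \<in> kk \<Longrightarrow> x + y \<in> kk" "x \<in> kk \<Longrightarrow> r *\<^sub>R x \<in> kk"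
  "x \<in> kk \<Longrightarrow> y \<in> kk \<Longrightarrow> x - y \<in> kk" "x \<in> kk \<Longrightarrow> - x \<in> kk" "0 \<in> kk"
  using subspace_k by (auto simp: subspace_add subspace_scale subspace_diff subspace_neg subspace_0)

lemma \<I>_k: "u \<in> kk \<Longrightarrow> \<I> u \<in> kk"
  and \<I>_add: "u \<in> kk \<Longrightarrow> v \<in> kk \<Longrightarrow> \<I> (u + v) = \<I> u + \<I> v"
  and \<I>_scale: "u \<in> kk \<Longrightarrow> \<I> (r *\<^sub>R u) = r *\<^sub>R \<I> u"
  and \<I>_sym: "u \<in> kk \<Longrightarrow> v \<in> kk \<Longrightarrow> ip (\<I> u) v = ip u (\<I> v)"
  and \<I>_pos: "u \<in> kk \<Longrightarrow> u \<noteq> 0 \<Longrightarrow> ip (\<I> u) u > 0"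
  using inertia unfolding inertia_tensor_def by blast+

lemma endo_\<I>: "k.endo \<I>"
  by (rule k.endoI) (simp_all add: \<I>_k \<I>_add \<I>_scale k_closed)

lemma endo_br: "u \<in> kk \<Longrightarrow> k.endo (br u)"
  by (rule k.endoI) (simp_all add: br_k br_linear)

lemma ip_eqI:
  assumes "x \<in> kk" "y \<in> kk" "\<And>z. z \<in> kk \<Longrightarrow> ip x z = ip y z"
  shows "x = y"
proof (rule ccontr)
  assume "x \<noteq> y"
  then have "ip (x - y) (x - y) > 0" by (intro ip_pos) simp
  with assms(3)[OF k_closed(3)[OF assms(1,2)]] show False by (simp only: ip_linear)
qed

lemma endo_form:
  assumes "\<And>a v w u. v \<in> kk \<Longrightarrow> w \<in> kk \<Longrightarrow> u \<in> kk \<Longrightarrow> \<gamma> (a *\<^sub>R v + w) u = a * \<gamma> v u + \<gamma> w u"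
    "\<And>a v w u. v \<in> kk \<Longrightarrow> w \<in> kk \<Longrightarrow> u \<in> kk \<Longrightarrow> \<gamma> u (a *\<^sub>R v + w) = a * \<gamma> u v + \<gamma> u w"
  shows "\<exists>C. k.endo C \<and> (\<forall>v\<in>kk. \<forall>w\<in>kk. ip (C v) w = \<gamma> v w)"
  by (rule k.endo_of_form[of ip \<gamma>]) (use assms ip_left ip_sym ip_pos in blast)+

text \<open>Recovers a vector of k from its inner products, so that a curve known only through them
  can be differentiated.\<close>

lemma dual_basis:
  obtains D where "\<And>b. D b \<in> kk" "\<And>x. x \<in> kk \<Longrightarrow> (\<Sum>b\<in>k.B. ip x (D b) *\<^sub>R b) = x"
proof -
  have "\<exists>z. z \<in> kk \<and> (\<forall>u\<in>kk. ip u z = k.rep u b)" for b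
    by (rule k.riesz[of ip "\<lambda>u. k.rep u b"]) (use ip_left ip_sym ip_pos k.rep_linear in blast)+
  then have "\<forall>b. \<exists>z. z \<in> kk \<and> (\<forall>u\<in>kk. ip u z = k.rep u b)" by (rule allI)
  from choice[OF this] obtain D where D: "\<And>b. D b \<in> kk" "\<And>b u. u \<in> kk \<Longrightarrow> ip u (D b) = k.rep u b"
    by blast
  have "(\<Sum>b\<in>k.B. ip x (D b) *\<^sub>R b) = x" if "x \<in> kk" for x
    by (simp only: D(2)[OF that] k.rep_sum[OF that])
  with D(1) that show ?thesis by blast
qed

text \<open>The hypothesis makes -U the adjoint of T, and adjoints share their trace.\<close>

lemma tr_skew:
  assumes "k.endo T" "k.endo U" "\<And>v w. v \<in> kk \<Longrightarrow> w \<in> kk \<Longrightarrow> ip (T v) w = - ip v (U w)"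
  shows "k.tr T = - k.tr U"
proof -
  have mU: "k.endo (\<lambda>v. - 1 *\<^sub>R U v + 0)"
    by (rule k.endoI) (simp_all add: k_closed k.endo_mem[OF assms(2)] k.endo_lin[OF assms(2)])
  have z: "k.endo (\<lambda>v. 0)" by (rule k.endoI) (simp_all add: k_closed)
  have "k.tr T = k.tr (\<lambda>v. - 1 *\<^sub>R U v + 0)"
    by (rule k.tr_adjoint[of ip, OF _ _ _ assms(1) mU])
      (use ip_left ip_sym ip_pos assms(3) in \<open>simp_all add: ip_linear\<close>)
  also have "\<dots> = - 1 * k.tr U + k.tr (\<lambda>v. 0)" by (rule k.tr_lin[OF assms(2) z])
  also have "k.tr (\<lambda>v. 0) = 0" by (simp add: k.tr_def representation_zero)
  finally show ?thesis by simp
qed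

lemma tr_br: "u \<in> kk \<Longrightarrow> k.tr (br u) = 0"
  using tr_skew[OF endo_br endo_br, of u u] ip_skew[of u] by force

section \<open>The metric tensor at a fixed point of the group\<close>

context
  fixes s :: 'a
  assumes s: "s \<in> carrier G"
begin

lemma linear_A: "linear (A s)"
  unfolding nh_form_def
  using linear_compose[OF Ad_linear[OF s] linear_compose[OF br_left[of w0] linear_uminus]]
  by (simp add: o_def)

lemmas A_lin = linear_add[OF linear_A] linear_cmul[OF linear_A] linear_neg[OF linear_A]
  linear_diff[OF linear_A] linear_0[OF linear_A]

lemma m_left: "x \<in> kk \<Longrightarrow> y \<in> kk \<Longrightarrow> m s (a *\<^sub>R x + y) z = a * m s x z + m s y z"
  by (simp add: m_def \<I>_add \<I>_scale k_closed A_lin ip_linear algebra_simps)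

lemma m_right: "m s z (a *\<^sub>R x + y) = a * m s z x + m s z y"
  by (simp add: m_def A_lin ip_linear algebra_simps)

lemma m_sym: "x \<in> kk \<Longrightarrow> y \<in> kk \<Longrightarrow> m s x y = m s y x"
  unfolding m_def using \<I>_sym[of x y] ip_sym[of x "\<I> y"] ip_sym[of "A s x" "A s y"] by simp

lemma ip_nonneg: "ip x x \<ge> 0"
  using ip_pos[of x] by (cases "x = 0") (auto simp: ip_linear)

lemma m_pos: "x \<in> kk \<Longrightarrow> x \<noteq> 0 \<Longrightarrow> m s x x > 0"
  using \<I>_pos[of x] ip_nonneg[of "A s x"] by (simp add: m_def)

text \<open>For the definite description in \<open>adjoint_k\<close>, existence comes from
  representing the form \<open>ip (A s v) (A s w)\<close> by an endomorphism of k, uniqueness from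
  definiteness.\<close>

lemma metric:
  shows endo_M: "k.endo (M s)" and ip_M: "x \<in> kk \<Longrightarrow> y \<in> kk \<Longrightarrow> ip (M s x) y = m s x y"
proof -
  have "\<exists>C. k.endo C \<and> (\<forall>v\<in>kk. \<forall>w\<in>kk. ip (C v) w = ip (A s v) (A s w))"
    by (rule endo_form) (simp_all add: A_lin ip_linear)
  then obtain C where C: "k.endo C" "\<And>v w. v \<in> kk \<Longrightarrow> w \<in> kk \<Longrightarrow> ip (C v) w = ip (A s v) (A s w)" by blast
  have ad: "adjoint_k G \<theta> (A s) (A s v) = C v" if v: "v \<in> kk" for v
    unfolding adjoint_k_def
  proof (rule the_equality)
    show "C v \<in> kk \<and> (\<forall>u\<in>kk. ip (A s u) (A s v) = ip u (C v))"
      using k.endo_mem[OF C(1) v] C(2)[OF v] ip_sym by metis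
    fix z assume z: "z \<in> kk \<and> (\<forall>u\<in>kk. ip (A s u) (A s v) = ip u z)"
    show "z = C v"
    proof (rule ip_eqI)
      fix y assume y: "y \<in> kk"
      have "ip z y = ip (A s y) (A s v)" using z y ip_sym by metis
      also have "\<dots> = ip (C v) y" using C(2)[OF v y] ip_sym by metis
      finally show "ip z y = ip (C v) y" .
    qed (use z k.endo_mem[OF C(1) v] in auto)
  qed
  have Mv: "M s v = \<I> v + C v" if "v \<in> kk" for v by (simp add: metric_tensor_def ad that)
  show "k.endo (M s)"
    by (rule k.endoI)
      (simp_all add: Mv k_closed \<I>_k \<I>_add \<I>_scale k.endo_mem[OF C(1)] k.endo_lin[OF C(1)] scaleR_add_right)
  show "x \<in> kk \<Longrightarrow> y \<in> kk \<Longrightarrow> ip (M s x) y = m s x y"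
    by (simp add: Mv m_def C(2) ip_linear)
qed

lemma M_mem: "x \<in> kk \<Longrightarrow> M s x \<in> kk"
  by (rule k.endo_mem[OF endo_M])

lemma det_M_pos: "det_on kk (M s) > 0"
proof (rule k.det_on_pos[OF endo_M, of ip])
  show "v \<in> kk \<Longrightarrow> v \<noteq> 0 \<Longrightarrow> ip (M s v) v > 0" for v by (simp add: ip_M m_pos)
qed (simp_all add: ip_left ip_pos)

text \<open>The inverse of \<mu>_0(s) on k; elsewhere its values are left open.\<close>

definition N :: "real^'m \<Rightarrow> real^'m" where
  "N = (SOME L. k.endo L \<and> (\<forall>v\<in>kk. L (M s v) = v) \<and> (\<forall>v\<in>kk. M s (L v) = v))"

lemma N: shows endo_N: "k.endo N" and N_M: "v \<in> kk \<Longrightarrow> N (M s v) = v" and M_N: "v \<in> kk \<Longrightarrow> M s (N v) = v"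
proof -
  have "v = 0" if "v \<in> kk" "M s v = 0" for v
    using m_pos[OF that(1)] ip_M[OF that(1) that(1)] that(2) by (auto simp: ip_linear)
  then have "\<exists>L. k.endo L \<and> (\<forall>v\<in>kk. L (M s v) = v) \<and> (\<forall>v\<in>kk. M s (L v) = v)"
    using k.endo_inverse[OF endo_M] by (metis (no_types, lifting))
  from someI_ex[OF this] show "k.endo N" "v \<in> kk \<Longrightarrow> N (M s v) = v" "v \<in> kk \<Longrightarrow> M s (N v) = v"
    unfolding N_def[symmetric] by blast+
qed

lemma N_mem: "x \<in> kk \<Longrightarrow> N x \<in> kk"
  by (rule k.endo_mem[OF endo_N])

lemma N_sym:
  assumes "x \<in> kk" "y \<in> kk"
  shows "ip (N x) y = ip x (N y)"
proof -
  have "ip (N x) y = ip (M s (N y)) (N x)" using ip_sym M_N assms by metis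
  also have "\<dots> = ip (M s (N x)) (N y)" using m_sym ip_M N_mem assms by simp
  finally show ?thesis using M_N assms by simp
qed

text \<open>The derivative of the metric tensor along \<open>s exp(t\<xi>)\<close>.\<close>

definition Mp :: "real^'m \<Rightarrow> real^'m \<Rightarrow> real^'m" where
  "Mp \<xi> = (SOME C. k.endo C \<and> (\<forall>v\<in>kk. \<forall>w\<in>kk.
     ip (C v) w = ip (A s (br \<xi> v)) (A s w) + ip (A s v) (A s (br \<xi> w))))"

lemma Mp: shows endo_Mp: "k.endo (Mp \<xi>)"
  and ip_Mp: "v \<in> kk \<Longrightarrow> w \<in> kk \<Longrightarrow> ip (Mp \<xi> v) w = ip (A s (br \<xi> v)) (A s w) + ip (A s v) (A s (br \<xi> w))"
proof -
  have "\<exists>C. k.endo C \<and> (\<forall>v\<in>kk. \<forall>w\<in>kk.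
     ip (C v) w = ip (A s (br \<xi> v)) (A s w) + ip (A s v) (A s (br \<xi> w)))"
    by (rule endo_form) (simp_all add: A_lin ip_linear br_linear algebra_simps)
  from someI_ex[OF this] show "k.endo (Mp \<xi>)"
    "v \<in> kk \<Longrightarrow> w \<in> kk \<Longrightarrow> ip (Mp \<xi> v) w = ip (A s (br \<xi> v)) (A s w) + ip (A s v) (A s (br \<xi> w))"
    unfolding Mp_def[symmetric] by blast+
qed

lemma Mp_linear:
  assumes "v \<in> kk"
  shows "Mp (a *\<^sub>R \<xi> + \<xi>') v = a *\<^sub>R Mp \<xi> v + Mp \<xi>' v"
  by (rule ip_eqI)
    (simp_all add: ip_Mp assms k.endo_mem[OF endo_Mp] k_closed ip_linear br_linear A_lin algebra_simps)

text \<open>Skewness moves \<open>br u\<close> from the test vector z to the other side of the inner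
  product, which turns the derivative of a symmetric form into a commutator.\<close>

lemma Mp_commutator:
  assumes u: "u \<in> kk" and v: "v \<in> kk"
  shows "Mp u v = M s (br u v) - \<I> (br u v) - (br u (M s v) - br u (\<I> v))"
proof (rule ip_eqI)
  fix z assume z: "z \<in> kk"
  have "ip (br u (M s v)) z = - m s v (br u z)" "ip (br u (\<I> v)) z = - ip (\<I> v) (br u z)"
    using ip_skew[OF u M_mem[OF v] z] ip_skew[OF u \<I>_k[OF v] z] ip_M[OF v br_k[OF u z]] by simp_all
  then show "ip (Mp u v) z = ip (M s (br u v) - \<I> (br u v) - (br u (M s v) - br u (\<I> v))) z"
    using ip_M[OF br_k[OF u v] z] by (simp add: ip_Mp u v z ip_linear m_def)
qed (simp_all add: u v k.endo_mem[OF endo_Mp] M_mem \<I>_k br_k k_closed)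

text \<open>The trace on the right is that of the vertical block of the bracket with
  \<open>X_nh\<close>. The factor 2 arises because N \<I> ad(u) and -ad(u) \<I> N are adjoint to
  each other, so two terms of the commutator contribute equally; it offsets the exponent 1/2 of the
  determinant in the volume density.\<close>

lemma trace_identity:
  assumes u: "u \<in> kk"
  shows "k.tr (\<lambda>v. N (Mp u v)) = 2 * k.tr (\<lambda>v. N (br v (\<I> u) + br u (\<I> v)))"
proof -
  have e: "k.endo (\<lambda>v. N (\<I> (br u v)))" "k.endo (\<lambda>v. N (br u (M s v)))" "k.endo (\<lambda>v. N (br u (\<I> v)))"
    "k.endo (\<lambda>v. br u (\<I> v))" "k.endo (\<lambda>v. N (br u v))" "k.endo (\<lambda>v. br u (\<I> (N v)))"
    by (intro k.endo_comp[OF endo_N] k.endo_comp[OF endo_\<I>] k.endo_comp[OF endo_br[OF u]]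
        endo_N endo_M endo_\<I> endo_br u)+
  have c: "\<I> u \<in> kk" by (rule \<I>_k[OF u])
  have NL: "N (x + y) = N x + N y" "N (x - y) = N x - N y" if "x \<in> kk" "y \<in> kk" for x y
    using k.endo_lin[OF endo_N that, of 1] k.endo_lin[OF endo_N that(2,1), of "- 1"] by simp_all
  have e2: "k.endo (\<lambda>v. N (br (\<I> u) v))" "k.endo (\<lambda>v. br (\<I> u) (N v))"
    by (intro k.endo_comp[OF endo_N] k.endo_comp[OF endo_br[OF c]] endo_N endo_br c)+
  have 1: "k.tr (\<lambda>v. N (br u (M s v))) = 0"
  \<comment> \<open>Cyclicity brings N next to the metric tensor and leaves the trace of
    \<open>br u\<close>.\<close>
  proof -
    have "k.tr (\<lambda>v. N (br u (M s v))) = k.tr (\<lambda>v. M s (N (br u v)))"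
      by (rule k.tr_comm[OF e(5) endo_M])
    also have "\<dots> = k.tr (br u)" by (rule k.tr_cong) (simp add: M_N br_k u)
    finally show ?thesis by (simp add: tr_br u)
  qed
  have 2: "k.tr (\<lambda>v. N (\<I> (br u v))) = - k.tr (\<lambda>v. N (br u (\<I> v)))"
  proof -
    have "k.tr (\<lambda>v. N (\<I> (br u v))) = - k.tr (\<lambda>v. br u (\<I> (N v)))"
    proof (rule tr_skew[OF e(1) e(6)])
      fix v w assume "v \<in> kk" "w \<in> kk"
      then show "ip (N (\<I> (br u v))) w = - ip v (br u (\<I> (N w)))"
        using ip_skew[OF u, of v "\<I> (N w)"] by (simp add: N_sym \<I>_sym \<I>_k br_k u N_mem)
    qed
    also have "k.tr (\<lambda>v. br u (\<I> (N v))) = k.tr (\<lambda>v. N (br u (\<I> v)))"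
      by (rule k.tr_comm[OF e(4) endo_N])
    finally show ?thesis .
  qed
  have 3: "k.tr (\<lambda>v. N (br (\<I> u) v)) = 0"
  proof -
    have "k.tr (\<lambda>v. N (br (\<I> u) v)) = - k.tr (\<lambda>v. br (\<I> u) (N v))"
    proof (rule tr_skew[OF e2])
      fix v w assume "v \<in> kk" "w \<in> kk"
      then show "ip (N (br (\<I> u) v)) w = - ip v (br (\<I> u) (N w))"
        using ip_skew[OF c, of v "N w"] by (simp add: N_sym br_k c N_mem)
    qed
    also have "k.tr (\<lambda>v. br (\<I> u) (N v)) = k.tr (\<lambda>v. N (br (\<I> u) v))"
      by (rule k.tr_comm[OF endo_br[OF c] endo_N])
    finally show ?thesis by simp
  qed
  have "k.tr (\<lambda>v. N (Mp u v)) = k.tr (\<lambda>v. 1 *\<^sub>R br u v +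
     (- 1 *\<^sub>R N (\<I> (br u v)) + (- 1 *\<^sub>R N (br u (M s v)) + N (br u (\<I> v)))))"
    by (rule k.tr_cong)
      (simp add: Mp_commutator[OF u] NL k_closed M_mem br_k u \<I>_k N_M)
  also have "\<dots> = 1 * k.tr (br u) + (- 1 * k.tr (\<lambda>v. N (\<I> (br u v))) + (- 1 * k.tr (\<lambda>v. N (br u (M s v)))
      + k.tr (\<lambda>v. N (br u (\<I> v)))))"
  proof -
    have e3: "k.endo (\<lambda>v. - 1 *\<^sub>R N (br u (M s v)) + N (br u (\<I> v)))"
      "k.endo (\<lambda>v. - 1 *\<^sub>R N (\<I> (br u v)) + (- 1 *\<^sub>R N (br u (M s v)) + N (br u (\<I> v))))"
      by (intro k.endo_lincomb e)+
    show ?thesis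
      by (simp only: k.tr_lin[OF endo_br[OF u] e3(2)] k.tr_lin[OF e(1) e3(1)] k.tr_lin[OF e(2,3)])
  qed
  also have "\<dots> = 2 * k.tr (\<lambda>v. N (br u (\<I> v)))" by (simp add: 1 2 tr_br u)
  \<comment> \<open>A traceless term is added, because the linearization of [u, \<I> u] also varies
    the first factor.\<close>
  also have "k.tr (\<lambda>v. N (br u (\<I> v))) = - 1 * k.tr (\<lambda>v. N (br (\<I> u) v)) + k.tr (\<lambda>v. N (br u (\<I> v)))"
    by (simp add: 3)
  also have "\<dots> = k.tr (\<lambda>v. - 1 *\<^sub>R N (br (\<I> u) v) + N (br u (\<I> v)))"
    by (rule k.tr_lin[OF e2(1) e(3), symmetric])
  also have "\<dots> = k.tr (\<lambda>v. N (br v (\<I> u) + br u (\<I> v)))"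
  proof (rule k.tr_cong)
    fix v assume v: "v \<in> kk"
    have "N (- br (\<I> u) v) = - N (br (\<I> u) v)"
      using NL(2)[of 0 "br (\<I> u) v"] NL(2)[of 0 0] by (simp add: k_closed br_k c v)
    then show "- 1 *\<^sub>R N (br (\<I> u) v) + N (br u (\<I> v)) = N (br v (\<I> u) + br u (\<I> v))"
      by (simp add: NL br_k c v u \<I>_k br_antisym[OF c v] k_closed)
  qed
  finally show ?thesis .
qed

end

section \<open>Derivatives along left invariant directions\<close>

definition flow_pt :: "'a \<Rightarrow> real^'m \<Rightarrow> real \<Rightarrow> 'a" where "flow_pt s \<xi> t = s \<otimes> E \<xi> t"

context
  fixes s :: 'a and \<xi> :: "real^'m"
  assumes s: "s \<in> carrier G" and \<xi>: "\<xi> \<in> kk"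
begin

lemma flow_pt: "flow_pt s \<xi> t \<in> carrier G" "flow_pt s \<xi> 0 = s"
  using s E[OF \<xi>] one_parameter_carrier one_parameter_zero by (auto simp: flow_pt_def)

lemma A_deriv: "((\<lambda>t. A (flow_pt s \<xi> t) v) has_vector_derivative A s (br \<xi> v)) (at 0)"
proof -
  have "bounded_linear (\<lambda>X. - br X w0)"
    using linear_compose[OF br_left[of w0] linear_uminus] by (simp add: o_def linear_conv_bounded_linear)
  from bounded_linear.has_vector_derivative[OF this Ad_one_parameter[OF s E[OF \<xi>]]]
  show ?thesis by (simp add: nh_form_def flow_pt_def)
qed

lemma A_line_deriv:
  "((\<lambda>t. A (flow_pt s \<xi> t) (u + t *\<^sub>R \<eta>)) has_vector_derivative A s (br \<xi> u) + A s \<eta>) (at 0)"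
proof -
  \<comment> \<open>At each t linearity separates u from t\<eta>, so derivatives for fixed vectors
    suffice; the term with \<open>br \<xi> \<eta>\<close> carries a factor t and drops out at
    0.\<close>
  have "((\<lambda>t. A (flow_pt s \<xi> t) u + t *\<^sub>R A (flow_pt s \<xi> t) \<eta>) has_vector_derivative
      A s (br \<xi> u) + (0 *\<^sub>R A s (br \<xi> \<eta>) + 1 *\<^sub>R A (flow_pt s \<xi> 0) \<eta>)) (at 0)"
    by (intro has_vector_derivative_add A_deriv has_vector_derivative_scaleR DERIV_ident)
  then show ?thesis by (simp add: flow_pt A_lin)
qed

lemma \<I>_line_deriv:
  assumes "u \<in> kk" "\<eta> \<in> kk"
  shows "((\<lambda>t. \<I> (u + t *\<^sub>R \<eta>)) has_vector_derivative \<I> \<eta>) (at 0)"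
proof -
  have "((\<lambda>t. \<I> u + t *\<^sub>R \<I> \<eta>) has_vector_derivative \<I> \<eta>) (at 0)"
    by (auto intro!: derivative_eq_intros)
  then show ?thesis using assms by (simp add: \<I>_add \<I>_scale k_closed)
qed

lemma ip_deriv:
  assumes "(f has_vector_derivative f') (at (0::real))" "(g has_vector_derivative g') (at 0)"
  shows "((\<lambda>t. ip (f t) (g t)) has_vector_derivative ip (f 0) g' + ip f' (g 0)) (at 0)"
  by (rule bounded_bilinear.has_vector_derivative[OF bounded_bilinear_ip assms])

lemma m_line_deriv:
  assumes u: "u \<in> kk" "\<eta> \<in> kk"
  shows "((\<lambda>t. m (flow_pt s \<xi> t) (u + t *\<^sub>R \<eta>) z) has_vector_derivative
     m s \<eta> z + ip (A s (br \<xi> u)) (A s z) + ip (A s u) (A s (br \<xi> z))) (at 0)"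
proof -
  have "((\<lambda>t. m (flow_pt s \<xi> t) (u + t *\<^sub>R \<eta>) z) has_vector_derivative
     (ip (\<I> (u + 0 *\<^sub>R \<eta>)) 0 + ip (\<I> \<eta>) z) +
     (ip (A (flow_pt s \<xi> 0) (u + 0 *\<^sub>R \<eta>)) (A s (br \<xi> z)) +
      ip (A s (br \<xi> u) + A s \<eta>) (A (flow_pt s \<xi> 0) z))) (at 0)"
    unfolding m_def
    by (intro has_vector_derivative_add ip_deriv A_line_deriv A_deriv \<I>_line_deriv u has_vector_derivative_const)
  then show ?thesis by (simp add: flow_pt m_def ip_linear algebra_simps)
qed

text \<open>The metric tensor is reached through its inner products with a dual basis, which are
  values of \<open>m\<close> along the curve with vertical velocity 0.\<close>

lemma M_deriv:
  assumes v: "v \<in> kk"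
  shows "((\<lambda>t. M (flow_pt s \<xi> t) v) has_vector_derivative Mp s \<xi> v) (at 0)"
proof -
  obtain D where D: "\<And>b. D b \<in> kk" "\<And>x. x \<in> kk \<Longrightarrow> (\<Sum>b\<in>k.B. ip x (D b) *\<^sub>R b) = x"
    by (rule dual_basis) blast
  have eq: "M (flow_pt s \<xi> t) v = (\<Sum>b\<in>k.B. m (flow_pt s \<xi> t) (v + t *\<^sub>R 0) (D b) *\<^sub>R b)" for t
    using D(2)[OF M_mem[OF flow_pt(1) v]] by (simp add: ip_M[OF flow_pt(1) v D(1)])
  have "((\<lambda>t. \<Sum>b\<in>k.B. m (flow_pt s \<xi> t) (v + t *\<^sub>R 0) (D b) *\<^sub>R b) has_vector_derivative
     (\<Sum>b\<in>k.B. (m s 0 (D b) + ip (A s (br \<xi> v)) (A s (D b)) + ip (A s v) (A s (br \<xi> (D b)))) *\<^sub>R b)) (at 0)"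
    by (intro has_vector_derivative_sum bounded_linear.has_vector_derivative[OF bounded_linear_scaleR_left]
        m_line_deriv v k_closed)
  also have "(\<Sum>b\<in>k.B. (m s 0 (D b) + ip (A s (br \<xi> v)) (A s (D b)) + ip (A s v) (A s (br \<xi> (D b)))) *\<^sub>R b)
     = (\<Sum>b\<in>k.B. ip (Mp s \<xi> v) (D b) *\<^sub>R b)"
  proof (rule sum.cong[OF refl])
    fix b
    have "m s 0 (D b) = 0" using m_left[OF s k_closed(5) k_closed(5), of 1 "D b"] by simp
    then show "(m s 0 (D b) + ip (A s (br \<xi> v)) (A s (D b)) + ip (A s v) (A s (br \<xi> (D b)))) *\<^sub>R b
       = ip (Mp s \<xi> v) (D b) *\<^sub>R b" by (simp add: ip_Mp[OF s v D(1)])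
  qed
  also have "\<dots> = Mp s \<xi> v" by (rule D(2)[OF k.endo_mem[OF endo_Mp[OF s] v]])
  finally show ?thesis unfolding eq .
qed

lemma deriv_TK_eq:
  assumes "((\<lambda>t. F (flow_pt s \<xi> t, u + t *\<^sub>R \<eta>)) has_vector_derivative D) (at 0)"
  shows "deriv_TK G F (s, u) (\<xi>, \<eta>) = D"
  using vector_derivative_at[OF assms] by (simp add: deriv_TK_def flow_pt_def E_def)

lemma deriv_liouville:
  assumes u: "u \<in> kk" "\<eta> \<in> kk" and z: "fst z \<in> kk"
  shows "deriv_TK G (\<lambda>q. liouville_form G \<theta> \<I> w0 q z) (s, u) (\<xi>, \<eta>)
    = m s \<eta> (fst z) + ip (A s (br \<xi> u)) (A s (fst z)) + ip (A s u) (A s (br \<xi> (fst z)))"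
proof (rule deriv_TK_eq)
  have "liouville_form G \<theta> \<I> w0 (flow_pt s \<xi> t, u + t *\<^sub>R \<eta>) z = m (flow_pt s \<xi> t) (u + t *\<^sub>R \<eta>) (fst z)" for t
    using u z by (simp add: liouville_form_def ip_M flow_pt k_closed)
  then show "((\<lambda>t. liouville_form G \<theta> \<I> w0 (flow_pt s \<xi> t, u + t *\<^sub>R \<eta>) z) has_vector_derivative
     m s \<eta> (fst z) + ip (A s (br \<xi> u)) (A s (fst z)) + ip (A s u) (A s (br \<xi> (fst z)))) (at 0)"
    using m_line_deriv[OF u] by simp
qed

lemma deriv_hamiltonian:
  assumes u: "u \<in> kk" "\<eta> \<in> kk"
  shows "deriv_TK G (compressed_hamiltonian G \<theta> \<I> w0) (s, u) (\<xi>, \<eta>) = m s \<eta> u + ip (A s (br \<xi> u)) (A s u)"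
proof (rule deriv_TK_eq)
  have line: "((\<lambda>t. u + t *\<^sub>R \<eta>) has_vector_derivative \<eta>) (at 0)"
    by (auto intro!: derivative_eq_intros)
  have "((\<lambda>t. (1/2) *\<^sub>R ip (\<I> (u + t *\<^sub>R \<eta>)) (u + t *\<^sub>R \<eta>)
        + (1/2) *\<^sub>R ip (A (flow_pt s \<xi> t) (u + t *\<^sub>R \<eta>)) (A (flow_pt s \<xi> t) (u + t *\<^sub>R \<eta>))) has_vector_derivative
     (1/2) *\<^sub>R (ip (\<I> (u + 0 *\<^sub>R \<eta>)) \<eta> + ip (\<I> \<eta>) (u + 0 *\<^sub>R \<eta>)) +
     (1/2) *\<^sub>R (ip (A (flow_pt s \<xi> 0) (u + 0 *\<^sub>R \<eta>)) (A s (br \<xi> u) + A s \<eta>) +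
      ip (A s (br \<xi> u) + A s \<eta>) (A (flow_pt s \<xi> 0) (u + 0 *\<^sub>R \<eta>)))) (at 0)"
    by (intro has_vector_derivative_add bounded_linear.has_vector_derivative[OF bounded_linear_scaleR_right]
        ip_deriv line A_line_deriv \<I>_line_deriv u)
  moreover have "(1/2) *\<^sub>R (ip (\<I> (u + 0 *\<^sub>R \<eta>)) \<eta> + ip (\<I> \<eta>) (u + 0 *\<^sub>R \<eta>)) +
     (1/2) *\<^sub>R (ip (A (flow_pt s \<xi> 0) (u + 0 *\<^sub>R \<eta>)) (A s (br \<xi> u) + A s \<eta>) +
      ip (A s (br \<xi> u) + A s \<eta>) (A (flow_pt s \<xi> 0) (u + 0 *\<^sub>R \<eta>))) = m s \<eta> u + ip (A s (br \<xi> u)) (A s u)"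
  proof -
    have "ip (\<I> u) \<eta> = ip (\<I> \<eta>) u" using \<I>_sym[OF u] ip_sym by metis
    moreover have "ip (A s u) (A s (br \<xi> u) + A s \<eta>) = ip (A s (br \<xi> u) + A s \<eta>) (A s u)" by (rule ip_sym)
    ultimately show ?thesis by (simp add: flow_pt m_def) (simp add: ip_linear)
  qed
  ultimately show "((\<lambda>t. compressed_hamiltonian G \<theta> \<I> w0 (flow_pt s \<xi> t, u + t *\<^sub>R \<eta>)) has_vector_derivative
     m s \<eta> u + ip (A s (br \<xi> u)) (A s u)) (at 0)"
    by (simp add: compressed_hamiltonian_def)
qed

lemma deriv_K_A: "deriv_K G (\<lambda>q. A q z) s \<xi> = A s (br \<xi> z)"
  using vector_derivative_at[OF A_deriv[of z]] by (simp add: deriv_K_def flow_pt_def E_def)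

end

section \<open>The two-forms and the equation of motion\<close>

lemma Omega_K_eq:
  assumes s: "s \<in> carrier G" and u: "u \<in> kk" and x: "x1 \<in> kk" "x2 \<in> kk" and v: "\<xi> \<in> kk" "\<eta> \<in> kk"
  shows "Omega_K G \<theta> \<I> w0 (s, u) (x1, x2) (\<xi>, \<eta>) = m s \<eta> x1 - m s x2 \<xi>
    - ip (A s (br x1 u)) (A s \<xi>) - ip (A s u) (A s (br x1 \<xi>))
    + ip (A s (br \<xi> u)) (A s x1) + ip (A s u) (A s (br \<xi> x1)) + m s u (br x1 \<xi>)"
proof -
  have 1: "deriv_TK G (\<lambda>q. liouville_form G \<theta> \<I> w0 q (\<xi>, \<eta>)) (s, u) (x1, x2)
      = m s x2 \<xi> + ip (A s (br x1 u)) (A s \<xi>) + ip (A s u) (A s (br x1 \<xi>))"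
    using deriv_liouville[OF s x(1) u x(2), of "(\<xi>, \<eta>)"] v by simp
  have 2: "deriv_TK G (\<lambda>q. liouville_form G \<theta> \<I> w0 q (x1, x2)) (s, u) (\<xi>, \<eta>)
      = m s \<eta> x1 + ip (A s (br \<xi> u)) (A s x1) + ip (A s u) (A s (br \<xi> x1))"
    using deriv_liouville[OF s v(1) u v(2), of "(x1, x2)"] x by simp
  show ?thesis
    unfolding Omega_K_def ext_deriv_def 1 2
    by (simp add: bracket_TK_def liouville_form_def ip_M s u x v br_k)
qed

lemma Omega_nh_eq:
  assumes s: "s \<in> carrier G" and u: "u \<in> kk" and x: "x1 \<in> kk" "x2 \<in> kk" and v: "\<xi> \<in> kk" "\<eta> \<in> kk"
  shows "Omega_nh G \<theta> \<I> w0 (s, u) (x1, x2) (\<xi>, \<eta>) = m s \<eta> x1 - m s x2 \<xi>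
    - ip (A s (br x1 u)) (A s \<xi>) + ip (A s (br \<xi> u)) (A s x1) + ip (\<I> u) (br x1 \<xi>)"
proof -
  have "ip (A s u) (A s (br \<xi> x1)) = - ip (A s u) (A s (br x1 \<xi>))"
    using br_antisym[OF x(1) v(1)] s by (simp add: A_lin ip_linear)
  \<comment> \<open>The two directional derivatives are \<open>A s (br x1 \<xi>)\<close> and
    \<open>A s (br \<xi> x1)\<close>; the bracket term cancels the former.\<close>
  moreover have "ext_deriv (deriv_K G) br A s x1 \<xi> = - A s (br \<xi> x1)"
    by (simp add: ext_deriv_def deriv_K_A s x v)
  ultimately show ?thesis
    by (simp add: Omega_nh_def Omega_K_eq assms m_def ip_linear)
qed

definition W :: "real^'m \<Rightarrow> real^'m" where "W u = - br u (\<I> u)"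

lemma W_k: "u \<in> kk \<Longrightarrow> W u \<in> kk"
  by (simp add: W_def k_closed br_k \<I>_k)

text \<open>Vertical test vectors (0, \<eta>) determine the velocity and horizontal ones (\<xi>, 0)
  the acceleration, both through definiteness.\<close>

lemma X_nh_eq:
  assumes s: "s \<in> carrier G" and u: "u \<in> kk"
  shows "X_nh G \<theta> \<I> w0 (s, u) = (u, N s (W u))"
  unfolding X_nh_def
proof (rule the_equality)
  let ?Z = "N s (W u)"
  have Z: "?Z \<in> kk" by (rule N_mem[OF s W_k[OF u]])
  \<comment> \<open>Skewness of \<open>br u\<close> brings the equation for Z into the form in which
    it occurs in \<open>Omega_nh_eq\<close>.\<close>
  have mZ: "m s ?Z \<xi> = ip (\<I> u) (br u \<xi>)" if "\<xi> \<in> kk" for \<xi>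
    using ip_M[OF s Z that] M_N[OF s W_k[OF u]] ip_skew[OF u \<I>_k[OF u] that] by (simp add: W_def ip_linear)
  show "(u, ?Z) \<in> kk \<times> kk \<and> (\<forall>v\<in>kk \<times> kk. Omega_nh G \<theta> \<I> w0 (s, u) (u, ?Z) v
      = deriv_TK G (compressed_hamiltonian G \<theta> \<I> w0) (s, u) v)"
    using s u Z by (auto simp: Omega_nh_eq deriv_hamiltonian mZ br_self A_lin ip_linear)
  fix x assume "x \<in> kk \<times> kk \<and> (\<forall>v\<in>kk \<times> kk. Omega_nh G \<theta> \<I> w0 (s, u) x v
      = deriv_TK G (compressed_hamiltonian G \<theta> \<I> w0) (s, u) v)"
  then obtain x1 x2 where x: "x = (x1, x2)" "x1 \<in> kk" "x2 \<in> kk" and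
    eq: "\<And>\<xi> \<eta>. \<xi> \<in> kk \<Longrightarrow> \<eta> \<in> kk \<Longrightarrow> Omega_nh G \<theta> \<I> w0 (s, u) (x1, x2) (\<xi>, \<eta>)
      = deriv_TK G (compressed_hamiltonian G \<theta> \<I> w0) (s, u) (\<xi>, \<eta>)" by auto
  have d: "x1 - u \<in> kk" using x u by (simp add: k_closed)
  have z: "m s 0 y = 0" "m s y 0 = 0" for y
    using m_left[OF s k_closed(5) k_closed(5), of 1 y] m_right[OF s, of y 1 0 0] by simp_all
  \<comment> \<open>The test vector (0, x1 - u) makes the difference of the two sides the squared
    length of \<open>x1 - u\<close>.\<close>
  have "m s (x1 - u) x1 = m s (x1 - u) u"
    using eq[OF k_closed(5) d] s u x d z by (simp add: Omega_nh_eq deriv_hamiltonian k_closed br_linear A_lin ip_linear)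
  then have "m s (x1 - u) (x1 - u) = 0"
    using m_right[OF s, of "x1 - u" "- 1" u x1] by simp
  then have x1: "x1 = u" using m_pos[OF s d] by force
  have "m s x2 \<xi> = m s ?Z \<xi>" if "\<xi> \<in> kk" for \<xi>
    using eq[OF that k_closed(5)] s u x z that
    by (simp add: Omega_nh_eq deriv_hamiltonian k_closed br_linear A_lin ip_linear x1 mZ br_self)
  then have "M s x2 = M s ?Z" using x Z by (intro ip_eqI) (simp_all add: ip_M s M_mem)
  then have "x2 = ?Z" using N_M[OF s x(3)] N_M[OF s Z] by metis
  with x x1 show "x = (u, ?Z)" by simp
qed

lemma W_line_deriv:
  assumes u: "u \<in> kk" "\<eta> \<in> kk"
  shows "((\<lambda>t. W (u + t *\<^sub>R \<eta>)) has_vector_derivative - (br u (\<I> \<eta>) + br \<eta> (\<I> u))) (at 0)"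
proof -
  have line: "((\<lambda>t. v + t *\<^sub>R w) has_vector_derivative w) (at 0)" for v w :: "real^'m"
    by (auto intro!: derivative_eq_intros)
  have bb: "bounded_bilinear br" using bilinear_lie_bracket bilinear_conv_bounded_bilinear by blast
  have "((\<lambda>t. - br (u + t *\<^sub>R \<eta>) (\<I> u + t *\<^sub>R \<I> \<eta>)) has_vector_derivative
      - (br (u + 0 *\<^sub>R \<eta>) (\<I> \<eta>) + br \<eta> (\<I> u + 0 *\<^sub>R \<I> \<eta>))) (at 0)"
    by (intro has_vector_derivative_minus bounded_bilinear.has_vector_derivative[OF bb] line)
  then show ?thesis using u by (simp add: W_def \<I>_add \<I>_scale k_closed)
qed

text \<open>\<open>N\<close> is a separate choice at each group element, so it is not differentiated
  directly: the second component solves a linear equation whose matrix and right-hand side have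
  known derivatives.\<close>

lemma deriv_X_nh:
  assumes s: "s \<in> carrier G" and u: "u \<in> kk" and v: "\<xi> \<in> kk" "\<eta> \<in> kk"
  shows "deriv_TK G (X_nh G \<theta> \<I> w0) (s, u) (\<xi>, \<eta>)
    = (\<eta>, N s (- (br u (\<I> \<eta>) + br \<eta> (\<I> u)) - Mp s \<xi> (N s (W u))))"
proof (rule deriv_TK_eq[OF s v(1)])
  let ?s = "flow_pt s \<xi>" and ?u = "\<lambda>t. u + t *\<^sub>R \<eta>"
  have sc: "?s t \<in> carrier G" and s0: "?s 0 = s" for t using flow_pt[OF s v(1)] by auto
  have uk: "?u t \<in> kk" for t using u v by (simp add: k_closed)
  have "((\<lambda>t. N (?s t) (W (?u t))) has_vector_derivative
     N s (- (br u (\<I> \<eta>) + br \<eta> (\<I> u)) - Mp s \<xi> (N (?s 0) (W (?u 0))))) (at 0)"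
  proof (rule k.solution_has_vector_derivative[where M = "\<lambda>t. M (?s t)" and w = "\<lambda>t. W (?u t)"])
    show "k.endo (M (?s t))" for t by (rule endo_M[OF sc])
    show "Mp s \<xi> x \<in> kk" if "x \<in> kk" for x by (rule k.endo_mem[OF endo_Mp[OF s] that])
    show "((\<lambda>t. M (?s t) x) has_vector_derivative Mp s \<xi> x) (at 0)" if "x \<in> kk" for x
      by (rule M_deriv[OF s v(1) that])
    show "k.endo (N s)" by (rule endo_N[OF s])
    show "N s (M (?s 0) x) = x" if "x \<in> kk" for x by (simp add: s0 N_M[OF s that])
    show "N (?s t) (W (?u t)) \<in> kk" for t by (rule N_mem[OF sc W_k[OF uk]])
    show "M (?s t) (N (?s t) (W (?u t))) = W (?u t)" for t by (rule M_N[OF sc W_k[OF uk]])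
    show "- (br u (\<I> \<eta>) + br \<eta> (\<I> u)) \<in> kk" by (simp add: k_closed br_k \<I>_k u v)
    show "((\<lambda>t. W (?u t)) has_vector_derivative - (br u (\<I> \<eta>) + br \<eta> (\<I> u))) (at 0)"
      by (rule W_line_deriv[OF u v(2)])
  qed
  moreover have "(?u has_vector_derivative \<eta>) (at 0)" by (auto intro!: derivative_eq_intros)
  ultimately have "((\<lambda>t. (?u t, N (?s t) (W (?u t)))) has_vector_derivative
     (\<eta>, N s (- (br u (\<I> \<eta>) + br \<eta> (\<I> u)) - Mp s \<xi> (N (?s 0) (W (?u 0)))))) (at 0)"
    by (intro has_vector_derivative_Pair)
  then show "((\<lambda>t. X_nh G \<theta> \<I> w0 (?s t, ?u t)) has_vector_derivative
     (\<eta>, N s (- (br u (\<I> \<eta>) + br \<eta> (\<I> u)) - Mp s \<xi> (N s (W u))))) (at 0)"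
    by (simp add: X_nh_eq[OF sc uk] s0)
qed

section \<open>The volume form and its Lie derivative\<close>

text \<open>The canonical form with the metric tensor replaced by the identity and the horizontal part
  dropped.\<close>

definition Omega0 :: "(real^'m) \<times> (real^'m) \<Rightarrow> (real^'m) \<times> (real^'m) \<Rightarrow> real" where
  "Omega0 v w = ip (snd w) (fst v) - ip (snd v) (fst w)"

abbreviation d :: nat where "d \<equiv> dim kk"
abbreviation vol :: "(nat \<Rightarrow> (real^'m) \<times> (real^'m)) \<Rightarrow> real" where "vol \<equiv> wedge_power Omega0 d"

lemma alternating_vol: "alternating_form {..<2 * d} (kk \<times> kk) vol"
  by (rule alternating_form_wedge_power) (simp_all add: Omega0_def ip_linear algebra_simps)

lemma wedge_power_Omega_K:
  assumes s: "s \<in> carrier G" and u: "u \<in> kk" and y: "y \<in> {..<2 * d} \<rightarrow> kk \<times> kk"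
  shows "wedge_power (Omega_K G \<theta> \<I> w0 (s, u)) d y = det_on kk (M s) * vol y"
proof -
  \<comment> \<open>The purely horizontal part of \<open>Omega_K\<close> is to be \<gamma>(w, v) -
    \<gamma>(v, w) in the horizontal components. Its bracket term is antisymmetric already and is
    therefore split into two halves.\<close>
  let ?\<gamma> = "\<lambda>v w. ip (A s (br v u)) (A s w) + ip (A s u) (A s (br v w)) - m s u (br v w) / 2"
  have z: "m s u 0 = 0" using m_right[OF s, of u 1 0 0] by simp
  have mu: "m s u (x + z) = m s u x + m s u z" "m s u (a *\<^sub>R x) = a * m s u x" for a x z
    using m_right[OF s, of u 1 x z] m_right[OF s, of u a x 0] z by simp_all
  have "\<exists>C. k.endo C \<and> (\<forall>v\<in>kk. \<forall>w\<in>kk. ip (C v) w = ?\<gamma> v w)"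
    by (rule endo_form)
      (simp_all add: br_linear A_lin[OF s] ip_linear mu algebra_simps add_divide_distrib)
  then obtain C where C: "k.endo C" "\<And>v w. v \<in> kk \<Longrightarrow> w \<in> kk \<Longrightarrow> ip (C v) w = ?\<gamma> v w" by blast
  let ?T = "\<lambda>v. (fst v, M s (snd v) + C (fst v))"
  have "Omega_K G \<theta> \<I> w0 (s, u) v w = Omega0 (?T v) (?T w)" if "v \<in> kk \<times> kk" "w \<in> kk \<times> kk" for v w
  proof -
    obtain x1 x2 \<xi> \<eta> where vw: "v = (x1, x2)" "w = (\<xi>, \<eta>)" by (cases v, cases w)
    then have mem: "x1 \<in> kk" "x2 \<in> kk" "\<xi> \<in> kk" "\<eta> \<in> kk" using that by auto
    have "m s u (br \<xi> x1) = - m s u (br x1 \<xi>)"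
      using m_right[OF s, of u "- 1" "br x1 \<xi>" 0] z by (simp add: br_antisym[OF mem(1,3)])
    then show ?thesis
      unfolding vw Omega_K_eq[OF s u mem] Omega0_def
      by (simp add: ip_linear ip_M[OF s] C(2) mem)
  qed
  then have "wedge_power (Omega_K G \<theta> \<I> w0 (s, u)) d y = wedge_power (\<lambda>v w. Omega0 (?T v) (?T w)) d y"
    using y by (rule wedge_power_cong)
  also have "\<dots> = vol (\<lambda>i. ?T (y i))" by (rule wedge_power_compose)
  \<comment> \<open>A shear leaves top-degree forms unchanged, so the horizontal part of
    \<open>Omega_K\<close> is not seen by its top power.\<close>
  also have "\<dots> = vol (\<lambda>i. (fst (y i), M s (snd (y i))))"
    using k.alternating_form_shear[OF alternating_vol C(1), of "\<lambda>i. (fst (y i), M s (snd (y i)))"] y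
    by (simp add: Pi_iff mem_Times_iff M_mem[OF s])
  also have "\<dots> = det_on kk (M s) * vol y"
    by (rule k.alternating_form_diag[OF alternating_vol endo_M[OF s] y])
  finally show ?thesis .
qed

text \<open>On constant fields both parts of the Lie derivative are multiples of
  \<open>vol y\<close>: the derivative of the coefficient along the flow, and the slot sum, which is
  a trace.\<close>

theorem lie_derivative_volume:
  assumes s: "s \<in> carrier G" and u: "u \<in> kk" and y: "y \<in> {..<2 * d} \<rightarrow> kk \<times> kk"
  shows "lie_derivative G (X_nh G \<theta> \<I> w0) (2 * d)
    (\<lambda>q y. nh_density G \<theta> \<I> w0 (fst q) * wedge_power (Omega_K G \<theta> \<I> w0 q) d y) (s, u) y = 0"
proof -
  let ?F = "\<lambda>q y. nh_density G \<theta> \<I> w0 (fst q) * wedge_power (Omega_K G \<theta> \<I> w0 q) d y"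
  let ?X = "X_nh G \<theta> \<I> w0" and ?Z = "N s (W u)" and ?D = "det_on kk (M s)"
  let ?tr = "k.tr (\<lambda>v. N s (br v (\<I> u) + br u (\<I> v)))"
  have Z: "?Z \<in> kk" by (rule N_mem[OF s W_k[OF u]])
  have F: "?F (s', u') y' = det_on kk (M s') powr (1/2) * vol y'"
    if "s' \<in> carrier G" "u' \<in> kk" "y' \<in> {..<2 * d} \<rightarrow> kk \<times> kk" for s' u' y'
  proof -
    have "det_on kk (M s') powr (-1/2) * det_on kk (M s') = det_on kk (M s') powr (1/2)"
      using det_M_pos[OF that(1)] powr_mult_base[of "det_on kk (M s')" "-1/2"] by (simp add: mult.commute)
    then show ?thesis by (simp add: wedge_power_Omega_K[OF that] nh_density_def)
  qed
  have 1: "deriv_TK G (\<lambda>q. ?F q y) (s, u) (?X (s, u)) = ?D powr (1/2) * ?tr * vol y"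
    unfolding X_nh_eq[OF s u]
  proof (rule deriv_TK_eq[OF s u])
    let ?s = "flow_pt s u"
    have sc: "?s t \<in> carrier G" and s0: "?s 0 = s" for t using flow_pt[OF s u] by auto
    have "((\<lambda>t. det_on kk (M (?s t))) has_real_derivative
        det_on kk (M (?s 0)) * k.tr (\<lambda>v. N s (Mp s u v))) (at 0)"
      by (rule k.det_on_has_derivative[where M = "\<lambda>t. M (?s t)"])
        (simp_all add: endo_M sc M_deriv s u k.endo_mem[OF endo_Mp] endo_N N_M M_N s0)
    then have "((\<lambda>t. det_on kk (M (?s t))) has_real_derivative ?D * (2 * ?tr)) (at 0)"
      by (simp add: s0 trace_identity[OF s u])
    from DERIV_fun_powr[OF this, of "1/2"]
    have d2: "((\<lambda>t. det_on kk (M (?s t)) powr (1/2)) has_real_derivative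
        1/2 * ?D powr (1/2 - 1) * (?D * (2 * ?tr))) (at 0)"
      using det_M_pos[OF s] by (simp add: s0)
    \<comment> \<open>The exponent 1/2 meets the factor 2 of \<open>trace_identity\<close>.\<close>
    have e2: "1/2 * ?D powr (1/2 - 1) * (?D * (2 * ?tr)) = ?D powr (1/2) * ?tr"
      using det_M_pos[OF s] powr_mult_base[of ?D "-1/2"] by (simp add: mult.commute)
    have "((\<lambda>t. det_on kk (M (?s t)) powr (1/2) * vol y) has_real_derivative
       ?D powr (1/2) * ?tr * vol y) (at 0)"
      by (rule DERIV_cmult_right[OF d2[unfolded e2]])
    moreover have "?F (?s t, u + t *\<^sub>R ?Z) y = det_on kk (M (?s t)) powr (1/2) * vol y" for t
      by (rule F[OF sc _ y]) (simp add: k_closed u Z)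
    ultimately show "((\<lambda>t. ?F (?s t, u + t *\<^sub>R ?Z) y) has_vector_derivative ?D powr (1/2) * ?tr * vol y) (at 0)"
      by (simp add: has_real_derivative_iff_has_vector_derivative)
  qed
  \<comment> \<open>The bracket of \<open>X_nh\<close> with the constant field v: minus the
    derivative of \<open>X_nh\<close> along v, plus the bracket of left invariant fields in the
    first component.\<close>
  define L where "L = (\<lambda>v. (br u (fst v) - snd v,
     - N s (- (br u (\<I> (snd v)) + br (snd v) (\<I> u)) - Mp s (fst v) ?Z)))"
  have fb: "field_bracket G ?X (\<lambda>_. y i) (s, u) = L (y i)" if "i < 2 * d" for i
  proof -
    obtain \<xi> \<eta> where yi: "y i = (\<xi>, \<eta>)" by (cases "y i")
    have "y i \<in> kk \<times> kk" using y that by (simp add: Pi_iff)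
    then have k: "\<xi> \<in> kk" "\<eta> \<in> kk" by (simp_all add: yi)
    have "deriv_TK G (\<lambda>_. y i) (s, u) (?X (s, u)) = 0"
      by (simp add: deriv_TK_def)
    then show ?thesis
      by (simp add: field_bracket_def yi deriv_X_nh[OF s u k] bracket_TK_def X_nh_eq[OF s u] L_def)
  qed
  have NL: "N s (a *\<^sub>R x + z) = a *\<^sub>R N s x + N s z" if "x \<in> kk" "z \<in> kk" for a x z
    by (rule k.endo_lin[OF endo_N[OF s] that])
  have L_mem: "L v \<in> kk \<times> kk" if "v \<in> kk \<times> kk" for v
    using that by (auto simp: L_def intro!: k_closed br_k \<I>_k u N_mem[OF s] k.endo_mem[OF endo_Mp[OF s]] Z)
  have L_lin: "L (a *\<^sub>R v + w) = a *\<^sub>R L v + L w" if "v \<in> kk \<times> kk" "w \<in> kk \<times> kk" for a v w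
  proof -
    obtain x1 x2 \<xi> \<eta> where vw: "v = (x1, x2)" "w = (\<xi>, \<eta>)" by (cases v, cases w)
    then have mem: "x1 \<in> kk" "x2 \<in> kk" "\<xi> \<in> kk" "\<eta> \<in> kk" using that by auto
    let ?P = "\<lambda>x1 x2. - (br u (\<I> x2) + br x2 (\<I> u)) - Mp s x1 ?Z"
    have P: "?P p q \<in> kk" if "p \<in> kk" "q \<in> kk" for p q
      by (intro k_closed br_k \<I>_k u that k.endo_mem[OF endo_Mp[OF s]] Z)
    have "?P (a *\<^sub>R x1 + \<xi>) (a *\<^sub>R x2 + \<eta>) = a *\<^sub>R ?P x1 x2 + ?P \<xi> \<eta>"
      unfolding Mp_linear[OF s Z] k.endo_lin[OF endo_\<I> mem(2,4)] by (simp add: br_linear algebra_simps)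
    then have "N s (?P (a *\<^sub>R x1 + \<xi>) (a *\<^sub>R x2 + \<eta>)) = a *\<^sub>R N s (?P x1 x2) + N s (?P \<xi> \<eta>)"
      using NL[OF P[OF mem(1,2)] P[OF mem(3,4)]] by simp
    then show ?thesis unfolding vw L_def by (simp add: br_linear algebra_simps)
  qed
  have yi: "y(i := L (y i)) \<in> {..<2 * d} \<rightarrow> kk \<times> kk" if "i < 2 * d" for i
    using y L_mem that by (simp add: Pi_iff)
  have "(\<Sum>i<2 * d. ?F (s, u) (y(i := field_bracket G ?X (\<lambda>_. y i) (s, u))))
      = (\<Sum>i<2 * d. ?D powr (1/2) * vol (y(i := L (y i))))"
    by (intro sum.cong refl) (simp only: fb lessThan_iff F[OF s u yi])
  also have "\<dots> = ?D powr (1/2) * (\<Sum>i<2 * d. vol (y(i := L (y i))))"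
    by (simp add: sum_distrib_left)
  also have "(\<Sum>i<2 * d. vol (y(i := L (y i))))
      = (k.tr (\<lambda>v. fst (L (v, 0))) + k.tr (\<lambda>v. snd (L (0, v)))) * vol y"
    by (rule k.alternating_form_trace_prod[OF alternating_vol L_mem L_lin y])
  also have "k.tr (\<lambda>v. fst (L (v, 0))) = 0" using tr_br[OF u] by (simp add: L_def)
  also have "k.tr (\<lambda>v. snd (L (0, v))) = ?tr"
  proof (rule k.tr_cong)
    fix v assume v: "v \<in> kk"
    \<comment> \<open>The derivative of the metric acts on the horizontal component and lands in the
      vertical one, so it sits off the diagonal and vanishes here.\<close>
    have M0: "Mp s 0 ?Z = 0" using Mp_linear[OF s Z, of 1 0 0] by simp
    have mem: "br v (\<I> u) + br u (\<I> v) \<in> kk" by (intro k_closed br_k \<I>_k u v)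
    have "N s 0 = 0" using NL[OF k_closed(5) k_closed(5), of 1] by simp
    then have "N s (- (br u (\<I> v) + br v (\<I> u))) = - N s (br v (\<I> u) + br u (\<I> v))"
      using NL[OF mem k_closed(5), of "- 1"] by (simp add: add.commute)
    then show "snd (L (0, v)) = N s (br v (\<I> u) + br u (\<I> v))" by (simp add: L_def M0)
  qed
  finally have S: "(\<Sum>i<2 * d. ?F (s, u) (y(i := field_bracket G ?X (\<lambda>_. y i) (s, u))))
      = ?D powr (1/2) * ((0 + ?tr) * vol y)" .
  show ?thesis unfolding lie_derivative_def 1 S by (simp only: add_0_left mult.assoc diff_self)
qed

end

theorem proposition3p4:
  fixes G :: "('a, real^'m) lie_data"
    and \<theta> \<I> :: "real^'m \<Rightarrow> real^'m"
    and K :: "'a set" and \<aa> :: "(real^'m) set" and w0 :: "real^'m"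
    and d :: nat
  assumes "semisimple_lie_group G"
    and "cartan_decomposition G \<theta> K"
    and "maximal_abelian_in G (p_part \<theta>) \<aa>"
    and "w0 \<in> \<aa>"
    and "inertia_tensor G \<theta> \<I>"
    and "d = dim (lie_algebra_of G K)"
  shows "\<forall>q \<in> K \<times> k_part \<theta>. \<forall>y. (\<forall>i<2*d. y i \<in> k_part \<theta> \<times> k_part \<theta>) \<longrightarrow>
    lie_derivative G (X_nh G \<theta> \<I> w0) (2*d)
      (\<lambda>q y. nh_density G \<theta> \<I> w0 (fst q) * wedge_power (Omega_K G \<theta> \<I> w0 q) d y) q y = 0"
proof (intro ballI allI impI)
  fix q y assume q: "q \<in> K \<times> k_part \<theta>" and y: "\<forall>i<2*d. y i \<in> k_part \<theta> \<times> k_part \<theta>"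
  have lie: "lie_group G" using assms(1) by (simp add: semisimple_lie_group_def)
  have inv: "cartan_involution G \<theta>" and K: "subgroup K G" and kK: "lie_algebra_of G K = k_part \<theta>"
    using assms(2) by (simp_all add: cartan_decomposition_def)
  have "\<exists>\<gamma>. one_parameter_subgroup G X \<gamma>" if "X \<in> k_part \<theta>" for X
    using that unfolding kK[symmetric] lie_algebra_of_def by blast
  then interpret compressed G \<theta> \<I> w0
    using lie inv assms(5)
    by (intro compressed.intro cartan.intro lie.intro cartan_axioms.intro lie_axioms.intro compressed_axioms.intro)
      (simp_all add: lie_group_def)
  obtain s u where su: "q = (s, u)" "s \<in> K" "u \<in> k_part \<theta>" using q by (cases q) auto
  have "s \<in> carrier G" using subgroup.subset[OF K] su(2) by blast
  \<comment> \<open>The degree is given by the Lie algebra of K, the tangent vectors by k; the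
    Cartan decomposition identifies the two.\<close>
  moreover have d: "d = dim (k_part \<theta>)" by (simp add: assms(6) kK)
  moreover have "y \<in> {..<2 * dim (k_part \<theta>)} \<rightarrow> k_part \<theta> \<times> k_part \<theta>" using y d by auto
  ultimately show "lie_derivative G (X_nh G \<theta> \<I> w0) (2*d)
      (\<lambda>q y. nh_density G \<theta> \<I> w0 (fst q) * wedge_power (Omega_K G \<theta> \<I> w0 q) d y) q y = 0"
    using lie_derivative_volume[of s u y] su by simp
qed

end
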